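(* Fix $d\ge 2$. Both of the following problems are undecidable: ($\mathcal{P}_N$) given two stochastic cellular automata of dimension $d$ with explicit global functions $F$ and $G$, decide whether $\mathcal{N}_F=\mathcal{N}_G$; ($\mathcal{P}_S$) given two stochastic cellular automata of dimension $d$ with explicit global functions $F$ and $G$, decide whether $\mathcal{S}_F=\mathcal{S}_G$.
   Context: A stochastic cellular automaton (stochastic CA) of dimension $d$ is a tuple $\mathcal{A}=(Q,R,V,V',f)$ where $Q$ (states) and $R$ (random symbols) are finite sets, $V=\{v_1,\dots,v_\rho\}$ and $V'=\{v'_1,\dots,v'_{\rho'}\}$ are finite subsets of $\mathbb{Z}^d$, and $f:Q^\rho\times R^{\rho'}\to Q$ is the local function. Its explicit global function $F:Q^{\mathbb{Z}^d}\times R^{\mathbb{Z}^d}\to Q^{\mathbb{Z}^d}$ is $F(c,s)_z=f\big((c_{z+v_1},\dots,c_{z+v_\rho}),(s_{z+v'_1},\dots,s_{z+v'_{\rho'}})\big)$. Its non-deterministic global function is $\mathcal{N}_F(c)=\{F(c,s):s\in R^{\mathbb{Z}^d}\}$ for $c\in Q^{\mathbb{Z}^d}$. Its stochastic global function maps $c$ to the Borel probability measure $\mathcal{S}_F(c)$ on $Q^{\mathbb{Z}^d}$ that is the law of $F(c,s)$ when $s$ is drawn from the uniform (i.i.d. uniform product) measure $\nu_R$ on $R^{\mathbb{Z}^d}$. CA are given as inputs by their finite description $(Q,R,V,V',f)$. *)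

theory Defs
  imports "HOL-Probability.Probability" "HOL-Library.Nat_Bijection"
begin

section \<open>Stochastic cellular automata\<close>

text \<open>
  The lattice of dimension \<open>d\<close> is the set of integer lists of length \<open>d\<close>, so that \<open>d\<close> stays an
  ordinary natural number and vectors can be part of a finite description.
\<close>

definition lattice :: "nat \<Rightarrow> int list set" where
  "lattice d = {v. length v = d}"

definition vadd :: "int list \<Rightarrow> int list \<Rightarrow> int list" where
  "vadd u v = map2 (+) u v"

definition configs :: "nat \<Rightarrow> nat set \<Rightarrow> (int list \<Rightarrow> nat) set" where
  "configs d Q = lattice d \<rightarrow>\<^sub>E Q"

text \<open>
  The tuple \<open>(Q, R, V, V', f)\<close>. States and random symbols are natural numbers, so that they can be
  handed to an algorithm. The neighbourhoods \<open>V\<close> and \<open>V'\<close> come with the enumeration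
  that fixes the order of the arguments of \<open>f\<close>. The values of \<open>f\<close> outside of
  \<open>Q\<^sup>\<rho> \<times> R\<^sup>\<rho>\<^sup>'\<close> are never used, neither by the global functions nor by the description.
\<close>

record stoch_ca =
  states :: "nat set"
  rsymbols :: "nat set"
  nbhd :: "int list list"
  rnbhd :: "int list list"
  local_fun :: "nat list \<Rightarrow> nat list \<Rightarrow> nat"

definition is_stoch_ca :: "nat \<Rightarrow> stoch_ca \<Rightarrow> bool" where
  "is_stoch_ca d A \<longleftrightarrow>
     finite (states A) \<and> states A \<noteq> {} \<and>
     finite (rsymbols A) \<and> rsymbols A \<noteq> {} \<and>
     distinct (nbhd A) \<and> set (nbhd A) \<subseteq> lattice d \<and>
     distinct (rnbhd A) \<and> set (rnbhd A) \<subseteq> lattice d \<and>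
     (\<forall>qs rs. set qs \<subseteq> states A \<and> length qs = length (nbhd A) \<and>
              set rs \<subseteq> rsymbols A \<and> length rs = length (rnbhd A) \<longrightarrow>
              local_fun A qs rs \<in> states A)"

definition explicit_global ::
  "nat \<Rightarrow> stoch_ca \<Rightarrow> (int list \<Rightarrow> nat) \<Rightarrow> (int list \<Rightarrow> nat) \<Rightarrow> (int list \<Rightarrow> nat)" where
  "explicit_global d A c s =
     (\<lambda>z\<in>lattice d. local_fun A (map (\<lambda>v. c (vadd z v)) (nbhd A))
                               (map (\<lambda>v. s (vadd z v)) (rnbhd A)))"

definition nondet_global :: "nat \<Rightarrow> stoch_ca \<Rightarrow> (int list \<Rightarrow> nat) \<Rightarrow> (int list \<Rightarrow> nat) set" where
  "nondet_global d A c = {explicit_global d A c s | s. s \<in> configs d (rsymbols A)}"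

definition random_config :: "nat \<Rightarrow> nat set \<Rightarrow> (int list \<Rightarrow> nat) measure" where
  "random_config d R = (\<Pi>\<^sub>M z\<in>lattice d. uniform_count_measure R)"

text \<open>
  As the lattice is countable and \<open>Q\<close> is finite and discrete, the product sigma-algebra used here is
  the Borel sigma-algebra of the product topology on the space of configurations.
\<close>

definition stoch_global :: "nat \<Rightarrow> stoch_ca \<Rightarrow> (int list \<Rightarrow> nat) \<Rightarrow> (int list \<Rightarrow> nat) measure" where
  "stoch_global d A c =
     distr (random_config d (rsymbols A)) (\<Pi>\<^sub>M z\<in>lattice d. count_space (states A))
       (explicit_global d A c)"

text \<open>
  Equality of the global functions, as functions on \<open>configs d Q\<close>: the domains must agree, and the
  values must agree on the common domain.
\<close>

definition nondet_equal :: "nat \<Rightarrow> stoch_ca \<Rightarrow> stoch_ca \<Rightarrow> bool" where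
  "nondet_equal d A B \<longleftrightarrow> states A = states B \<and>
     (\<forall>c\<in>configs d (states A). nondet_global d A c = nondet_global d B c)"

definition stoch_equal :: "nat \<Rightarrow> stoch_ca \<Rightarrow> stoch_ca \<Rightarrow> bool" where
  "stoch_equal d A B \<longleftrightarrow> states A = states B \<and>
     (\<forall>c\<in>configs d (states A). stoch_global d A c = stoch_global d B c)"

lemma vadd_in_lattice: "u \<in> lattice d \<Longrightarrow> v \<in> lattice d \<Longrightarrow> vadd u v \<in> lattice d"
  by (simp add: lattice_def vadd_def)

lemma explicit_global_in_configs:
  assumes "is_stoch_ca d A" "c \<in> configs d (states A)" "s \<in> configs d (rsymbols A)"
  shows "explicit_global d A c s \<in> configs d (states A)"
proof -
  have "local_fun A (map (\<lambda>v. c (vadd z v)) (nbhd A)) (map (\<lambda>v. s (vadd z v)) (rnbhd A)) \<in> states A"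
    if "z \<in> lattice d" for z
  proof -
    have "set (map (\<lambda>v. c (vadd z v)) (nbhd A)) \<subseteq> states A"
      using assms that vadd_in_lattice unfolding is_stoch_ca_def configs_def by (auto simp: PiE_def Pi_def)
    moreover have "set (map (\<lambda>v. s (vadd z v)) (rnbhd A)) \<subseteq> rsymbols A"
      using assms that vadd_in_lattice unfolding is_stoch_ca_def configs_def by (auto simp: PiE_def Pi_def)
    ultimately show ?thesis
      using assms(1) unfolding is_stoch_ca_def by (metis length_map)
  qed
  then show ?thesis
    by (auto simp: explicit_global_def configs_def)
qed

lemma measurable_map_count_space:
  assumes "\<And>v. v \<in> set vs \<Longrightarrow> g v \<in> measurable M (count_space (UNIV :: nat set))"
  shows "(\<lambda>s. map (\<lambda>v. g v s) vs) \<in> measurable M (count_space UNIV)"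
  using assms
proof (induction vs)
  case (Cons v vs)
  have 1: "g v \<in> measurable M (count_space UNIV)"
    and 2: "(\<lambda>s. map (\<lambda>v. g v s) vs) \<in> measurable M (count_space UNIV)"
    using Cons by auto
  have "(\<lambda>s. (g v s, map (\<lambda>v. g v s) vs))
      \<in> measurable M (count_space UNIV \<Otimes>\<^sub>M count_space UNIV)"
    using 1 2 by measurable
  then have "(\<lambda>s. (g v s, map (\<lambda>v. g v s) vs)) \<in> measurable M (count_space UNIV)"
    by (simp add: pair_measure_countable)
  from measurable_compose[OF this, of "\<lambda>(x, xs). x # xs" "count_space UNIV"] show ?case
    by simp
qed simp

lemma explicit_global_measurable:
  assumes "is_stoch_ca d A" "c \<in> configs d (states A)"
  shows "explicit_global d A c \<in> measurable (random_config d (rsymbols A))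
           (\<Pi>\<^sub>M z\<in>lattice d. count_space (states A))"
proof (rule measurable_PiM_single')
  have sp: "space (random_config d (rsymbols A)) = configs d (rsymbols A)"
    by (simp add: random_config_def configs_def space_PiM space_uniform_count_measure)
  show "explicit_global d A c \<in> space (random_config d (rsymbols A)) \<rightarrow>
          (\<Pi>\<^sub>E z\<in>lattice d. space (count_space (states A)))"
    using explicit_global_in_configs[OF assms] sp by (auto simp: configs_def)
  fix z assume z: "z \<in> lattice d"
  have comp: "(\<lambda>s. s (vadd z v)) \<in> measurable (random_config d (rsymbols A)) (count_space UNIV)"
    if "v \<in> set (rnbhd A)" for v
  proof -
    have "vadd z v \<in> lattice d"
      using that z assms vadd_in_lattice unfolding is_stoch_ca_def by blast
    then have 1: "(\<lambda>s. s (vadd z v)) \<in> measurable (random_config d (rsymbols A))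
        (uniform_count_measure (rsymbols A))"
      unfolding random_config_def by (rule measurable_component_singleton)
    have 2: "(\<lambda>x. x) \<in> measurable (uniform_count_measure (rsymbols A)) (count_space UNIV)"
      by (auto simp: measurable_def sets_uniform_count_measure space_uniform_count_measure)
    show ?thesis
      using measurable_compose[OF 1 2] .
  qed
  have "(\<lambda>s. map (\<lambda>v. s (vadd z v)) (rnbhd A))
      \<in> measurable (random_config d (rsymbols A)) (count_space UNIV)"
    by (rule measurable_map_count_space) (rule comp)
  from measurable_compose[OF this,
      of "\<lambda>rs. local_fun A (map (\<lambda>v. c (vadd z v)) (nbhd A)) rs" "count_space UNIV"]
  have "(\<lambda>s. explicit_global d A c s z) \<in> measurable (random_config d (rsymbols A)) (count_space UNIV)"
    using z by (simp add: explicit_global_def)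
  moreover have "explicit_global d A c s z \<in> states A" if "s \<in> space (random_config d (rsymbols A))" for s
    using explicit_global_in_configs[OF assms] that z sp by (auto simp: configs_def)
  ultimately show "(\<lambda>s. explicit_global d A c s z)
      \<in> measurable (random_config d (rsymbols A)) (count_space (states A))"
    by (auto simp: measurable_def)
qed


section \<open>Finite descriptions\<close>

text \<open>
  The local function is given by its full table: the argument tuples are listed in lexicographic
  order, with the symbols of \<open>Q\<close> and \<open>R\<close> in increasing order.
\<close>

definition fun_table :: "stoch_ca \<Rightarrow> nat list" where
  "fun_table A =
     [local_fun A qs rs.
        qs \<leftarrow> List.n_lists (length (nbhd A)) (sorted_list_of_set (states A)),
        rs \<leftarrow> List.n_lists (length (rnbhd A)) (sorted_list_of_set (rsymbols A))]"

definition vector_code :: "int list \<Rightarrow> nat" where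
  "vector_code v = list_encode (map int_encode v)"

definition ca_code :: "stoch_ca \<Rightarrow> nat" where
  "ca_code A = list_encode
     [list_encode (sorted_list_of_set (states A)),
      list_encode (sorted_list_of_set (rsymbols A)),
      list_encode (map vector_code (nbhd A)),
      list_encode (map vector_code (rnbhd A)),
      list_encode (fun_table A)]"

definition ca_pair_code :: "stoch_ca \<times> stoch_ca \<Rightarrow> nat" where
  "ca_pair_code = (\<lambda>(A, B). prod_encode (ca_code A, ca_code B))"

definition ca_pairs :: "nat \<Rightarrow> (stoch_ca \<times> stoch_ca) set" where
  "ca_pairs d = {A. is_stoch_ca d A} \<times> {B. is_stoch_ca d B}"


section \<open>Decidability\<close>

text \<open>
  Kleene's partial recursive functions. \<open>evals p xs y\<close> means that the function denoted by \<open>p\<close> is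
  defined at \<open>xs\<close> with value \<open>y\<close>; terms carry no arity, and are undefined on argument lists that are
  too short (or not of length one, for the successor). The recursion variable of \<open>PrimRec\<close> and the
  search variable of \<open>Mu\<close> are the first argument.
\<close>

datatype recf = Zero | Succ | Proj nat | Comp recf "recf list" | PrimRec recf recf | Mu recf

inductive evals :: "recf \<Rightarrow> nat list \<Rightarrow> nat \<Rightarrow> bool" where
  evals_Zero: "evals Zero xs 0"
| evals_Succ: "evals Succ [x] (Suc x)"
| evals_Proj: "i < length xs \<Longrightarrow> evals (Proj i) xs (xs ! i)"
| evals_Comp: "list_all2 (\<lambda>g y. evals g xs y) gs ys \<Longrightarrow> evals f ys z \<Longrightarrow> evals (Comp f gs) xs z"
| evals_PrimRec_0: "evals f xs y \<Longrightarrow> evals (PrimRec f g) (0 # xs) y"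
| evals_PrimRec_Suc: "evals (PrimRec f g) (n # xs) y \<Longrightarrow> evals g (y # n # xs) z \<Longrightarrow>
    evals (PrimRec f g) (Suc n # xs) z"
| evals_Mu: "evals f (n # xs) 0 \<Longrightarrow> (\<And>m. m < n \<Longrightarrow> \<exists>k. evals f (m # xs) (Suc k)) \<Longrightarrow>
    evals (Mu f) xs n"

inductive_cases evals_ZeroE: "evals Zero xs y"
inductive_cases evals_SuccE: "evals Succ xs y"
inductive_cases evals_ProjE: "evals (Proj i) xs y"
inductive_cases evals_CompE: "evals (Comp f gs) xs y"
inductive_cases evals_PrimRec_0E: "evals (PrimRec f g) (0 # xs) y"
inductive_cases evals_PrimRec_SucE: "evals (PrimRec f g) (Suc n # xs) y"
inductive_cases evals_MuE: "evals (Mu f) xs y"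

lemma evals_deterministic: "evals p xs y \<Longrightarrow> evals p xs z \<Longrightarrow> y = z"
proof (induction arbitrary: z rule: evals.induct)
  case (evals_Zero xs)
  from evals_Zero.prems show ?case by (rule evals_ZeroE) simp
next
  case (evals_Succ x)
  from evals_Succ.prems show ?case by (rule evals_SuccE) simp
next
  case (evals_Proj i xs)
  from evals_Proj.prems show ?case by (rule evals_ProjE) simp
next
  case (evals_Comp xs gs ys f y)
  from evals_Comp.prems obtain ys' where
    ys': "list_all2 (\<lambda>g y. evals g xs y) gs ys'" "evals f ys' z"
    by (rule evals_CompE)
  have "ys = ys'"
    using evals_Comp.IH(1) ys'(1) by (intro nth_equalityI) (simp_all add: list_all2_conv_all_nth)
  then show ?case
    using evals_Comp.IH(2) ys'(2) by simp
next
  case (evals_PrimRec_0 f xs y g)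
  from evals_PrimRec_0.prems have "evals f xs z" by (rule evals_PrimRec_0E)
  then show ?case by (rule evals_PrimRec_0.IH)
next
  case (evals_PrimRec_Suc f g n xs y z')
  from evals_PrimRec_Suc.prems obtain w where w: "evals (PrimRec f g) (n # xs) w" "evals g (w # n # xs) z"
    by (rule evals_PrimRec_SucE)
  have "y = w" using w(1) by (rule evals_PrimRec_Suc.IH)
  then show ?case using w(2) evals_PrimRec_Suc.IH(2) by simp
next
  case (evals_Mu f n xs)
  from evals_Mu.prems have z: "evals f (z # xs) 0"
    by (rule evals_MuE)
  from evals_Mu.prems have z': "\<exists>k. evals f (m # xs) (Suc k)" if "m < z" for m
    by (rule evals_MuE) (use that in simp)
  consider "n < z" | "z < n" | "n = z" by linarith
  then show ?case
  proof cases
    case 1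
    with z' obtain k where "evals f (n # xs) (Suc k)" by blast
    then have "0 = Suc k" by (rule evals_Mu.IH(1))
    then show ?thesis by simp
  next
    case 2
    then obtain k where "\<And>u. evals f (z # xs) u \<Longrightarrow> Suc k = u"
      using evals_Mu.IH(2) by blast
    from this[OF z] show ?thesis by simp
  next
    case 3
    then show ?thesis .
  qed
qed

text \<open>
  A decision problem consists of a set of instances, each given to the algorithm by its code, and
  the predicate to be decided. The algorithm must stop with the right answer on (the codes of) all
  instances; nothing is required of it on numbers that are not codes of instances.
\<close>

definition decidable_problem :: "'a set \<Rightarrow> ('a \<Rightarrow> nat) \<Rightarrow> ('a \<Rightarrow> bool) \<Rightarrow> bool" where
  "decidable_problem I code P \<longleftrightarrow>
     (\<exists>p. \<forall>x\<in>I. evals p [code x] (if P x then 1 else 0))"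

end

theory Submission
  imports Defs
begin

text \<open>
  Let \<open>F\<close> toss an independent fair coin at every cell. In \<open>G\<close>, the configuration \<open>c\<close> declares some
  edges of the lattice open, every open edge carries a random bit, and a cell outputs the parity of
  the bits at its open edges; a cell at which \<open>c\<close> violates a local rule adds a private random bit.
  If the connected component of a cell is infinite or contains a violation, the output at this cell
  can be flipped, without disturbing any given finite window, by flipping the bits along a path that
  leaves the window or ends at the violation; so if this holds for all components, the output is
  uniform and, by compactness, every binary configuration is attained. On a finite component
  without violations the outputs have even sum. Hence \<open>F\<close> and \<open>G\<close> agree, in either
  sense, iff no \<open>c\<close> has a finite component without violations.

  The local rules can be chosen such that such components are the rectangles on which a halting run of
  a given register program is drawn. The input of the program does not enter the rules but only the
  neighbourhood: from the corner of a rectangle, edges with offsets \<open>m\<close> and \<open>n\<close> lead to the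
  last counting cells of the two input registers. So a procedure deciding equality
  can be turned into a program that is fed, through \<open>m\<close> and \<open>n\<close>, the states and the table of its own
  automaton, and halts iff the procedure claims that this automaton is equal to \<open>F\<close>, that is, iff the
  program does not halt.
\<close>

section \<open>Flippable random bits\<close>

text \<open>The obstacle to a plain reduction from halting is that a recursive function would have
  to compute the table of an automaton from a program. Here the program \<open>c\<close> is fixed
  before its automaton is coded, so the code of the states and the code of the table are two
  constants \<open>S\<close> and \<open>T\<close>. The table does not change with the offsets, so
  \<open>S\<close> and \<open>T\<close> may be put into the offsets afterwards: there is no
  circularity and no need for a recursion theorem. The code of the pair is then elementary
  arithmetic in the two input registers, from which \<open>S\<close> and \<open>T\<close> are
  recovered by subtraction. Programs may be nondeterministic and may block, since only the existence
  of a halting run matters; this leaves commands so simple that their effect on unary counters can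
  be checked between neighbouring tiles. Columns are counted from 0, so an offset \<open>m\<close>
  stands for the register value \<open>Suc m\<close>. A finite closed set may consist of several
  rectangles joined by input edges, so the marks of a corner could belong to another rectangle; a
  corner that is extremal in the set rules this out.\<close>

definition vneg :: "int list \<Rightarrow> int list" where
  "vneg v = map uminus v"

lemma vneg_in_lattice: "v \<in> lattice d \<Longrightarrow> vneg v \<in> lattice d"
  by (simp add: lattice_def vneg_def)

lemma vadd_zero: "z \<in> lattice d \<Longrightarrow> vadd z (replicate d 0) = z"
  by (auto simp: lattice_def vadd_def intro: nth_equalityI)

lemma zero_in_lattice: "replicate d 0 \<in> lattice d"
  by (simp add: lattice_def)

lemma vadd_vneg: "z \<in> lattice d \<Longrightarrow> v \<in> lattice d \<Longrightarrow> vadd (vadd z v) (vneg v) = z"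
  by (auto simp: lattice_def vadd_def vneg_def intro!: nth_equalityI)

lemma vneg_vadd: "z \<in> lattice d \<Longrightarrow> v \<in> lattice d \<Longrightarrow> vadd (vadd z (vneg v)) v = z"
  by (auto simp: lattice_def vadd_def vneg_def intro!: nth_equalityI)

lemma vadd_eq_self: "z \<in> lattice d \<Longrightarrow> v \<in> lattice d \<Longrightarrow> vadd z v = z \<Longrightarrow> v = replicate d 0"
  by (auto simp: lattice_def vadd_def list_eq_iff_nth_eq)

lemma space_random_config: "space (random_config d R) = configs d R"
  by (simp add: random_config_def configs_def space_PiM space_uniform_count_measure)

lemma prob_space_random_config:
  assumes "finite R" "R \<noteq> {}"
  shows "prob_space (random_config d R)"
  unfolding random_config_def using assms by (intro prob_space_PiM prob_space_uniform_count_measure)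

section \<open>Measure-preserving maps of random configurations\<close>

definition preserves :: "'a measure \<Rightarrow> ('a \<Rightarrow> 'a) \<Rightarrow> bool" where
  "preserves M T \<longleftrightarrow> T \<in> measurable M M \<and> distr M M T = M"

lemma preserves_id: "preserves M (\<lambda>s. s)"
  by (simp add: preserves_def distr_id)

lemma preserves_comp: "preserves M S \<Longrightarrow> preserves M T \<Longrightarrow> preserves M (\<lambda>s. T (S s))"
  unfolding preserves_def using distr_distr[of T M M S M] by (auto simp: comp_def)

text \<open>The preimage of a box under a permutation of one coordinate is a box whose side at
  \<open>z\<close> has the same number of elements, and the measure is determined by its values on
  boxes.\<close>

lemma preserves_update:
  assumes R: "finite R" "R \<noteq> {}" and \<pi>: "bij_betw \<pi> R R" and z: "z \<in> lattice d"
  shows "preserves (random_config d R) (\<lambda>s. s(z := \<pi> (s z)))" (is "preserves ?M ?T")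
proof -
  let ?U = "\<lambda>_. uniform_count_measure R :: nat measure"
  interpret prob_space ?M by (rule prob_space_random_config[OF R])
  have \<pi>R: "r \<in> R \<Longrightarrow> \<pi> r \<in> R" for r using \<pi> by (auto dest: bij_betwE)
  have T: "?T \<in> measurable ?M ?M"
    unfolding random_config_def
  proof (rule measurable_PiM_single')
    show "?T \<in> space (Pi\<^sub>M (lattice d) ?U) \<rightarrow> (\<Pi>\<^sub>E i\<in>lattice d. space (uniform_count_measure R))"
      using z \<pi>R by (auto simp: space_PiM space_uniform_count_measure PiE_iff extensional_def)
    fix i assume i: "i \<in> lattice d"
    show "(\<lambda>s. ?T s i) \<in> measurable (Pi\<^sub>M (lattice d) ?U) (uniform_count_measure R)"
    proof (cases "i = z")
      case True
      have "\<pi> \<in> measurable (uniform_count_measure R) (uniform_count_measure R)"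
        using \<pi>R by (auto simp: measurable_def space_uniform_count_measure sets_uniform_count_measure)
      with measurable_component_singleton[OF z, of ?U] True show ?thesis
        by (auto intro: measurable_compose)
    qed (use i in simp)
  qed
  have "distr ?M ?M ?T = ?M"
  proof (rule measure_eqI_PiM_infinite[where I = "lattice d" and M = ?U])
    show "finite_measure (distr ?M ?M ?T)"
      using prob_space_distr[OF T] prob_space.finite_measure by blast
    fix A J
    assume J: "finite J" "J \<subseteq> lattice d" and A: "\<And>i. i \<in> J \<Longrightarrow> A i \<in> sets (uniform_count_measure R)"
    let ?E = "\<lambda>A. prod_emb (lattice d) ?U J (Pi\<^sub>E J A)"
    define B where "B = A(z := {r \<in> R. \<pi> r \<in> A z})"
    have AR: "A i \<subseteq> R" if "i \<in> J" for i using A[OF that] by (simp add: sets_uniform_count_measure)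
    have BR: "B i \<subseteq> R" if "i \<in> J" for i using AR[OF that] by (auto simp: B_def)
    have E: "emeasure ?M (?E A') = (\<Prod>i\<in>J. emeasure (uniform_count_measure R) (A' i))"
      if "\<And>i. i \<in> J \<Longrightarrow> A' i \<subseteq> R" for A'
      unfolding random_config_def using J R that
      by (intro emeasure_PiM_emb) (auto intro: prob_space_uniform_count_measure simp: sets_uniform_count_measure)
    have meas: "?E A \<in> sets ?M"
      unfolding random_config_def using J A by (intro sets_PiM_I) auto
    have "?T -` ?E A \<inter> space ?M = ?E B"
    proof (intro equalityI subsetI)
      fix s assume s: "s \<in> ?T -` ?E A \<inter> space ?M"
      then have "s \<in> lattice d \<rightarrow>\<^sub>E R" by (simp add: space_random_config configs_def)
      moreover have "s i \<in> B i" if "i \<in> J" for i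
      proof -
        have "?T s i \<in> A i" using s that by (auto simp: prod_emb_def PiE_iff)
        then show ?thesis using \<open>s \<in> lattice d \<rightarrow>\<^sub>E R\<close> z by (auto simp: B_def split: if_splits)
      qed
      ultimately show "s \<in> ?E B"
        using J by (auto simp: prod_emb_def PiE_iff space_uniform_count_measure)
    next
      fix s assume s: "s \<in> ?E B"
      then have sR: "s \<in> lattice d \<rightarrow>\<^sub>E R" by (auto simp: prod_emb_def space_uniform_count_measure)
      moreover have "?T s i \<in> A i" if "i \<in> J" for i
        using s that by (auto simp: prod_emb_def PiE_iff B_def split: if_splits)
      moreover have "?T s \<in> lattice d \<rightarrow>\<^sub>E R"
        using sR z \<pi>R by (auto simp: PiE_iff extensional_def)
      ultimately show "s \<in> ?T -` ?E A \<inter> space ?M"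
        using J by (auto simp: prod_emb_def PiE_iff space_random_config configs_def space_uniform_count_measure)
    qed
    then have "emeasure (distr ?M ?M ?T) (?E A) = emeasure ?M (?E B)"
      using emeasure_distr[OF T meas] by simp
    also have "\<dots> = (\<Prod>i\<in>J. emeasure (uniform_count_measure R) (B i))"
      by (rule E) (rule BR)
    also have "\<dots> = (\<Prod>i\<in>J. emeasure (uniform_count_measure R) (A i))"
    proof (intro prod.cong refl)
      fix i assume i: "i \<in> J"
      have "card (B i) = card (A i)"
      proof (cases "i = z")
        case True
        have "bij_betw \<pi> (B z) (A z)"
          using \<pi> AR[OF i] True unfolding bij_betw_def B_def by (auto simp: inj_on_def image_iff)
        with True show ?thesis by (simp add: bij_betw_same_card)
      qed (simp add: B_def)
      then show "emeasure (uniform_count_measure R) (B i) = emeasure (uniform_count_measure R) (A i)"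
        using AR[OF i] BR[OF i] R by (simp add: emeasure_uniform_count_measure)
    qed
    also have "\<dots> = emeasure ?M (?E A)" using E[of A, OF AR] by simp
    finally show "emeasure (distr ?M ?M ?T) (?E A) = emeasure ?M (?E A)" .
  qed (simp_all add: random_config_def)
  with T show ?thesis by (simp add: preserves_def)
qed

text \<open>Every coordinate of every finite window of \<open>X\<close> can be flipped alone by a measure preserving map;
  this forces the coordinates to be independent fair bits.\<close>

definition flippable :: "'a measure \<Rightarrow> 'i set \<Rightarrow> ('a \<Rightarrow> 'i \<Rightarrow> nat) \<Rightarrow> bool" where
  "flippable M I X \<longleftrightarrow> (\<forall>W z. finite W \<longrightarrow> W \<subseteq> I \<longrightarrow> z \<in> W \<longrightarrow>
     (\<exists>T. preserves M T \<and> (\<forall>s\<in>space M. \<forall>y\<in>W. X (T s) y = (if y = z then 1 - X s y else X s y))))"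

text \<open>Induction on the window: the map that flips \<open>z\<close> and fixes the values on
  \<open>W\<close> pulls \<open>E 0\<close> back to \<open>E 1\<close>, so the constraint on
  \<open>W\<close> splits into two halves of equal measure. The factor at \<open>z\<close> is the
  probability that a fair bit lies in \<open>A z\<close>.\<close>

lemma measure_flippable:
  assumes M: "prob_space M" and fl: "flippable M I X"
    and meas: "\<And>z. z \<in> I \<Longrightarrow> (\<lambda>s. X s z) \<in> measurable M (count_space UNIV)"
    and bin: "\<And>s z. s \<in> space M \<Longrightarrow> z \<in> I \<Longrightarrow> X s z \<in> {0, 1}"
    and W: "finite W" "W \<subseteq> I"
  shows "measure M {s \<in> space M. \<forall>z\<in>W. X s z \<in> A z} =
    (\<Prod>z\<in>W. (of_bool (0 \<in> A z) + of_bool (1 \<in> A z)) / 2)"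
  using W
proof (induction W)
  case empty
  show ?case using prob_space.prob_space[OF M] by simp
next
  case (insert z W)
  interpret prob_space M by (rule M)
  let ?X = "\<lambda>s. \<forall>y\<in>W. X s y \<in> A y"
  define E where "E b = {s \<in> space M. ?X s \<and> X s z = b}" for b :: nat
  have z: "z \<in> I" and WI: "W \<subseteq> I" using insert.prems by auto
  have pred: "Measurable.pred M (\<lambda>s. X s y \<in> B)" if "y \<in> I" for y and B :: "nat set"
    using measurable_compose[OF meas[OF that], of "\<lambda>x. x \<in> B" "count_space UNIV"] by simp
  have pX: "Measurable.pred M ?X"
    using insert.hyps(1) WI by (intro pred_intros_finite pred) auto
  have E_sets: "E b \<in> sets M" for b
  proof -
    have "Measurable.pred M (\<lambda>s. ?X s \<and> X s z \<in> {b})" using pX pred[OF z] by (intro pred_intros_logic)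
    then show ?thesis unfolding E_def by (simp add: pred_def)
  qed
  obtain T where T: "preserves M T"
    "\<And>s y. s \<in> space M \<Longrightarrow> y \<in> insert z W \<Longrightarrow> X (T s) y = (if y = z then 1 - X s y else X s y)"
    using fl insert.hyps(1) insert.prems unfolding flippable_def by (metis finite_insert insertI1)
  have T_meas: "T \<in> measurable M M" and T_distr: "distr M M T = M" using T(1) by (auto simp: preserves_def)
  have "T -` E 0 \<inter> space M = E 1"
  proof (intro equalityI subsetI)
    fix s assume s: "s \<in> T -` E 0 \<inter> space M"
    then have "X s z \<noteq> 0" using T(2)[of s z] by (auto simp: E_def)
    then have "X s z = 1" using bin[of s z] s z by auto
    moreover have "X s y \<in> A y" if "y \<in> W" for y
    proof -
      have "X (T s) y \<in> A y" "y \<noteq> z" using s that insert.hyps by (auto simp: E_def)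
      then show ?thesis using T(2)[of s y] s that by simp
    qed
    ultimately show "s \<in> E 1" using s by (simp add: E_def)
  next
    fix s assume s: "s \<in> E 1"
    then have "T s \<in> space M" using T_meas by (auto simp: E_def dest: measurable_space)
    moreover have "X (T s) y \<in> A y" if "y \<in> W" for y
    proof -
      have "X s y \<in> A y" "y \<noteq> z" "s \<in> space M" using s that insert.hyps by (auto simp: E_def)
      then show ?thesis using T(2)[of s y] that by simp
    qed
    moreover have "X (T s) z = 0" using T(2)[of s z] s by (simp add: E_def)
    ultimately show "s \<in> T -` E 0 \<inter> space M" using s by (simp add: E_def)
  qed
  then have eq: "measure M (E 0) = measure M (E 1)"
    using measure_distr[OF T_meas E_sets[of 0]] T_distr by simp
  have disj: "E 0 \<inter> E 1 = {}" by (auto simp: E_def)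
  have "{s \<in> space M. ?X s} = E 0 \<union> E 1"
    using bin z by (fastforce simp: E_def)
  then have "measure M {s \<in> space M. ?X s} = measure M (E 0) + measure M (E 1)"
    using E_sets disj by (simp add: finite_measure_Union)
  with insert.IH[OF WI] eq have half: "measure M (E b) = (\<Prod>y\<in>W. (of_bool (0 \<in> A y) + of_bool (1 \<in> A y)) / 2) / 2"
    if "b = 0 \<or> b = 1" for b
    using that by auto
  have "{s \<in> space M. \<forall>y\<in>insert z W. X s y \<in> A y} =
      (if 0 \<in> A z then E 0 else {}) \<union> (if 1 \<in> A z then E 1 else {})"
  proof (intro equalityI subsetI)
    fix s assume s: "s \<in> {s \<in> space M. \<forall>y\<in>insert z W. X s y \<in> A y}"
    then have "X s z = 0 \<or> X s z = 1" using bin[of s z] z by auto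
    with s show "s \<in> (if 0 \<in> A z then E 0 else {}) \<union> (if 1 \<in> A z then E 1 else {})"
      by (auto simp: E_def)
  qed (auto simp: E_def split: if_splits)
  then have "measure M {s \<in> space M. \<forall>y\<in>insert z W. X s y \<in> A y} =
      measure M (if 0 \<in> A z then E 0 else {}) + measure M (if 1 \<in> A z then E 1 else {})"
    using E_sets disj by (simp add: finite_measure_Union)
  also have "\<dots> = (of_bool (0 \<in> A z) + of_bool (1 \<in> A z)) / 2 *
      (\<Prod>y\<in>W. (of_bool (0 \<in> A y) + of_bool (1 \<in> A y)) / 2)"
    using half by auto
  finally show ?case using insert.hyps by simp
qed

lemma emeasure_distr_flippable:
  assumes M: "prob_space M" and fl: "flippable M I X"
    and X: "X \<in> measurable M (\<Pi>\<^sub>M z\<in>I. count_space Q)"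
    and bin: "\<And>s z. s \<in> space M \<Longrightarrow> z \<in> I \<Longrightarrow> X s z \<in> {0, 1}"
    and J: "finite J" "J \<subseteq> I" and A: "\<And>z. z \<in> J \<Longrightarrow> A z \<subseteq> Q"
  shows "emeasure (distr M (\<Pi>\<^sub>M z\<in>I. count_space Q) X) (prod_emb I (\<lambda>_. count_space Q) J (Pi\<^sub>E J A)) =
    (\<Prod>z\<in>J. (of_bool (0 \<in> A z) + of_bool (1 \<in> A z)) / 2 :: real)"
proof -
  interpret prob_space M by (rule M)
  let ?E = "prod_emb I (\<lambda>_. count_space Q) J (Pi\<^sub>E J A)"
  have E_sets: "?E \<in> sets (\<Pi>\<^sub>M z\<in>I. count_space Q)" using J A by (intro sets_PiM_I) auto
  have comp: "(\<lambda>s. X s z) \<in> measurable M (count_space UNIV)" if "z \<in> I" for z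
  proof -
    have "(\<lambda>s. X s z) \<in> measurable M (count_space Q)"
      using measurable_compose[OF X measurable_component_singleton[OF that]] .
    moreover have "(\<lambda>x. x) \<in> measurable (count_space Q) (count_space UNIV)" by simp
    ultimately show ?thesis by (rule measurable_compose)
  qed
  have "X -` ?E \<inter> space M = {s \<in> space M. \<forall>z\<in>J. X s z \<in> A z}"
    using measurable_space[OF X] J by (auto simp: prod_emb_def space_PiM PiE_iff)
  then have "emeasure (distr M (\<Pi>\<^sub>M z\<in>I. count_space Q) X) ?E = emeasure M {s \<in> space M. \<forall>z\<in>J. X s z \<in> A z}"
    using emeasure_distr[OF X E_sets] by simp
  then show ?thesis
    using measure_flippable[OF M fl comp bin J, of A] by (simp add: emeasure_eq_measure)
qed

text \<open>On cylinders both laws have the value computed above, which depends neither on the space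
  nor on the map.\<close>

lemma distr_flippable_eq:
  assumes M: "prob_space M" and N: "prob_space N"
    and fl: "flippable M I X" "flippable N I Y"
    and X: "X \<in> measurable M (\<Pi>\<^sub>M z\<in>I. count_space Q)" and Y: "Y \<in> measurable N (\<Pi>\<^sub>M z\<in>I. count_space Q)"
    and bin: "\<And>s z. s \<in> space M \<Longrightarrow> z \<in> I \<Longrightarrow> X s z \<in> {0, 1}"
      "\<And>s z. s \<in> space N \<Longrightarrow> z \<in> I \<Longrightarrow> Y s z \<in> {0, 1}"
  shows "distr M (\<Pi>\<^sub>M z\<in>I. count_space Q) X = distr N (\<Pi>\<^sub>M z\<in>I. count_space Q) Y"
proof (rule measure_eqI_PiM_infinite[where I = I and M = "\<lambda>_. count_space Q"])
  let ?P = "\<Pi>\<^sub>M z\<in>I. count_space Q"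
  show "finite_measure (distr M ?P X)"
    using prob_space.prob_space_distr[OF M X] prob_space.finite_measure by blast
  fix A J
  assume J: "finite J" "J \<subseteq> I" and A: "\<And>i. i \<in> J \<Longrightarrow> A i \<in> sets (count_space Q)"
  then have "\<And>i. i \<in> J \<Longrightarrow> A i \<subseteq> Q" by simp
  then show "emeasure (distr M ?P X) (prod_emb I (\<lambda>_. count_space Q) J (Pi\<^sub>E J A)) =
      emeasure (distr N ?P Y) (prod_emb I (\<lambda>_. count_space Q) J (Pi\<^sub>E J A))"
    using emeasure_distr_flippable[OF M fl(1) X bin(1) J] emeasure_distr_flippable[OF N fl(2) Y bin(2) J]
    by simp
qed simp_all

text \<open>Starting from any point, wrong cells are corrected one after the other; each flip leaves
  the cells corrected before unchanged.\<close>

lemma flippable_attains: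
  assumes M: "prob_space M" and fl: "flippable M I X"
    and bin: "\<And>s z. s \<in> space M \<Longrightarrow> z \<in> I \<Longrightarrow> X s z \<in> {0, 1}"
    and W: "finite W" "W \<subseteq> I" and p: "\<And>z. z \<in> W \<Longrightarrow> p z \<in> {0, 1}"
  shows "\<exists>s\<in>space M. \<forall>z\<in>W. X s z = p z"
proof -
  have "\<exists>s\<in>space M. \<forall>z\<in>V. X s z = p z" if "finite V" "V \<subseteq> W" for V
    using that
  proof (induction V)
    case empty
    show ?case using prob_space.not_empty[OF M] by blast
  next
    case (insert v V)
    then obtain s where s: "s \<in> space M" "\<forall>z\<in>V. X s z = p z" by blast
    show ?case
    proof (cases "X s v = p v")
      case True
      then show ?thesis using s by blast
    next
      case False
      have v: "finite (insert v V)" "insert v V \<subseteq> I" "v \<in> I" using insert W by auto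
      then obtain T where T: "preserves M T"
        "\<And>y. y \<in> insert v V \<Longrightarrow> X (T s) y = (if y = v then 1 - X s y else X s y)"
        using fl s(1) unfolding flippable_def by (metis insertI1)
      have "T s \<in> space M" using T(1) s(1) by (auto simp: preserves_def dest: measurable_space)
      moreover have "X (T s) v = p v"
        using T(2)[of v] False bin[OF s(1) v(3)] p[of v] insert.prems by auto
      moreover have "X (T s) z = p z" if "z \<in> V" for z
        using T(2)[of z] that s(2) insert.hyps by auto
      ultimately show ?thesis by blast
    qed
  qed
  then show ?thesis using W(1) by blast
qed

text \<open>Each constraint \<open>X s z = p z\<close> depends on finitely many coordinates and so
  defines a closed set in the compact product space; these sets have the finite intersection
  property by \<open>fin\<close>.\<close>

lemma compact_attains:
  fixes X :: "('i \<Rightarrow> 'r) \<Rightarrow> 'i \<Rightarrow> 'b"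
  assumes R: "finite R"
    and N: "\<And>z. z \<in> I \<Longrightarrow> finite (N z) \<and> N z \<subseteq> I"
    and loc: "\<And>z s s'. z \<in> I \<Longrightarrow> (\<And>y. y \<in> N z \<Longrightarrow> s y = s' y) \<Longrightarrow> X s z = X s' z"
    and fin: "\<And>W. finite W \<Longrightarrow> W \<subseteq> I \<Longrightarrow> \<exists>s\<in>I \<rightarrow>\<^sub>E R. \<forall>z\<in>W. X s z = p z"
  shows "\<exists>s\<in>I \<rightarrow>\<^sub>E R. \<forall>z\<in>I. X s z = p z"
proof -
  let ?P = "product_topology (\<lambda>_. discrete_topology R) I"
  have top: "topspace ?P = I \<rightarrow>\<^sub>E R" by simp
  have comp: "compact_space ?P"
    using R by (simp add: compact_space_product_topology compact_space_discrete_topology)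
  define K where "K z = {s \<in> I \<rightarrow>\<^sub>E R. X s z = p z}" for z
  have closed: "closedin ?P (K z)" if z: "z \<in> I" for z
  proof -
    have "openin ?P (topspace ?P - K z)"
    proof (subst openin_subopen, intro ballI)
      fix s assume s: "s \<in> topspace ?P - K z"
      let ?U = "\<Pi>\<^sub>E y\<in>I. if y \<in> N z then {s y} else R"
      have sR: "s \<in> I \<rightarrow>\<^sub>E R" using s by simp
      have "openin ?P ?U"
      proof (rule product_topology_basis)
        show "openin (discrete_topology R) (if y \<in> N z then {s y} else R)" for y
          using sR N[OF z] by (auto simp: PiE_iff)
        have "{y. (if y \<in> N z then {s y} else R) \<noteq> topspace (discrete_topology R)} \<subseteq> N z" by auto
        then show "finite {y. (if y \<in> N z then {s y} else R) \<noteq> topspace (discrete_topology R)}"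
          using N[OF z] finite_subset by blast
      qed
      moreover have "s \<in> ?U" using sR by (auto simp: PiE_iff)
      moreover have "?U \<subseteq> topspace ?P - K z"
      proof
        fix t assume t: "t \<in> ?U"
        have "t y = s y" if "y \<in> N z" for y
        proof -
          have "t y \<in> (if y \<in> N z then {s y} else R)" using t that N[OF z] by (intro PiE_mem[OF t]) auto
          with that show ?thesis by simp
        qed
        then have "X t z = X s z" by (rule loc[OF z])
        moreover have "t \<in> I \<rightarrow>\<^sub>E R"
        proof (rule PiE_I)
          fix y assume "y \<in> I"
          from PiE_mem[OF t this] sR \<open>y \<in> I\<close> show "t y \<in> R" by (auto split: if_splits)
        qed (use t in \<open>auto simp: PiE_iff extensional_def\<close>)
        ultimately show "t \<in> topspace ?P - K z" using s by (auto simp: K_def)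
      qed
      ultimately show "\<exists>U. openin ?P U \<and> s \<in> U \<and> U \<subseteq> topspace ?P - K z" by blast
    qed
    then show ?thesis by (auto simp: closedin_def K_def)
  qed
  \<comment> \<open>The whole space joins the family so that a point of the intersection is a
    configuration even if \<open>I\<close> is empty.\<close>
  have "\<Inter> (insert (topspace ?P) (K ` I)) \<noteq> {}"
  proof (rule compact_space_fip[THEN iffD1, OF comp, rule_format], intro conjI ballI allI impI)
    show "closedin ?P C" if "C \<in> insert (topspace ?P) (K ` I)" for C
      using that closed closedin_topspace[of ?P, unfolded top] by auto
    fix \<F> assume F: "finite \<F> \<and> \<F> \<subseteq> insert (topspace ?P) (K ` I)"
    then have "finite (\<F> - {topspace ?P})" "\<F> - {topspace ?P} \<subseteq> K ` I" by auto
    then obtain W where W: "finite W" "W \<subseteq> I" "\<F> - {topspace ?P} = K ` W"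
      by (meson finite_subset_image)
    from fin[OF W(1,2)] obtain s where s: "s \<in> I \<rightarrow>\<^sub>E R" "\<forall>z\<in>W. X s z = p z" by blast
    have "s \<in> A" if "A \<in> \<F>" for A
    proof (cases "A = topspace ?P")
      case True
      then show ?thesis using s(1) by simp
    next
      case False
      then have "A \<in> K ` W" using that W(3) by blast
      then show ?thesis using s by (auto simp: K_def)
    qed
    then show "\<Inter> \<F> \<noteq> {}" by blast
  qed
  then obtain s where "s \<in> topspace ?P" "\<forall>z\<in>I. s \<in> K z" by blast
  then show ?thesis by (auto simp: K_def)
qed

section \<open>Parity automata\<close>

text \<open>The order fixes the indices used in local functions: 0 is the cell itself,
  \<open>Suc j\<close> the end of its \<open>j\<close>-th edge, and \<open>Suc (J + j)\<close> the
  start of the \<open>j\<close>-th edge that arrives at it. The negated offsets are there because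
  the bit of an edge is stored at its start and must also be read at its end.\<close>

definition nbs :: "nat \<Rightarrow> int list list \<Rightarrow> int list list" where
  "nbs d vs = replicate d 0 # vs @ map vneg vs"

definition parity_fun :: "nat \<Rightarrow> (nat \<Rightarrow> nat \<Rightarrow> bool) \<Rightarrow> (nat list \<Rightarrow> bool) \<Rightarrow> nat list \<Rightarrow> nat list \<Rightarrow> nat" where
  "parity_fun J opn good qs rs =
     ((\<Sum>j<J. of_bool (opn j (qs ! 0) \<and> bit (rs ! 0) j)) +
      (\<Sum>j<J. of_bool (opn j (qs ! (Suc (J + j))) \<and> bit (rs ! (Suc (J + j))) j)) +
      of_bool (\<not> good qs \<and> bit (rs ! 0) J)) mod 2"

text \<open>The \<open>j\<close>-th bit of the random symbol at \<open>z\<close> is attached to the edge from \<open>z\<close> to \<open>z + vs ! j\<close>,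
  which the state at \<open>z\<close> declares open or closed; the last bit is private to \<open>z\<close> and is
  used only if the neighbourhood of \<open>z\<close> is not good. The new state is the sum modulo 2 of all
  bits at open edges and of the private bit.\<close>

definition parity_ca :: "nat \<Rightarrow> int list list \<Rightarrow> (nat \<Rightarrow> nat \<Rightarrow> bool) \<Rightarrow> (nat list \<Rightarrow> bool) \<Rightarrow> nat set \<Rightarrow> stoch_ca" where
  "parity_ca d vs opn good Q = \<lparr>states = Q, rsymbols = {..<2 ^ Suc (length vs)},
     nbhd = nbs d vs, rnbhd = nbs d vs, local_fun = parity_fun (length vs) opn good\<rparr>"

text \<open>The set of states is a parameter, to be taken equal to that of the parity automaton:
  global functions can be equal only on a common domain.\<close>

definition coin_ca :: "nat \<Rightarrow> nat set \<Rightarrow> stoch_ca" where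
  "coin_ca d Q = \<lparr>states = Q, rsymbols = {0, 1}, nbhd = [], rnbhd = [replicate d 0],
     local_fun = (\<lambda>qs rs. hd rs)\<rparr>"

text \<open>The edge condition ranges over the whole lattice, so it also covers open edges that
  start outside of \<open>C\<close>: the set is a finite nonempty union of components of the
  undirected graph, free of violations.\<close>

definition closed_good ::
  "nat \<Rightarrow> int list list \<Rightarrow> (nat \<Rightarrow> nat \<Rightarrow> bool) \<Rightarrow> (nat list \<Rightarrow> bool) \<Rightarrow> (int list \<Rightarrow> nat) \<Rightarrow> int list set \<Rightarrow> bool" where
  "closed_good d vs opn good c C \<longleftrightarrow> finite C \<and> C \<noteq> {} \<and> C \<subseteq> lattice d \<and>
     (\<forall>z\<in>lattice d. \<forall>j<length vs. opn j (c z) \<longrightarrow> (z \<in> C \<longleftrightarrow> vadd z (vs ! j) \<in> C)) \<and>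
     (\<forall>z\<in>C. good (map (\<lambda>v. c (vadd z v)) (nbs d vs)))"

lemma odd_sum_of_bool_flip:
  fixes J k :: nat
  assumes "\<And>j. j < J \<Longrightarrow> P' j \<longleftrightarrow> (P j \<noteq> (j = k \<and> B))"
  shows "odd (\<Sum>j<J. of_bool (P' j) :: nat) \<longleftrightarrow> (odd (\<Sum>j<J. of_bool (P j) :: nat) \<noteq> (k < J \<and> B))"
  using assms
proof (induction J)
  case (Suc J)
  then have IH: "odd (\<Sum>j<J. of_bool (P' j) :: nat) \<longleftrightarrow> (odd (\<Sum>j<J. of_bool (P j) :: nat) \<noteq> (k < J \<and> B))"
    by simp
  have "P' J \<longleftrightarrow> (P J \<noteq> (J = k \<and> B))" using Suc.prems by simp
  then show ?case unfolding sum.lessThan_Suc odd_add IH less_Suc_eq by (cases "J = k") auto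
qed simp

lemma explicit_global_coin:
  assumes "s \<in> configs d {0, 1}"
  shows "explicit_global d (coin_ca d Q) c s = s"
proof (rule extensionalityI[of _ "lattice d"])
  show "s \<in> extensional (lattice d)" using assms by (simp add: configs_def PiE_iff)
  show "explicit_global d (coin_ca d Q) c s z = s z" if "z \<in> lattice d" for z
    using that by (simp add: explicit_global_def coin_ca_def vadd_zero)
qed (simp add: explicit_global_def)

lemma is_stoch_ca_coin:
  assumes "finite Q" "{0, 1} \<subseteq> Q"
  shows "is_stoch_ca d (coin_ca d Q)"
proof -
  have "hd rs \<in> Q" if "set rs \<subseteq> {0, 1}" "length rs = length [replicate d (0 :: int)]" for rs
  proof -
    have "hd rs \<in> set rs" using that(2) by (cases rs) auto
    with that(1) assms(2) show ?thesis by blast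
  qed
  moreover have "Q \<noteq> {}" using assms(2) by blast
  ultimately show ?thesis
    using assms(1) zero_in_lattice unfolding is_stoch_ca_def coin_ca_def by simp
qed

text \<open>Distinctness of \<open>nbs d vs\<close> makes the neighbourhood legal and keeps the zero
  vector out of \<open>vs\<close>, so that no edge is a loop. The states 0 and 1 are the possible
  outputs.\<close>

locale parity =
  fixes d :: nat and vs :: "int list list" and opn :: "nat \<Rightarrow> nat \<Rightarrow> bool"
    and good :: "nat list \<Rightarrow> bool" and Q :: "nat set"
  assumes vs: "set vs \<subseteq> lattice d" "distinct (nbs d vs)" and Q: "finite Q" "{0, 1} \<subseteq> Q"
begin

abbreviation J where "J \<equiv> length vs"
abbreviation R :: "nat set" where "R \<equiv> {..<2 ^ Suc J}"
abbreviation F where "F \<equiv> coin_ca d Q"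
abbreviation G where "G \<equiv> parity_ca d vs opn good Q"
abbreviation M where "M \<equiv> random_config d R"

lemma R_nonempty: "R \<noteq> {}"
proof -
  have "0 \<in> R" by simp
  then show ?thesis by blast
qed

lemma nth_vs: "j < J \<Longrightarrow> vs ! j \<in> lattice d"
  using vs(1) by (auto simp: subset_iff)

lemma nbs_lattice: "set (nbs d vs) \<subseteq> lattice d"
  using vs(1) zero_in_lattice vneg_in_lattice by (auto simp: nbs_def)

lemma is_stoch_ca_G: "is_stoch_ca d G"
proof -
  have "parity_fun J opn good qs rs < 2" for qs rs by (simp add: parity_fun_def)
  then have "parity_fun J opn good qs rs \<in> {0, 1}" for qs rs by (simp add: less_2_cases_iff)
  with Q(2) have "parity_fun J opn good qs rs \<in> Q" for qs rs by blast
  moreover have "Q \<noteq> {}" using Q(2) by blast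
  ultimately show ?thesis
    using vs(2) Q(1) nbs_lattice R_nonempty unfolding is_stoch_ca_def parity_ca_def by simp
qed

lemma is_stoch_ca_F: "is_stoch_ca d F"
  using Q by (rule is_stoch_ca_coin)

lemma shift_neq:
  assumes "z \<in> lattice d" "j < J"
  shows "vadd z (vs ! j) \<noteq> z"
proof
  assume "vadd z (vs ! j) = z"
  then have "vs ! j = replicate d 0" using vadd_eq_self assms nth_vs by blast
  moreover have "vs ! j \<in> set vs" using assms(2) by simp
  moreover have "replicate d 0 \<notin> set vs" using vs(2) by (simp add: nbs_def)
  ultimately show False by simp
qed

definition bad :: "(int list \<Rightarrow> nat) \<Rightarrow> int list \<Rightarrow> bool" where
  "bad c z \<longleftrightarrow> \<not> good (map (\<lambda>v. c (vadd z v)) (nbs d vs))"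

definition prev :: "int list \<Rightarrow> nat \<Rightarrow> int list" where
  "prev z j = vadd z (vneg (vs ! j))"

text \<open>The sum before reduction modulo 2, split into departing edges, arriving edges and the
  private bit; unreduced values can be added up over a set of cells.\<close>

definition total :: "(int list \<Rightarrow> nat) \<Rightarrow> (int list \<Rightarrow> nat) \<Rightarrow> int list \<Rightarrow> nat" where
  "total c s z =
     (\<Sum>j<J. of_bool (opn j (c z) \<and> bit (s z) j)) +
     (\<Sum>j<J. of_bool (opn j (c (prev z j)) \<and> bit (s (prev z j)) j)) +
     of_bool (bad c z \<and> bit (s z) J)"

lemma prev_iff: "z \<in> lattice d \<Longrightarrow> x \<in> lattice d \<Longrightarrow> j < J \<Longrightarrow> prev x j = z \<longleftrightarrow> x = vadd z (vs ! j)"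
  unfolding prev_def using vadd_vneg[of z d "vs ! j"] vneg_vadd[of x d "vs ! j"] nth_vs by auto

lemma explicit_global_G:
  assumes "z \<in> lattice d"
  shows "explicit_global d G c s z = of_bool (odd (total c s z))"
proof -
  have 0: "nbs d vs ! 0 = replicate d 0" by (simp add: nbs_def)
  have 1: "nbs d vs ! (Suc (J + j)) = vneg (vs ! j)" if "j < J" for j
    using that by (simp add: nbs_def nth_append)
  have len: "length (nbs d vs) = Suc (J + J)" by (simp add: nbs_def)
  have nth: "map (\<lambda>v. e (vadd z v)) (nbs d vs) ! 0 = e z"
    "\<And>j. j < J \<Longrightarrow> map (\<lambda>v. e (vadd z v)) (nbs d vs) ! (Suc (J + j)) = e (prev z j)" for e :: "int list \<Rightarrow> nat"
    using assms by (simp_all add: len 0 1 vadd_zero prev_def)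
  have "(\<Sum>j<J. of_bool (opn j (map (\<lambda>v. c (vadd z v)) (nbs d vs) ! (Suc (J + j))) \<and>
        bit (map (\<lambda>v. s (vadd z v)) (nbs d vs) ! (Suc (J + j))) j) :: nat)
      = (\<Sum>j<J. of_bool (opn j (c (prev z j)) \<and> bit (s (prev z j)) j))"
    using nth(2) by (intro sum.cong) auto
  then have "parity_fun J opn good (map (\<lambda>v. c (vadd z v)) (nbs d vs)) (map (\<lambda>v. s (vadd z v)) (nbs d vs))
      = total c s z mod 2"
    unfolding parity_fun_def total_def bad_def nth(1) by simp
  then have "explicit_global d G c s z = total c s z mod 2"
    using assms by (simp add: explicit_global_def parity_ca_def)
  then show ?thesis by (simp add: mod_2_eq_odd)
qed

text \<open>Every edge that is open at an end in \<open>C\<close> has both ends in \<open>C\<close>, so its bit is counted twice.\<close>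

lemma total_even:
  assumes C: "closed_good d vs opn good c C"
  shows "even (\<Sum>z\<in>C. total c s z)"
proof -
  have fin: "finite C" and CL: "C \<subseteq> lattice d"
    and cl: "\<And>z j. z \<in> lattice d \<Longrightarrow> j < J \<Longrightarrow> opn j (c z) \<Longrightarrow> z \<in> C \<longleftrightarrow> vadd z (vs ! j) \<in> C"
    and gd: "\<And>z. z \<in> C \<Longrightarrow> \<not> bad c z"
    using C unfolding closed_good_def bad_def by blast+
  let ?a = "\<lambda>j z. of_bool (opn j (c z) \<and> bit (s z) j) :: nat"
  \<comment> \<open>The shift by \<open>vs ! j\<close> matches only the cells whose
    \<open>j\<close>-th edge is open, since along a closed edge it may leave \<open>C\<close>; the
    remaining terms are zero on both sides.\<close>
  have swap: "(\<Sum>z\<in>C. ?a j z) = (\<Sum>z\<in>C. ?a j (prev z j))" if j: "j < J" for j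
  proof (rule sum.reindex_bij_witness_not_neutral[where i = "\<lambda>z. prev z j" and j = "\<lambda>z. vadd z (vs ! j)"
        and S' = "{z \<in> C. \<not> opn j (c z)}" and T' = "{z \<in> C. \<not> opn j (c (prev z j))}"])
    show "finite {z \<in> C. \<not> opn j (c z)}" "finite {z \<in> C. \<not> opn j (c (prev z j))}" using fin by auto
    fix z assume z: "z \<in> C - {z \<in> C. \<not> opn j (c z)}"
    then have zL: "z \<in> lattice d" using CL by auto
    then show bk: "prev (vadd z (vs ! j)) j = z"
      using prev_iff[of z "vadd z (vs ! j)" j] j nth_vs vadd_in_lattice by blast
    with z show "vadd z (vs ! j) \<in> C - {z \<in> C. \<not> opn j (c (prev z j))}"
      using cl[OF zL j] by auto
  next
    fix z assume z: "z \<in> C - {z \<in> C. \<not> opn j (c (prev z j))}"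
    then have zL: "z \<in> lattice d" and bL: "prev z j \<in> lattice d"
      using CL j nth_vs vadd_in_lattice vneg_in_lattice by (auto simp: prev_def)
    then show bk: "vadd (prev z j) (vs ! j) = z"
      using prev_iff[of "prev z j" z j] j by simp
    with z show "prev z j \<in> C - {z \<in> C. \<not> opn j (c z)}"
      using cl[OF bL j] by auto
  next
    fix z assume z: "z \<in> C"
    then show "?a j (prev (vadd z (vs ! j)) j) = ?a j z"
      using prev_iff[of z "vadd z (vs ! j)" j] j nth_vs vadd_in_lattice CL by auto
  qed auto
  have eq: "(\<Sum>j<J. \<Sum>z\<in>C. ?a j z) = (\<Sum>j<J. \<Sum>z\<in>C. ?a j (prev z j))"
    by (rule sum.cong[OF refl], rule swap) simp
  have "(\<Sum>z\<in>C. total c s z) = (\<Sum>z\<in>C. (\<Sum>j<J. ?a j z) + (\<Sum>j<J. ?a j (prev z j)))"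
    using gd by (intro sum.cong) (simp_all add: total_def)
  also have "\<dots> = (\<Sum>j<J. \<Sum>z\<in>C. ?a j z) + (\<Sum>j<J. \<Sum>z\<in>C. ?a j (prev z j))"
    unfolding sum.distrib by (intro arg_cong2[where f = "(+)"] sum.swap)
  finally show ?thesis unfolding eq by simp
qed

section \<open>Flipping outputs along paths\<close>

lemma bij_flip_bit:
  assumes "k \<le> J"
  shows "bij_betw (flip_bit k) R R"
proof (rule bij_betw_byWitness[where f' = "flip_bit k"])
  show "\<forall>r\<in>R. flip_bit k (flip_bit k r) = r" by (auto intro!: bit_eqI simp: bit_flip_bit_iff)
  show sub: "flip_bit k ` R \<subseteq> R"
  proof
    fix x assume "x \<in> flip_bit k ` R"
    then obtain r where r: "r < 2 ^ Suc J" "x = flip_bit k r" by auto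
    have "take_bit (Suc J) x = x"
      using assms r take_bit_nat_eq_self[OF r(1)] by (simp add: take_bit_flip_bit_eq)
    then show "x \<in> R" by (metis lessThan_iff take_bit_nat_eq_self_iff)
  qed
  show "flip_bit k ` R \<subseteq> R" by (rule sub)
  show "\<forall>r\<in>R. flip_bit k (flip_bit k r) = r" by (auto intro!: bit_eqI simp: bit_flip_bit_iff)
qed

lemma preserves_flip: "z \<in> lattice d \<Longrightarrow> k \<le> J \<Longrightarrow> preserves M (\<lambda>s. s(z := flip_bit k (s z)))"
  by (rule preserves_update[OF finite_lessThan R_nonempty bij_flip_bit])

text \<open>An open edge contributes its bit at its two ends, a private bit only at its own cell and
  only if that cell is bad. The contributions are combined by exclusive or.\<close>

lemma odd_total_flip:
  assumes "z \<in> lattice d" "x \<in> lattice d"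
  shows "odd (total c (s(z := flip_bit k (s z))) x) \<longleftrightarrow>
    ((odd (total c s x) \<noteq> (k < J \<and> x = z \<and> opn k (c z))) \<noteq>
      (k < J \<and> x = vadd z (vs ! k) \<and> opn k (c z))) \<noteq> (x = z \<and> k = J \<and> bad c z)"
proof -
  let ?s = "s(z := flip_bit k (s z))"
  have b: "bit (?s y) j \<longleftrightarrow> (bit (s y) j \<noteq> (y = z \<and> j = k))" for y j
    by (auto simp: bit_flip_bit_iff)
  have 1: "odd (\<Sum>j<J. of_bool (opn j (c x) \<and> bit (?s x) j) :: nat) \<longleftrightarrow>
      (odd (\<Sum>j<J. of_bool (opn j (c x) \<and> bit (s x) j) :: nat) \<noteq> (k < J \<and> (x = z \<and> opn k (c z))))"
    by (rule odd_sum_of_bool_flip) (unfold b, auto)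
  have 2: "odd (\<Sum>j<J. of_bool (opn j (c (prev x j)) \<and> bit (?s (prev x j)) j) :: nat) \<longleftrightarrow>
      (odd (\<Sum>j<J. of_bool (opn j (c (prev x j)) \<and> bit (s (prev x j)) j) :: nat) \<noteq>
        (k < J \<and> (prev x k = z \<and> opn k (c z))))"
    by (rule odd_sum_of_bool_flip) (unfold b, auto)
  have 3: "odd (of_bool (bad c x \<and> bit (?s x) J) :: nat) \<longleftrightarrow>
      (odd (of_bool (bad c x \<and> bit (s x) J) :: nat) \<noteq> (x = z \<and> k = J \<and> bad c z))"
    unfolding b by auto
  have 4: "k < J \<and> (prev x k = z \<and> opn k (c z)) \<longleftrightarrow> k < J \<and> x = vadd z (vs ! k) \<and> opn k (c z)"
    using prev_iff[OF assms] by blast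
  show ?thesis
    unfolding total_def odd_add 1 2[unfolded 4] 3 by blast
qed

definition link :: "(int list \<Rightarrow> nat) \<Rightarrow> (int list \<times> int list) set" where
  "link c = {(z, vadd z (vs ! j)) | z j. z \<in> lattice d \<and> j < J \<and> opn j (c z)}"

text \<open>Unlike in \<open>flippable\<close>, the effect is described on the whole lattice:
  \<open>A\<close> is exactly the set of toggled cells. Composition then becomes symmetric
  difference.\<close>

definition flips :: "(int list \<Rightarrow> nat) \<Rightarrow> int list set \<Rightarrow> ((int list \<Rightarrow> nat) \<Rightarrow> (int list \<Rightarrow> nat)) \<Rightarrow> bool" where
  "flips c A T \<longleftrightarrow> preserves M T \<and>
     (\<forall>s. \<forall>x\<in>lattice d. odd (total c (T s) x) \<longleftrightarrow> (odd (total c s x) \<noteq> (x \<in> A)))"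

lemma flips_comp:
  assumes S: "flips c A S" and T: "flips c B T"
  shows "flips c (A - B \<union> (B - A)) (\<lambda>s. T (S s))"
  unfolding flips_def
proof (intro conjI allI ballI)
  show "preserves M (\<lambda>s. T (S s))" using S T preserves_comp unfolding flips_def by blast
  fix s x assume x: "x \<in> lattice d"
  have "odd (total c (T (S s)) x) \<longleftrightarrow> (odd (total c (S s) x) \<noteq> (x \<in> B))"
    using T x unfolding flips_def by blast
  moreover have "odd (total c (S s) x) \<longleftrightarrow> (odd (total c s x) \<noteq> (x \<in> A))"
    using S x unfolding flips_def by blast
  ultimately show "odd (total c (T (S s)) x) \<longleftrightarrow> (odd (total c s x) \<noteq> (x \<in> A - B \<union> (B - A)))"
    by auto
qed

lemma flips_edge:
  assumes "(z, y) \<in> link c"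
  shows "\<exists>T. flips c {z, y} T"
proof -
  obtain j where j: "z \<in> lattice d" "j < J" "opn j (c z)" "y = vadd z (vs ! j)"
    using assms by (auto simp: link_def)
  have "flips c {z, y} (\<lambda>s. s(z := flip_bit j (s z)))"
    unfolding flips_def using j shift_neq[OF j(1,2)] preserves_flip[of z j]
    by (auto simp: odd_total_flip simp del: fun_upd_apply)
  then show ?thesis by blast
qed

lemma linkE:
  assumes "(z, y) \<in> link c"
  obtains j where "z \<in> lattice d" "j < J" "opn j (c z)" "y = vadd z (vs ! j)"
  using assms unfolding link_def by blast

lemma link_lattice: "(z, y) \<in> link c \<Longrightarrow> z \<in> lattice d \<and> y \<in> lattice d"
  by (erule linkE) (simp add: nth_vs vadd_in_lattice)

lemma link_irrefl: "(z, y) \<in> link c \<Longrightarrow> y \<noteq> z"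
  by (erule linkE) (simp add: shift_neq)

text \<open>Each inner cell of the path meets two of the flipped bits.\<close>

lemma flips_path:
  assumes "(z, y) \<in> (link c \<union> (link c)\<inverse>)\<^sup>*"
  shows "\<exists>T. flips c ({z} - {y} \<union> ({y} - {z})) T"
  using assms
proof (induction rule: rtrancl_induct)
  case base
  have "flips c {} (\<lambda>s. s)" by (simp add: flips_def preserves_id)
  then show ?case by auto
next
  case (step y x)
  then obtain T where T: "flips c ({z} - {y} \<union> ({y} - {z})) T" by blast
  from step.hyps(2) have "(y, x) \<in> link c \<or> (x, y) \<in> link c" by blast
  then obtain S where S: "flips c {y, x} S"
    using flips_edge[of y x c] flips_edge[of x y c] by (metis insert_commute)
  \<comment> \<open>Only for \<open>y \<noteq> x\<close> is \<open>{y, x}\<close> the symmetric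
    difference of the two singletons, which makes the toggles at \<open>y\<close> cancel.\<close>
  have yx: "y \<noteq> x" using step.hyps(2) link_irrefl by blast
  have "({z} - {y} \<union> ({y} - {z})) - {y, x} \<union> ({y, x} - ({z} - {y} \<union> ({y} - {z}))) = {z} - {x} \<union> ({x} - {z})"
    using yx by auto
  with flips_comp[OF T S] show ?case by auto
qed

lemma explicit_global_flips:
  assumes "flips c A T" "z \<in> lattice d"
  shows "explicit_global d G c (T s) z = (if z \<in> A then 1 - explicit_global d G c s z else explicit_global d G c s z)"
proof -
  have "odd (total c (T s) z) \<longleftrightarrow> (odd (total c s z) \<noteq> (z \<in> A))"
    using assms unfolding flips_def by blast
  then show ?thesis by (simp add: explicit_global_G[OF assms(2)])
qed

lemma flippable_G:
  assumes no: "\<nexists>C. closed_good d vs opn good c C"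
  shows "flippable M (lattice d) (explicit_global d G c)"
  unfolding flippable_def
proof (intro allI impI)
  fix W z assume W: "finite W" "W \<subseteq> lattice d" "z \<in> W"
  let ?L = "(link c \<union> (link c)\<inverse>)\<^sup>*"
  let ?C = "{y. (z, y) \<in> ?L}"
  have CL: "?C \<subseteq> lattice d"
  proof
    fix y assume "y \<in> ?C"
    then have "(z, y) \<in> ?L" by simp
    then show "y \<in> lattice d" using W link_lattice by (induction rule: rtrancl_induct) auto
  qed
  have closed: "y \<in> ?C \<longleftrightarrow> vadd y (vs ! j) \<in> ?C" if "y \<in> lattice d" "j < J" "opn j (c y)" for y j
  proof -
    have "(y, vadd y (vs ! j)) \<in> link c" using that by (auto simp: link_def)
    then have "(y, vadd y (vs ! j)) \<in> ?L" "(vadd y (vs ! j), y) \<in> ?L" by auto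
    then show ?thesis by (auto intro: rtrancl_trans)
  qed
  have "\<exists>T A. flips c A T \<and> A \<inter> W = {z}"
  proof (cases "\<exists>y\<in>?C. bad c y")
    case True
    then obtain y where y: "(z, y) \<in> ?L" "bad c y" by auto
    obtain T where T: "flips c ({z} - {y} \<union> ({y} - {z})) T" using flips_path[OF y(1)] by blast
    have yL: "y \<in> lattice d" using CL y(1) by auto
    \<comment> \<open>The private bit of \<open>y\<close> cancels the toggle that the path leaves at
      its end. If \<open>y = z\<close>, the path toggles nothing and the private bit does all the
      work.\<close>
    have "flips c {y} (\<lambda>s. s(y := flip_bit J (s y)))"
      unfolding flips_def using yL y(2) preserves_flip[of y J]
      by (auto simp: odd_total_flip simp del: fun_upd_apply)
    from flips_comp[OF T this] have "\<exists>T. flips c (({z} - {y} \<union> ({y} - {z})) - {y} \<union> ({y} - ({z} - {y} \<union> ({y} - {z})))) T"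
      by blast
    moreover have "({z} - {y} \<union> ({y} - {z})) - {y} \<union> ({y} - ({z} - {y} \<union> ({y} - {z}))) = {z}" by auto
    ultimately have "\<exists>T. flips c {z} T" by simp
    then show ?thesis using W(3) by blast
  next
    case False
    have "z \<in> ?C" by simp
    with False no CL closed have "infinite ?C" unfolding closed_good_def bad_def by blast
    then have "\<not> ?C \<subseteq> W" using W(1) finite_subset by blast
    then obtain y where y: "(z, y) \<in> ?L" "y \<notin> W" by blast
    obtain T where T: "flips c ({z} - {y} \<union> ({y} - {z})) T" using flips_path[OF y(1)] by blast
    moreover have "({z} - {y} \<union> ({y} - {z})) \<inter> W = {z}" using y(2) W(3) by auto
    ultimately show ?thesis by blast
  qed
  then obtain T A where TA: "flips c A T" "A \<inter> W = {z}" by blast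
  have "explicit_global d G c (T s) y = (if y = z then 1 - explicit_global d G c s y else explicit_global d G c s y)"
    if "y \<in> W" for s y
  proof -
    have "y \<in> A \<longleftrightarrow> y = z" using TA(2) that by blast
    then show ?thesis using explicit_global_flips[OF TA(1), of y s] W(2) that by auto
  qed
  then show "\<exists>T. preserves M T \<and> (\<forall>s\<in>space M. \<forall>y\<in>W. explicit_global d G c (T s) y =
      (if y = z then 1 - explicit_global d G c s y else explicit_global d G c s y))"
    using TA(1) unfolding flips_def by blast
qed

section \<open>Comparison with the coin automaton\<close>

lemma flippable_F: "flippable (random_config d {0, 1}) (lattice d) (explicit_global d F c)"
  unfolding flippable_def
proof (intro allI impI)
  fix W z assume W: "finite W" "W \<subseteq> lattice d" "z \<in> W"
  have "bij_betw (\<lambda>x :: nat. 1 - x) {0, 1} {0, 1}"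
    by (auto simp: bij_betw_def inj_on_def)
  then have T: "preserves (random_config d {0, 1}) (\<lambda>s. s(z := 1 - s z))"
    using W by (intro preserves_update) auto
  have "s(z := 1 - s z) \<in> configs d {0, 1}" if "s \<in> configs d {0, 1}" for s
    using T that measurable_space[of "\<lambda>s. s(z := 1 - s z)" "random_config d {0, 1}" "random_config d {0, 1}" s]
    unfolding preserves_def space_random_config by blast
  with T show "\<exists>T. preserves (random_config d {0, 1}) T \<and> (\<forall>s\<in>space (random_config d {0, 1}). \<forall>y\<in>W.
      explicit_global d F c (T s) y = (if y = z then 1 - explicit_global d F c s y else explicit_global d F c s y))"
    by (intro exI[of _ "\<lambda>s. s(z := 1 - s z)"]) (simp add: space_random_config explicit_global_coin)
qed

lemma rsymbols_G: "rsymbols G = R" and rsymbols_F: "rsymbols F = {0, 1}"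
  and states_G: "states G = Q" and states_F: "states F = Q"
  by (simp_all add: parity_ca_def coin_ca_def)

lemma nondet_global_F: "nondet_global d F c = configs d {0, 1}"
proof (intro equalityI subsetI)
  fix p assume "p \<in> nondet_global d F c"
  then obtain s where "p = explicit_global d F c s" "s \<in> configs d {0, 1}"
    unfolding nondet_global_def rsymbols_F by blast
  then show "p \<in> configs d {0, 1}" using explicit_global_coin by simp
next
  fix p assume p: "p \<in> configs d {0, 1}"
  then have "p = explicit_global d F c p" using explicit_global_coin by simp
  with p show "p \<in> nondet_global d F c" unfolding nondet_global_def rsymbols_F by blast
qed

lemma binary_G: "z \<in> lattice d \<Longrightarrow> explicit_global d G c s z \<in> {0, 1}"
  by (simp add: explicit_global_G)

lemma binary_F: "s \<in> configs d {0, 1} \<Longrightarrow> z \<in> lattice d \<Longrightarrow> explicit_global d F c s z \<in> {0, 1}"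
  unfolding explicit_global_coin by (auto simp: configs_def PiE_iff)

lemma prob_space_G: "prob_space M"
  by (rule prob_space_random_config[OF finite_lessThan R_nonempty])

lemma nondet_global_G:
  assumes no: "\<nexists>C. closed_good d vs opn good c C"
  shows "nondet_global d G c = configs d {0, 1}"
proof (intro equalityI subsetI)
  fix p assume "p \<in> nondet_global d G c"
  then obtain s where p: "p = explicit_global d G c s" by (auto simp: nondet_global_def)
  have "p z \<in> {0, 1}" if "z \<in> lattice d" for z unfolding p by (rule binary_G[OF that])
  moreover have "p \<in> extensional (lattice d)" unfolding p explicit_global_def by simp
  ultimately show "p \<in> configs d {0, 1}" unfolding configs_def PiE_iff by blast
next
  fix p assume p: "p \<in> configs d {0, 1}"
  have "\<exists>s\<in>lattice d \<rightarrow>\<^sub>E R. \<forall>z\<in>lattice d. explicit_global d G c s z = p z"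
  proof (rule compact_attains[where N = "\<lambda>z. set (map (vadd z) (nbs d vs))"])
    show "finite (set (map (vadd z) (nbs d vs))) \<and> set (map (vadd z) (nbs d vs)) \<subseteq> lattice d"
      if "z \<in> lattice d" for z
      using that nbs_lattice vadd_in_lattice by auto
    show "explicit_global d G c s z = explicit_global d G c s' z"
      if "z \<in> lattice d" "\<And>y. y \<in> set (map (vadd z) (nbs d vs)) \<Longrightarrow> s y = s' y" for z s s'
    proof -
      have "map (\<lambda>v. s (vadd z v)) (rnbhd G) = map (\<lambda>v. s' (vadd z v)) (rnbhd G)"
        using that(2) by (simp add: parity_ca_def)
      from this that(1) show ?thesis by (simp only: explicit_global_def restrict_apply if_True)
    qed
    fix W assume W: "finite W" "W \<subseteq> lattice d"
    have "\<exists>s\<in>space M. \<forall>z\<in>W. explicit_global d G c s z = p z"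
    proof (rule flippable_attains[OF prob_space_G flippable_G[OF no] _ W])
      show "p z \<in> {0, 1}" if "z \<in> W" for z
        using p that W(2) unfolding configs_def PiE_iff by blast
    qed (rule binary_G)
    then show "\<exists>s\<in>lattice d \<rightarrow>\<^sub>E R. \<forall>z\<in>W. explicit_global d G c s z = p z"
      by (simp add: space_random_config configs_def)
  qed simp
  then obtain s where s: "s \<in> configs d R" "\<And>z. z \<in> lattice d \<Longrightarrow> explicit_global d G c s z = p z"
    by (auto simp: configs_def)
  have "explicit_global d G c s = p"
  proof (rule extensionalityI[of _ "lattice d"])
    show "p \<in> extensional (lattice d)" using p by (simp add: configs_def PiE_iff)
  qed (use s(2) in \<open>auto simp: explicit_global_def\<close>)
  then show "p \<in> nondet_global d G c" using s(1) unfolding nondet_global_def rsymbols_G by blast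
qed

lemma stoch_global_eq:
  assumes no: "\<nexists>C. closed_good d vs opn good c C" and c: "c \<in> configs d Q"
  shows "stoch_global d F c = stoch_global d G c"
proof -
  have 1: "explicit_global d G c \<in> measurable M (\<Pi>\<^sub>M z\<in>lattice d. count_space Q)"
    using explicit_global_measurable[OF is_stoch_ca_G, of c] c by (simp add: rsymbols_G states_G)
  have 2: "explicit_global d F c \<in> measurable (random_config d {0, 1}) (\<Pi>\<^sub>M z\<in>lattice d. count_space Q)"
    using explicit_global_measurable[OF is_stoch_ca_F, of c] c by (simp add: rsymbols_F states_F)
  show ?thesis
    unfolding stoch_global_def rsymbols_F rsymbols_G states_F states_G
  proof (rule distr_flippable_eq[OF _ prob_space_G flippable_F flippable_G[OF no] 2 1])
    show "prob_space (random_config d {0, 1})" by (rule prob_space_random_config) auto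
    show "explicit_global d F c s z \<in> {0, 1}" if "s \<in> space (random_config d {0, 1})" "z \<in> lattice d" for s z
      using that by (intro binary_F) (simp add: space_random_config)
  qed (rule binary_G)
qed

text \<open>The pattern with a single 1 in \<open>C\<close> has an odd sum, whereas all outputs on
  \<open>C\<close> have an even one.\<close>

lemma closed_good_not_attained:
  assumes C: "closed_good d vs opn good c C" and z0: "z0 \<in> C"
  shows "\<exists>z\<in>C. explicit_global d G c s z \<noteq> of_bool (z = z0)"
proof (rule ccontr)
  assume "\<not> ?thesis"
  then have eq: "explicit_global d G c s z = of_bool (z = z0)" if "z \<in> C" for z using that by blast
  have fin: "finite C" "C \<subseteq> lattice d" using C unfolding closed_good_def by blast+
  have par: "odd (total c s z) \<longleftrightarrow> z = z0" if "z \<in> C" for z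
    using eq[OF that] explicit_global_G[of z c s] that fin by (cases "z = z0") auto
  have "odd (\<Sum>z\<in>C. total c s z) \<longleftrightarrow> odd (card {z \<in> C. odd (total c s z)})"
    using fin(1) by (simp add: even_sum_iff)
  also have "{z \<in> C. odd (total c s z)} = {z0}" using z0 par by blast
  finally show False using total_even[OF C, of s] by simp
qed

lemma nondet_global_neq:
  assumes C: "closed_good d vs opn good c C"
  shows "nondet_global d F c \<noteq> nondet_global d G c"
proof
  assume eq: "nondet_global d F c = nondet_global d G c"
  obtain z0 where z0: "z0 \<in> C" and CL: "C \<subseteq> lattice d" using C unfolding closed_good_def by blast
  define p where "p = (\<lambda>z\<in>lattice d. of_bool (z = z0) :: nat)"
  have "p \<in> configs d {0, 1}" by (auto simp: p_def configs_def)
  then have "p \<in> nondet_global d G c" using eq nondet_global_F by simp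
  then obtain s where "p = explicit_global d G c s" by (auto simp: nondet_global_def)
  moreover have "p z = of_bool (z = z0)" if "z \<in> C" for z using that CL by (auto simp: p_def)
  ultimately show False using closed_good_not_attained[OF C z0, of s] by auto
qed

text \<open>The cylinder of the unattainable pattern on \<open>C\<close> has measure 0 for the
  parity automaton, but positive measure for the coin, each cell contributing a factor 1/2.\<close>

lemma stoch_global_neq:
  assumes C: "closed_good d vs opn good c C" and c: "c \<in> configs d Q"
  shows "stoch_global d F c \<noteq> stoch_global d G c"
proof
  assume eq: "stoch_global d F c = stoch_global d G c"
  obtain z0 where z0: "z0 \<in> C" and fin: "finite C" and CL: "C \<subseteq> lattice d"
    using C unfolding closed_good_def by blast
  let ?P = "\<Pi>\<^sub>M z\<in>lattice d. count_space Q"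
  let ?E = "prod_emb (lattice d) (\<lambda>_. count_space Q) C (\<Pi>\<^sub>E z\<in>C. {of_bool (z = z0)})"
  have 1: "explicit_global d G c \<in> measurable M ?P"
    using explicit_global_measurable[OF is_stoch_ca_G, of c] c by (simp add: rsymbols_G states_G)
  have 2: "explicit_global d F c \<in> measurable (random_config d {0, 1}) ?P"
    using explicit_global_measurable[OF is_stoch_ca_F, of c] c by (simp add: rsymbols_F states_F)
  have sub: "{of_bool (z = z0)} \<subseteq> Q" for z using Q(2) by auto
  have E_sets: "?E \<in> sets ?P" using fin CL sub by (intro sets_PiM_I) auto
  have "explicit_global d G c -` ?E \<inter> space M = {}"
  proof (intro equals0I)
    fix s assume "s \<in> explicit_global d G c -` ?E \<inter> space M"
    then have "\<forall>z\<in>C. explicit_global d G c s z = of_bool (z = z0)"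
      by (auto simp: prod_emb_def PiE_iff)
    then show False using closed_good_not_attained[OF C z0, of s] by blast
  qed
  then have "emeasure (stoch_global d G c) ?E = 0"
    unfolding stoch_global_def rsymbols_G states_G using emeasure_distr[OF 1 E_sets] by simp
  moreover have "emeasure (stoch_global d F c) ?E =
      (\<Prod>z\<in>C. (of_bool (0 \<in> {of_bool (z = z0) :: nat}) + of_bool (1 \<in> {of_bool (z = z0) :: nat})) / 2 :: real)"
    unfolding stoch_global_def rsymbols_F states_F
  proof (rule emeasure_distr_flippable[OF _ flippable_F 2 _ fin CL sub])
    show "prob_space (random_config d {0, 1})" by (rule prob_space_random_config) auto
    show "explicit_global d F c s z \<in> {0, 1}" if "s \<in> space (random_config d {0, 1})" "z \<in> lattice d" for s z
      using that by (intro binary_F) (simp add: space_random_config)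
  qed
  moreover have "(\<Prod>z\<in>C. (of_bool (0 \<in> {of_bool (z = z0) :: nat}) + of_bool (1 \<in> {of_bool (z = z0) :: nat})) / 2 :: real) > 0"
    by (intro prod_pos) auto
  ultimately show False using eq by simp
qed

lemma nondet_equal_iff:
  "nondet_equal d F G \<longleftrightarrow> (\<nexists>c C. c \<in> configs d Q \<and> closed_good d vs opn good c C)"
  unfolding nondet_equal_def states_F states_G
  using nondet_global_neq nondet_global_G nondet_global_F by blast

lemma stoch_equal_iff:
  "stoch_equal d F G \<longleftrightarrow> (\<nexists>c C. c \<in> configs d Q \<and> closed_good d vs opn good c C)"
  unfolding stoch_equal_def states_F states_G
  using stoch_global_neq stoch_global_eq by blast

end

section \<open>Register programs\<close>

text \<open>Nondeterministic register programs: \<open>Dec i\<close> and \<open>Test i\<close> block unless register \<open>i\<close> is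
  positive or zero, respectively, and \<open>Star\<close> iterates any number of times.\<close>

datatype com = Inc nat | Dec nat | Test nat | Seq com com | Star com

type_synonym store = "nat \<Rightarrow> nat"

primrec rel :: "com \<Rightarrow> (store \<times> store) set" where
  "rel (Inc i) = {(\<sigma>, \<tau>). \<tau> = \<sigma>(i := Suc (\<sigma> i))}"
| "rel (Dec i) = {(\<sigma>, \<tau>). \<sigma> = \<tau>(i := Suc (\<tau> i))}"
| "rel (Test i) = {(\<sigma>, \<tau>). \<sigma> i = 0 \<and> \<tau> = \<sigma>}"
| "rel (Seq a b) = rel a O rel b"
| "rel (Star a) = (rel a)\<^sup>*"

section \<open>Derived commands\<close>

definition skip :: com where
  "skip = Seq (Inc 0) (Dec 0)"

definition loop :: "nat \<Rightarrow> com \<Rightarrow> com" where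
  "loop a c = Seq (Star (Seq (Dec a) c)) (Test a)"

definition clear :: "nat \<Rightarrow> com" where
  "clear a = loop a skip"

text \<open>Reading a counter destroys it, so the value is moved to \<open>r\<close> and to the
  scratch register \<open>t\<close> at once and then restored from \<open>t\<close>, which is zero
  again afterwards.\<close>

definition copy :: "nat \<Rightarrow> nat \<Rightarrow> nat \<Rightarrow> com" where
  "copy a r t = Seq (clear r) (Seq (loop a (Seq (Inc r) (Inc t))) (loop t (Inc a)))"

lemma rel_iff [simp]:
  "(\<sigma>, \<tau>) \<in> rel (Inc i) \<longleftrightarrow> \<tau> = \<sigma>(i := Suc (\<sigma> i))"
  "(\<sigma>, \<tau>) \<in> rel (Test i) \<longleftrightarrow> \<sigma> i = 0 \<and> \<tau> = \<sigma>"
  "(\<sigma>, \<tau>) \<in> rel (Seq a b) \<longleftrightarrow> (\<exists>\<rho>. (\<sigma>, \<rho>) \<in> rel a \<and> (\<rho>, \<tau>) \<in> rel b)"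
  "(\<sigma>, \<tau>) \<in> rel (Star a) \<longleftrightarrow> (\<sigma>, \<tau>) \<in> (rel a)\<^sup>*"
  by (simp_all add: relcomp_unfold)

lemma rel_Dec_iff [simp]: "(\<sigma>, \<tau>) \<in> rel (Dec i) \<longleftrightarrow> \<sigma> i > 0 \<and> \<tau> = \<sigma>(i := \<sigma> i - 1)"
proof
  assume "(\<sigma>, \<tau>) \<in> rel (Dec i)"
  then have "\<sigma> = \<tau>(i := Suc (\<tau> i))" by simp
  then show "\<sigma> i > 0 \<and> \<tau> = \<sigma>(i := \<sigma> i - 1)" by simp
qed auto

declare rel.simps [simp del]

lemma rel_skip [simp]: "(\<sigma>, \<tau>) \<in> rel skip \<longleftrightarrow> \<tau> = \<sigma>"
  by (simp add: skip_def)

text \<open>Blocking makes the number of iterations definite: at zero \<open>Dec\<close> forbids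
  another round, and at a positive value the final \<open>Test\<close> discards the choice to
  stop.\<close>

lemma rel_loop_unfold:
  "(\<sigma>, \<tau>) \<in> rel (loop a c) \<longleftrightarrow>
     (if \<sigma> a = 0 then \<tau> = \<sigma> else \<exists>\<rho>. (\<sigma>(a := \<sigma> a - 1), \<rho>) \<in> rel c \<and> (\<rho>, \<tau>) \<in> rel (loop a c))"
proof -
  let ?R = "rel (Seq (Dec a) c)"
  have lp: "(\<sigma>, \<tau>) \<in> rel (loop a c) \<longleftrightarrow> (\<sigma>, \<tau>) \<in> ?R\<^sup>* \<and> \<tau> a = 0" for \<sigma> \<tau>
    by (auto simp: loop_def)
  have R: "(\<sigma>, \<rho>) \<in> ?R \<longleftrightarrow> \<sigma> a > 0 \<and> (\<sigma>(a := \<sigma> a - 1), \<rho>) \<in> rel c" for \<rho>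
    by auto
  have "(\<sigma>, \<tau>) \<in> ?R\<^sup>* \<longleftrightarrow> \<tau> = \<sigma> \<or> (\<exists>\<rho>. (\<sigma>, \<rho>) \<in> ?R \<and> (\<rho>, \<tau>) \<in> ?R\<^sup>*)"
    by (metis converse_rtranclE converse_rtrancl_into_rtrancl rtrancl.rtrancl_refl)
  then have unf: "(\<sigma>, \<tau>) \<in> ?R\<^sup>* \<longleftrightarrow>
      \<tau> = \<sigma> \<or> (\<sigma> a > 0 \<and> (\<exists>\<rho>. (\<sigma>(a := \<sigma> a - 1), \<rho>) \<in> rel c \<and> (\<rho>, \<tau>) \<in> ?R\<^sup>*))"
    unfolding R by blast
  show ?thesis
  proof (cases "\<sigma> a = 0")
    case True
    then show ?thesis by (simp only: lp unf) auto
  next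
    case False
    then have "\<sigma> a > 0" "\<not> (\<tau> = \<sigma> \<and> \<tau> a = 0)" by auto
    then have "(\<sigma>, \<tau>) \<in> ?R\<^sup>* \<and> \<tau> a = 0 \<longleftrightarrow>
        (\<exists>\<rho>. (\<sigma>(a := \<sigma> a - 1), \<rho>) \<in> rel c \<and> (\<rho>, \<tau>) \<in> ?R\<^sup>* \<and> \<tau> a = 0)"
      unfolding unf by metis
    with False show ?thesis by (simp only: lp if_False)
  qed
qed

lemma rel_clear [simp]: "(\<sigma>, \<tau>) \<in> rel (clear a) \<longleftrightarrow> \<tau> = \<sigma>(a := 0)"
proof (induction "\<sigma> a" arbitrary: \<sigma>)
  case 0
  then have "\<sigma> a = 0" "\<sigma>(a := 0) = \<sigma>" by (simp_all add: fun_upd_idem)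
  then show ?case
    by (simp add: clear_def rel_loop_unfold[of \<sigma>])
next
  case (Suc n)
  then have "\<sigma> a = Suc n" by simp
  with Suc.hyps(1)[of "\<sigma>(a := n)"] show ?case
    by (simp add: clear_def rel_loop_unfold[of \<sigma>])
qed

lemma rel_loop_Inc:
  assumes "a \<noteq> t"
  shows "(\<sigma>, \<tau>) \<in> rel (loop t (Inc a)) \<longleftrightarrow> \<tau> = \<sigma>(a := \<sigma> a + \<sigma> t, t := 0)"
proof (induction "\<sigma> t" arbitrary: \<sigma>)
  case 0
  then show ?case
    by (simp add: rel_loop_unfold[of \<sigma>] fun_upd_idem)
next
  case (Suc n)
  have "(\<sigma>, \<tau>) \<in> rel (loop t (Inc a)) \<longleftrightarrow> (\<sigma>(t := n, a := Suc (\<sigma> a)), \<tau>) \<in> rel (loop t (Inc a))"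
    using assms Suc.hyps(2)[symmetric] by (simp add: rel_loop_unfold[of \<sigma>])
  also have "\<dots> \<longleftrightarrow> \<tau> = \<sigma>(a := \<sigma> a + \<sigma> t, t := 0)"
    using assms Suc.hyps(2)[symmetric]
    by (subst Suc.hyps(1)) (auto simp: fun_eq_iff)
  finally show ?case .
qed

lemma rel_loop_Inc_Inc:
  assumes "a \<noteq> r" "a \<noteq> t" "r \<noteq> t"
  shows "(\<sigma>, \<tau>) \<in> rel (loop a (Seq (Inc r) (Inc t))) \<longleftrightarrow>
    \<tau> = \<sigma>(r := \<sigma> r + \<sigma> a, t := \<sigma> t + \<sigma> a, a := 0)"
proof (induction "\<sigma> a" arbitrary: \<sigma>)
  case 0
  then show ?case
    by (simp add: rel_loop_unfold[of \<sigma>] fun_upd_idem)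
next
  case (Suc n)
  have "(\<sigma>, \<tau>) \<in> rel (loop a (Seq (Inc r) (Inc t))) \<longleftrightarrow>
      (\<sigma>(a := n, r := Suc (\<sigma> r), t := Suc (\<sigma> t)), \<tau>) \<in> rel (loop a (Seq (Inc r) (Inc t)))"
    using assms Suc.hyps(2)[symmetric] by (simp add: rel_loop_unfold[of \<sigma>])
  also have "\<dots> \<longleftrightarrow> \<tau> = \<sigma>(r := \<sigma> r + \<sigma> a, t := \<sigma> t + \<sigma> a, a := 0)"
    using assms Suc.hyps(2)[symmetric]
    by (subst Suc.hyps(1)) (auto simp: fun_eq_iff)
  finally show ?case .
qed

lemma rel_copy:
  assumes "a \<noteq> r" "a \<noteq> t" "r \<noteq> t" "\<sigma> t = 0"
  shows "(\<sigma>, \<tau>) \<in> rel (copy a r t) \<longleftrightarrow> \<tau> = \<sigma>(r := \<sigma> a)"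
proof -
  have "(\<sigma>, \<tau>) \<in> rel (copy a r t) \<longleftrightarrow> \<tau> = (\<sigma>(r := 0))(r := \<sigma> a, t := \<sigma> a, a := 0, a := \<sigma> a, t := 0)"
    unfolding copy_def
    using assms by (simp add: rel_loop_Inc rel_loop_Inc_Inc del: fun_upd_upd)
  also have "(\<sigma>(r := 0))(r := \<sigma> a, t := \<sigma> a, a := 0, a := \<sigma> a, t := 0) = \<sigma>(r := \<sigma> a)"
    using assms by (auto simp: fun_eq_iff)
  finally show ?thesis .
qed

section \<open>Compiling recursive functions into programs\<close>

definition clean :: "nat \<Rightarrow> store \<Rightarrow> bool" where
  "clean N \<sigma> \<longleftrightarrow> (\<forall>i\<ge>N. \<sigma> i = 0)"

text \<open>The equivalence also covers divergence: where \<open>p\<close> is undefined,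
  \<open>c\<close> has no complete run. Since only \<open>r\<close> may change, all scratch
  registers from \<open>N\<close> on are zero again at the end.\<close>

definition realizes :: "com \<Rightarrow> recf \<Rightarrow> nat list \<Rightarrow> nat \<Rightarrow> nat \<Rightarrow> bool" where
  "realizes c p as r N \<longleftrightarrow> (\<forall>\<sigma> \<tau>. clean N \<sigma> \<longrightarrow>
     ((\<sigma>, \<tau>) \<in> rel c \<longleftrightarrow> (\<exists>y. evals p (map \<sigma> as) y \<and> \<tau> = \<sigma>(r := y))))"

text \<open>Quantifying over all register allocations lets the induction place the program of a
  subterm above the registers already in use.\<close>

definition realizable :: "recf \<Rightarrow> bool" where
  "realizable p \<longleftrightarrow> (\<forall>as r N. set as \<subseteq> {..<N} \<longrightarrow> r < N \<longrightarrow> r \<notin> set as \<longrightarrow> (\<exists>c. realizes c p as r N))"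

lemma realizableI:
  assumes "\<And>as r N. set as \<subseteq> {..<N} \<Longrightarrow> r < N \<Longrightarrow> r \<notin> set as \<Longrightarrow> \<exists>c. realizes c p as r N"
  shows "realizable p"
  using assms unfolding realizable_def by blast

lemma realizableE:
  assumes "realizable p" "set as \<subseteq> {..<N}" "r < N" "r \<notin> set as"
  obtains c where "\<And>\<sigma> \<tau>. clean N \<sigma> \<Longrightarrow>
     (\<sigma>, \<tau>) \<in> rel c \<longleftrightarrow> (\<exists>y. evals p (map \<sigma> as) y \<and> \<tau> = \<sigma>(r := y))"
  using assms unfolding realizable_def realizes_def by metis

lemma clean_upd: "clean N \<sigma> \<Longrightarrow> N \<le> M \<Longrightarrow> i < M \<Longrightarrow> clean M (\<sigma>(i := y))"
  unfolding clean_def by auto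

lemma clean_mono: "clean N \<sigma> \<Longrightarrow> N \<le> M \<Longrightarrow> clean M \<sigma>"
  unfolding clean_def by auto

lemma map_upd_notin: "i \<notin> set as \<Longrightarrow> map (\<sigma>(i := y)) as = map \<sigma> as"
  by (auto simp: fun_upd_def)

lemma evals_Zero_iff: "evals Zero xs y \<longleftrightarrow> y = 0"
  using evals_Zero evals_ZeroE by blast

lemma evals_Succ_iff: "evals Succ xs y \<longleftrightarrow> (\<exists>x. xs = [x] \<and> y = Suc x)"
  by (metis evals_Succ evals_SuccE)

lemma evals_Proj_iff: "evals (Proj i) xs y \<longleftrightarrow> i < length xs \<and> y = xs ! i"
  by (metis evals_Proj evals_ProjE)

lemma evals_Comp_iff:
  "evals (Comp f gs) xs z \<longleftrightarrow> (\<exists>ys. list_all2 (\<lambda>g y. evals g xs y) gs ys \<and> evals f ys z)"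
proof
  assume "evals (Comp f gs) xs z"
  then show "\<exists>ys. list_all2 (\<lambda>g y. evals g xs y) gs ys \<and> evals f ys z"
    by (rule evals_CompE) blast
qed (metis evals_Comp)

lemma evals_PrimRec_0_iff: "evals (PrimRec f g) (0 # xs) y \<longleftrightarrow> evals f xs y"
  by (metis evals_PrimRec_0 evals_PrimRec_0E)

lemma evals_PrimRec_Suc_iff:
  "evals (PrimRec f g) (Suc n # xs) z \<longleftrightarrow> (\<exists>y. evals (PrimRec f g) (n # xs) y \<and> evals g (y # n # xs) z)"
  by (metis evals_PrimRec_Suc evals_PrimRec_SucE)

lemma evals_Mu_iff:
  "evals (Mu f) xs n \<longleftrightarrow> evals f (n # xs) 0 \<and> (\<forall>m<n. \<exists>k. evals f (m # xs) (Suc k))"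
proof
  assume "evals (Mu f) xs n"
  then show "evals f (n # xs) 0 \<and> (\<forall>m<n. \<exists>k. evals f (m # xs) (Suc k))"
    by (rule evals_MuE) blast
qed (auto intro: evals_Mu)

lemma not_evals_PrimRec_Nil: "\<not> evals (PrimRec f g) [] y"
proof
  assume "evals (PrimRec f g) [] y"
  then show False by cases
qed

lemma realizes_undefined:
  assumes "\<And>\<sigma> y. \<not> evals p (map \<sigma> as) y"
  shows "\<exists>c. realizes c p as r N"
proof -
  \<comment> \<open>A command that always blocks.\<close>
  have "realizes (Seq (Inc 0) (Test 0)) p as r N"
    unfolding realizes_def using assms by auto
  then show ?thesis ..
qed

lemma realizable_Zero: "realizable Zero"
proof (rule realizableI)
  fix as :: "nat list" and r N :: nat
  have "realizes (clear r) Zero as r N"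
    unfolding realizes_def by (auto simp: evals_Zero_iff)
  then show "\<exists>c. realizes c Zero as r N" ..
qed

lemma realizable_Succ: "realizable Succ"
proof (rule realizableI)
  fix as :: "nat list" and r N :: nat
  assume as: "set as \<subseteq> {..<N}" and r: "r < N" "r \<notin> set as"
  show "\<exists>c. realizes c Succ as r N"
  proof (cases "\<exists>a. as = [a]")
    case True
    then obtain a where a: "as = [a]" by blast
    have "realizes (Seq (copy a r N) (Inc r)) Succ as r N"
      unfolding realizes_def
      using as r a by (auto simp: evals_Succ_iff rel_copy clean_def)
    then show ?thesis ..
  next
    case False
    then show ?thesis
      by (intro realizes_undefined) (auto simp: evals_Succ_iff map_eq_Cons_conv)
  qed
qed

lemma realizable_Proj: "realizable (Proj i)"
proof (rule realizableI)
  fix as :: "nat list" and r N :: nat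
  assume as: "set as \<subseteq> {..<N}" and r: "r < N" "r \<notin> set as"
  show "\<exists>c. realizes c (Proj i) as r N"
  proof (cases "i < length as")
    case True
    then have "as ! i \<in> set as" by simp
    then have "as ! i \<noteq> r" "as ! i \<noteq> N"
      using as r by force+
    then have "realizes (copy (as ! i) r N) (Proj i) as r N"
      unfolding realizes_def
      using r True by (auto simp: evals_Proj_iff rel_copy clean_def)
    then show ?thesis ..
  next
    case False
    then show ?thesis
      by (intro realizes_undefined) (auto simp: evals_Proj_iff)
  qed
qed

fun upd_list :: "store \<Rightarrow> nat \<Rightarrow> nat list \<Rightarrow> store" where
  "upd_list \<sigma> N [] = \<sigma>"
| "upd_list \<sigma> N (y # ys) = upd_list (\<sigma>(N := y)) (Suc N) ys"

lemma upd_list_apply: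
  "upd_list \<sigma> N ys i = (if N \<le> i \<and> i < N + length ys then ys ! (i - N) else \<sigma> i)"
  by (induction \<sigma> N ys rule: upd_list.induct) (auto simp: nth_Cons' simp del: fun_upd_apply, simp_all)

lemma rel_clear_range:
  "\<exists>c. \<forall>\<sigma> \<tau>. (\<sigma>, \<tau>) \<in> rel c \<longleftrightarrow> \<tau> = (\<lambda>i. if N \<le> i \<and> i < N + k then 0 else \<sigma> i)"
proof (induction k)
  case 0
  have "(\<lambda>i. if N \<le> i \<and> i < N then 0 else \<sigma> i) = \<sigma>" for \<sigma> :: store by auto
  then show ?case by (intro exI[of _ skip]) simp
next
  case (Suc k)
  then obtain c where c: "(\<sigma>, \<tau>) \<in> rel c \<longleftrightarrow> \<tau> = (\<lambda>i. if N \<le> i \<and> i < N + k then 0 else \<sigma> i)" for \<sigma> \<tau>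
    by blast
  show ?case
  proof (intro exI[of _ "Seq c (clear (N + k))"] allI)
    fix \<sigma> \<tau> :: store
    have "(\<lambda>i. if N \<le> i \<and> i < N + k then 0 else \<sigma> i)(N + k := 0)
        = (\<lambda>i. if N \<le> i \<and> i < N + Suc k then 0 else \<sigma> i)"
      by (auto simp: fun_eq_iff)
    then show "(\<sigma>, \<tau>) \<in> rel (Seq c (clear (N + k))) \<longleftrightarrow>
        \<tau> = (\<lambda>i. if N \<le> i \<and> i < N + Suc k then 0 else \<sigma> i)"
      by (simp add: c)
  qed
qed

text \<open>The bound rises with every argument: a result stored at \<open>N\<close> counts as
  occupied for the programs that follow, whose scratch space starts at \<open>Suc N\<close>.\<close>

lemma realizable_arguments:
  assumes "\<And>g. g \<in> set gs \<Longrightarrow> realizable g" "set as \<subseteq> {..<N}"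
  shows "\<exists>c. \<forall>\<sigma> \<tau>. clean N \<sigma> \<longrightarrow> ((\<sigma>, \<tau>) \<in> rel c \<longleftrightarrow>
    (\<exists>ys. list_all2 (\<lambda>g y. evals g (map \<sigma> as) y) gs ys \<and> \<tau> = upd_list \<sigma> N ys))"
  using assms
proof (induction gs arbitrary: N)
  case Nil
  show ?case by (intro exI[of _ skip]) simp
next
  case (Cons g gs)
  have as: "set as \<subseteq> {..<Suc N}" "N \<notin> set as" using Cons.prems(2) by force+
  from Cons.prems(1) have "realizable g" by simp
  then obtain c where c: "clean (Suc N) \<sigma> \<Longrightarrow>
      (\<sigma>, \<tau>) \<in> rel c \<longleftrightarrow> (\<exists>y. evals g (map \<sigma> as) y \<and> \<tau> = \<sigma>(N := y))" for \<sigma> \<tau>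
    using as by (elim realizableE[where r = N]) auto
  obtain c' where c': "clean (Suc N) \<sigma> \<Longrightarrow> (\<sigma>, \<tau>) \<in> rel c' \<longleftrightarrow>
    (\<exists>ys. list_all2 (\<lambda>g y. evals g (map \<sigma> as) y) gs ys \<and> \<tau> = upd_list \<sigma> (Suc N) ys)" for \<sigma> \<tau>
    using Cons.IH[of "Suc N"] Cons.prems(1) as(1) by (metis list.set_intros(2))
  show ?case
  proof (intro exI[of _ "Seq c c'"] allI impI)
    fix \<sigma> \<tau> :: store
    assume \<sigma>: "clean N \<sigma>"
    have 1: "clean (Suc N) \<sigma>" "\<And>y. clean (Suc N) (\<sigma>(N := y))"
      using \<sigma> by (auto intro: clean_mono clean_upd)
    let ?A = "\<lambda>ys. list_all2 (\<lambda>g y. evals g (map \<sigma> as) y) gs ys"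
    have m: "map (\<sigma>(N := y)) as = map \<sigma> as" for y using as(2) by (rule map_upd_notin)
    have "(\<sigma>, \<tau>) \<in> rel (Seq c c') \<longleftrightarrow> (\<exists>y. evals g (map \<sigma> as) y \<and> (\<sigma>(N := y), \<tau>) \<in> rel c')"
      unfolding rel_iff c[OF 1(1)] by blast
    also have "\<dots> \<longleftrightarrow> (\<exists>y. evals g (map \<sigma> as) y \<and> (\<exists>ys. ?A ys \<and> \<tau> = upd_list \<sigma> N (y # ys)))"
      unfolding c'[OF 1(2)] m by simp
    also have "\<dots> \<longleftrightarrow> (\<exists>ys. list_all2 (\<lambda>g y. evals g (map \<sigma> as) y) (g # gs) ys \<and> \<tau> = upd_list \<sigma> N ys)"
      unfolding list_all2_Cons1 by blast
    finally show "(\<sigma>, \<tau>) \<in> rel (Seq c c') \<longleftrightarrow> \<dots>" .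
  qed
qed

lemma realizable_Comp:
  assumes f: "realizable f" and gs: "\<And>g. g \<in> set gs \<Longrightarrow> realizable g"
  shows "realizable (Comp f gs)"
proof (rule realizableI)
  fix as :: "nat list" and r N :: nat
  assume as: "set as \<subseteq> {..<N}" and r: "r < N" "r \<notin> set as"
  let ?k = "length gs"
  obtain c1 where c1: "clean N \<sigma> \<Longrightarrow> (\<sigma>, \<tau>) \<in> rel c1 \<longleftrightarrow>
    (\<exists>ys. list_all2 (\<lambda>g y. evals g (map \<sigma> as) y) gs ys \<and> \<tau> = upd_list \<sigma> N ys)" for \<sigma> \<tau>
    using realizable_arguments[of gs as N] gs as by blast
  obtain c2 where c2: "clean (N + ?k) \<sigma> \<Longrightarrow>
      (\<sigma>, \<tau>) \<in> rel c2 \<longleftrightarrow> (\<exists>y. evals f (map \<sigma> [N..<N + ?k]) y \<and> \<tau> = \<sigma>(r := y))" for \<sigma> \<tau>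
    using f r(1) by (elim realizableE[where r = r and as = "[N..<N + ?k]" and N = "N + ?k"]) auto
  obtain c3 where c3: "(\<sigma>, \<tau>) \<in> rel c3 \<longleftrightarrow>
      \<tau> = (\<lambda>i. if N \<le> i \<and> i < N + ?k then 0 else \<sigma> i)" for \<sigma> \<tau>
    using rel_clear_range by blast
  have "realizes (Seq c1 (Seq c2 c3)) (Comp f gs) as r N"
    unfolding realizes_def
  proof (intro allI impI)
    fix \<sigma> \<tau> :: store
    assume \<sigma>: "clean N \<sigma>"
    have 2: "(upd_list \<sigma> N ys, \<rho>) \<in> rel c2 \<longleftrightarrow> (\<exists>y. evals f ys y \<and> \<rho> = (upd_list \<sigma> N ys)(r := y))"
      if "length ys = ?k" for ys \<rho>
    proof -
      have "clean (N + ?k) (upd_list \<sigma> N ys)"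
        using \<sigma> that by (auto simp: clean_def upd_list_apply)
      moreover have "map (upd_list \<sigma> N ys) [N..<N + ?k] = ys"
        using that by (intro nth_equalityI) (auto simp: upd_list_apply)
      ultimately show ?thesis using c2 by simp
    qed
    have 3: "(\<lambda>i. if N \<le> i \<and> i < N + ?k then 0 else ((upd_list \<sigma> N ys)(r := y)) i) = \<sigma>(r := y)"
      if "length ys = ?k" for ys y
      using \<sigma> that r by (auto simp: fun_eq_iff clean_def upd_list_apply)
    have "(\<sigma>, \<tau>) \<in> rel (Seq c1 (Seq c2 c3)) \<longleftrightarrow>
       (\<exists>ys \<rho>. list_all2 (\<lambda>g y. evals g (map \<sigma> as) y) gs ys \<and> (upd_list \<sigma> N ys, \<rho>) \<in> rel c2 \<and> (\<rho>, \<tau>) \<in> rel c3)"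
      unfolding rel_iff c1[OF \<sigma>] by blast
    also have "\<dots> \<longleftrightarrow> (\<exists>ys y. list_all2 (\<lambda>g y. evals g (map \<sigma> as) y) gs ys \<and> evals f ys y \<and> \<tau> = \<sigma>(r := y))"
    proof (intro ex_cong1 iffI)
      fix ys
      assume "\<exists>\<rho>. list_all2 (\<lambda>g y. evals g (map \<sigma> as) y) gs ys \<and>
        (upd_list \<sigma> N ys, \<rho>) \<in> rel c2 \<and> (\<rho>, \<tau>) \<in> rel c3"
      then obtain \<rho> where \<rho>: "list_all2 (\<lambda>g y. evals g (map \<sigma> as) y) gs ys"
        "(upd_list \<sigma> N ys, \<rho>) \<in> rel c2" "(\<rho>, \<tau>) \<in> rel c3" by blast
      have l: "length ys = ?k" using \<rho>(1) by (simp add: list_all2_lengthD)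
      with 2 \<rho>(2) obtain y where y: "evals f ys y" "\<rho> = (upd_list \<sigma> N ys)(r := y)" by blast
      have "\<tau> = \<sigma>(r := y)" using \<rho>(3) 3[OF l] unfolding c3 y(2) by simp
      with \<rho>(1) y(1) show "\<exists>y. list_all2 (\<lambda>g y. evals g (map \<sigma> as) y) gs ys \<and> evals f ys y \<and> \<tau> = \<sigma>(r := y)"
        by blast
    next
      fix ys
      assume "\<exists>y. list_all2 (\<lambda>g y. evals g (map \<sigma> as) y) gs ys \<and> evals f ys y \<and> \<tau> = \<sigma>(r := y)"
      then obtain y where y: "list_all2 (\<lambda>g y. evals g (map \<sigma> as) y) gs ys" "evals f ys y"
        "\<tau> = \<sigma>(r := y)" by blast
      have l: "length ys = ?k" using y(1) by (simp add: list_all2_lengthD)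
      have "(upd_list \<sigma> N ys, (upd_list \<sigma> N ys)(r := y)) \<in> rel c2" using 2[OF l] y(2) by blast
      moreover have "((upd_list \<sigma> N ys)(r := y), \<tau>) \<in> rel c3" unfolding c3 3[OF l] y(3) ..
      ultimately show "\<exists>\<rho>. list_all2 (\<lambda>g y. evals g (map \<sigma> as) y) gs ys \<and>
        (upd_list \<sigma> N ys, \<rho>) \<in> rel c2 \<and> (\<rho>, \<tau>) \<in> rel c3"
        using y(1) by blast
    qed
    also have "\<dots> \<longleftrightarrow> (\<exists>y. evals (Comp f gs) (map \<sigma> as) y \<and> \<tau> = \<sigma>(r := y))"
      by (auto simp: evals_Comp_iff)
    finally show "(\<sigma>, \<tau>) \<in> rel (Seq c1 (Seq c2 c3)) \<longleftrightarrow> \<dots>" .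
  qed
  then show "\<exists>c. realizes c (Comp f gs) as r N" ..
qed

text \<open>Lets the existence of intermediate values, which the upward loop of the program
  requires, be absorbed into the existence of the final value.\<close>

lemma evals_PrimRec_downward:
  "evals (PrimRec f g) ((m + k) # xs) z \<Longrightarrow> \<exists>y. evals (PrimRec f g) (m # xs) y"
  by (induction k arbitrary: z) (auto simp: evals_PrimRec_Suc_iff)

text \<open>Register \<open>N\<close> holds the current value, \<open>Suc N\<close> the index
  reached, \<open>N + 2\<close> the number of rounds left, and \<open>N + 3\<close> the result of
  \<open>g\<close>. Copying uses \<open>N + 4\<close> as scratch inside the loop and
  \<open>N + 3\<close> outside.\<close>

lemma realizable_PrimRec:
  assumes f: "realizable f" and g: "realizable g"
  shows "realizable (PrimRec f g)"
proof (rule realizableI)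
  fix as :: "nat list" and r N :: nat
  assume as: "set as \<subseteq> {..<N}" and r: "r < N" "r \<notin> set as"
  show "\<exists>c. realizes c (PrimRec f g) as r N"
  proof (cases as)
    case Nil
    then show ?thesis
      by (intro realizes_undefined) (simp add: not_evals_PrimRec_Nil)
  next
    case (Cons a bs)
    have a: "a < N" "a \<noteq> r" and bs: "set bs \<subseteq> {..<N}" "r \<notin> set bs"
      using as r Cons by auto
    have nbs: "N \<notin> set bs" "Suc N \<notin> set bs" "N + 2 \<notin> set bs" "N + 3 \<notin> set bs" using bs by force+
    obtain cf where cf: "clean (N + 3) \<sigma> \<Longrightarrow>
      (\<sigma>, \<tau>) \<in> rel cf \<longleftrightarrow> (\<exists>y. evals f (map \<sigma> bs) y \<and> \<tau> = \<sigma>(N := y))" for \<sigma> \<tau>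
      using f bs nbs by (elim realizableE[where r = N and as = bs and N = "N + 3"]) force+
    obtain cg where cg: "clean (N + 4) \<sigma> \<Longrightarrow>
      (\<sigma>, \<tau>) \<in> rel cg \<longleftrightarrow> (\<exists>y. evals g (map \<sigma> (N # Suc N # bs)) y \<and> \<tau> = \<sigma>(N + 3 := y))" for \<sigma> \<tau>
      using g bs nbs
      by (elim realizableE[where r = "N + 3" and as = "N # Suc N # bs" and N = "N + 4"]) force+
    define body where "body = Seq cg (Seq (copy (N + 3) N (N + 4)) (Seq (clear (N + 3)) (Inc (Suc N))))"
    have body: "(\<sigma>, \<tau>) \<in> rel body \<longleftrightarrow>
        (\<exists>y. evals g (\<sigma> N # \<sigma> (Suc N) # map \<sigma> bs) y \<and> \<tau> = \<sigma>(N := y, Suc N := Suc (\<sigma> (Suc N))))"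
      if \<sigma>: "clean (N + 3) \<sigma>" for \<sigma> \<tau>
    proof -
      have 1: "clean (N + 4) \<sigma>" using \<sigma> by (rule clean_mono) simp
      have 2: "\<sigma> (N + 3) = 0" "\<sigma> (N + 4) = 0" using \<sigma> by (auto simp: clean_def)
      have "(\<sigma>, \<tau>) \<in> rel body \<longleftrightarrow> (\<exists>y. evals g (\<sigma> N # \<sigma> (Suc N) # map \<sigma> bs) y \<and>
         \<tau> = \<sigma>(N + 3 := y, N := y, N + 3 := 0, Suc N := Suc (\<sigma> (Suc N))))"
        unfolding body_def using 2
        by (auto simp: cg[OF 1] rel_copy)
      moreover have "\<sigma>(N + 3 := y, N := y, N + 3 := 0, Suc N := Suc (\<sigma> (Suc N)))
         = \<sigma>(N := y, Suc N := Suc (\<sigma> (Suc N)))" for y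
        using 2 by (auto simp: fun_eq_iff)
      ultimately show ?thesis by simp
    qed
    \<comment> \<open>The invariant: \<open>N\<close> contains the value at the index in
      \<open>Suc N\<close>, and the registers \<open>Suc N\<close> and \<open>N + 2\<close> add up
      to the argument aimed at.\<close>
    have lp: "(\<sigma>, \<tau>) \<in> rel (loop (N + 2) body) \<longleftrightarrow>
        (\<exists>y. evals (PrimRec f g) ((\<sigma> (Suc N) + \<sigma> (N + 2)) # map \<sigma> bs) y \<and>
          \<tau> = \<sigma>(N := y, Suc N := \<sigma> (Suc N) + \<sigma> (N + 2), N + 2 := 0))"
      if "clean (N + 3) \<sigma>" "evals (PrimRec f g) (\<sigma> (Suc N) # map \<sigma> bs) (\<sigma> N)" for \<sigma> \<tau>
      using that
    proof (induction "\<sigma> (N + 2)" arbitrary: \<sigma>)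
      case 0
      have "\<sigma>(N := y, Suc N := \<sigma> (Suc N), N + 2 := 0) = \<sigma>" if "y = \<sigma> N" for y
        using 0 that by (auto simp: fun_eq_iff)
      moreover have "evals (PrimRec f g) (\<sigma> (Suc N) # map \<sigma> bs) y \<longleftrightarrow> y = \<sigma> N" for y
        using 0 evals_deterministic by blast
      ultimately show ?case
        using 0 by (simp add: rel_loop_unfold[of \<sigma>] del: fun_upd_apply)
    next
      case (Suc n)
      let ?\<sigma> = "\<sigma>(N + 2 := n)"
      let ?i = "\<sigma> (Suc N)"
      have c: "clean (N + 3) ?\<sigma>" using Suc.prems(1) by (auto simp: clean_def)
      have m: "map ?\<sigma> bs = map \<sigma> bs" using nbs by (intro map_upd_notin) auto
      have \<sigma>2: "\<sigma> (N + 2) = Suc n" using Suc.hyps(2) by simp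
      have "(\<sigma>, \<tau>) \<in> rel (loop (N + 2) body) \<longleftrightarrow>
         (\<exists>\<rho>. (?\<sigma>, \<rho>) \<in> rel body \<and> (\<rho>, \<tau>) \<in> rel (loop (N + 2) body))"
        unfolding rel_loop_unfold[of \<sigma>] \<sigma>2 by simp
      also have "\<dots> \<longleftrightarrow> (\<exists>y. evals g (\<sigma> N # ?i # map \<sigma> bs) y \<and>
             (?\<sigma>(N := y, Suc N := Suc ?i), \<tau>) \<in> rel (loop (N + 2) body))"
        unfolding body[OF c] m by (simp del: add_2_eq_Suc') blast
      also have "\<dots> \<longleftrightarrow> (\<exists>y. evals (PrimRec f g) (Suc ?i # map \<sigma> bs) y \<and>
             (?\<sigma>(N := y, Suc N := Suc ?i), \<tau>) \<in> rel (loop (N + 2) body))"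
        using Suc.prems(2) evals_deterministic unfolding evals_PrimRec_Suc_iff by blast
      also have "\<dots> \<longleftrightarrow> (\<exists>z. evals (PrimRec f g) (Suc ?i # map \<sigma> bs) z \<and>
           (\<exists>y. evals (PrimRec f g) ((Suc ?i + n) # map \<sigma> bs) y \<and>
          \<tau> = (?\<sigma>(N := z, Suc N := Suc ?i))(N := y, Suc N := Suc ?i + n, N + 2 := 0)))"
      proof (intro ex_cong1 conj_cong refl)
        fix z assume z: "evals (PrimRec f g) (Suc ?i # map \<sigma> bs) z"
        define \<rho> where "\<rho> = ?\<sigma>(N := z, Suc N := Suc ?i)"
        have \<rho>: "\<rho> N = z" "\<rho> (Suc N) = Suc ?i" "\<rho> (N + 2) = n" "map \<rho> bs = map \<sigma> bs"
          using nbs by (auto simp: \<rho>_def)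
        have "clean (N + 3) \<rho>" using c by (auto simp: clean_def \<rho>_def)
        from Suc.hyps(1)[OF \<rho>(3)[symmetric] this, unfolded \<rho>, OF z]
        show "(?\<sigma>(N := z, Suc N := Suc ?i), \<tau>) \<in> rel (loop (N + 2) body) \<longleftrightarrow> (\<exists>y.
           evals (PrimRec f g) ((Suc ?i + n) # map \<sigma> bs) y \<and>
          \<tau> = (?\<sigma>(N := z, Suc N := Suc ?i))(N := y, Suc N := Suc ?i + n, N + 2 := 0))"
          unfolding \<rho>_def[symmetric] by blast
      qed
      also have "\<dots> \<longleftrightarrow> (\<exists>y. evals (PrimRec f g) ((Suc ?i + n) # map \<sigma> bs) y \<and>
          \<tau> = \<sigma>(N := y, Suc N := Suc ?i + n, N + 2 := 0))"
      proof -
        have "(?\<sigma>(N := z, Suc N := Suc ?i))(N := y, Suc N := Suc ?i + n, N + 2 := 0)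
           = \<sigma>(N := y, Suc N := Suc ?i + n, N + 2 := 0)" for y z
          by (auto simp: fun_eq_iff)
        then show ?thesis using evals_PrimRec_downward[of f g "Suc ?i" n] by metis
      qed
      finally show ?case unfolding \<sigma>2 by simp
    qed
    define c where "c = Seq cf (Seq (copy a (N + 2) (N + 3)) (Seq (loop (N + 2) body)
      (Seq (copy N r (N + 3)) (Seq (clear N) (clear (Suc N))))))"
    have "realizes c (PrimRec f g) as r N"
      unfolding realizes_def
    proof (intro allI impI)
      fix \<sigma> \<tau> :: store
      assume \<sigma>: "clean N \<sigma>"
      have z: "\<sigma> N = 0" "\<sigma> (Suc N) = 0" "\<sigma> (N + 2) = 0" "\<sigma> (N + 3) = 0"
        using \<sigma> by (auto simp: clean_def)
      have 1: "clean (N + 3) \<sigma>" using \<sigma> by (rule clean_mono) simp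
      have lp': "(\<sigma>(N := y, N + 2 := \<sigma> a), \<rho>) \<in> rel (loop (N + 2) body) \<longleftrightarrow>
         (\<exists>w. evals (PrimRec f g) (\<sigma> a # map \<sigma> bs) w \<and>
          \<rho> = \<sigma>(N := w, Suc N := \<sigma> a))" if y: "evals f (map \<sigma> bs) y" for y \<rho>
      proof -
        define \<rho>0 where "\<rho>0 = \<sigma>(N := y, N + 2 := \<sigma> a)"
        have \<rho>0: "\<rho>0 N = y" "\<rho>0 (Suc N) = 0" "\<rho>0 (N + 2) = \<sigma> a" "map \<rho>0 bs = map \<sigma> bs"
          using nbs z by (auto simp: \<rho>0_def)
        have w: "\<rho>0(N := w, Suc N := \<sigma> a, N + 2 := 0) = \<sigma>(N := w, Suc N := \<sigma> a)" for w
          using z by (auto simp: fun_eq_iff \<rho>0_def)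
        have "clean (N + 3) \<rho>0" using 1 by (auto simp: clean_def \<rho>0_def)
        from lp[OF this, unfolded \<rho>0 add_0 w evals_PrimRec_0_iff, OF y] show ?thesis
          unfolding \<rho>0_def .
      qed
      have aN: "a \<noteq> N" "a \<noteq> N + 2" "a \<noteq> N + 3" "r \<noteq> N" "r \<noteq> Suc N" "r \<noteq> N + 3" using a r by auto
      have cp: "(\<sigma>(N := y), \<rho>) \<in> rel (copy a (N + 2) (N + 3)) \<longleftrightarrow> \<rho> = \<sigma>(N := y, N + 2 := \<sigma> a)" for y \<rho>
        using aN z by (simp add: rel_copy)
      have cp': "(\<sigma>(N := w, Suc N := \<sigma> a), \<rho>) \<in> rel (copy N r (N + 3)) \<longleftrightarrow>
          \<rho> = \<sigma>(N := w, Suc N := \<sigma> a, r := w)" for w \<rho>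
        using aN z by (simp add: rel_copy)
      have fin: "\<sigma>(N := w, Suc N := \<sigma> a, r := w, N := 0, Suc N := 0) = \<sigma>(r := w)" for w
        using r z by (auto simp: fun_eq_iff)
      have dn: "\<exists>y. evals f (map \<sigma> bs) y" if "evals (PrimRec f g) (\<sigma> a # map \<sigma> bs) w" for w
        using evals_PrimRec_downward[of f g 0 "\<sigma> a"] that by (auto simp: evals_PrimRec_0_iff)
      have "(\<sigma>, \<tau>) \<in> rel c \<longleftrightarrow> (\<exists>y. evals f (map \<sigma> bs) y \<and>
          (\<exists>w. evals (PrimRec f g) (\<sigma> a # map \<sigma> bs) w \<and> \<tau> = \<sigma>(r := w)))"
      proof -
        have "(\<sigma>, \<tau>) \<in> rel c \<longleftrightarrow> (\<exists>y. evals f (map \<sigma> bs) y \<and>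
           (\<exists>\<rho>1. (\<sigma>(N := y), \<rho>1) \<in> rel (copy a (N + 2) (N + 3)) \<and>
             (\<exists>\<rho>2. (\<rho>1, \<rho>2) \<in> rel (loop (N + 2) body) \<and>
               (\<exists>\<rho>3. (\<rho>2, \<rho>3) \<in> rel (copy N r (N + 3)) \<and> \<tau> = \<rho>3(N := 0, Suc N := 0)))))"
          unfolding c_def rel_iff rel_clear cf[OF 1] by blast
        also have "\<dots> \<longleftrightarrow> (\<exists>y. evals f (map \<sigma> bs) y \<and>
             (\<exists>\<rho>2. (\<sigma>(N := y, N + 2 := \<sigma> a), \<rho>2) \<in> rel (loop (N + 2) body) \<and>
               (\<exists>\<rho>3. (\<rho>2, \<rho>3) \<in> rel (copy N r (N + 3)) \<and> \<tau> = \<rho>3(N := 0, Suc N := 0))))"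
          by (simp only: cp simp_thms)
        also have "\<dots> \<longleftrightarrow> (\<exists>y. evals f (map \<sigma> bs) y \<and>
             (\<exists>w. evals (PrimRec f g) (\<sigma> a # map \<sigma> bs) w \<and>
               (\<exists>\<rho>3. (\<sigma>(N := w, Suc N := \<sigma> a), \<rho>3) \<in> rel (copy N r (N + 3)) \<and>
                 \<tau> = \<rho>3(N := 0, Suc N := 0))))"
          by (intro ex_cong1 conj_cong refl) (simp only: lp', blast)
        also have "\<dots> \<longleftrightarrow> (\<exists>y. evals f (map \<sigma> bs) y \<and>
             (\<exists>w. evals (PrimRec f g) (\<sigma> a # map \<sigma> bs) w \<and> \<tau> = \<sigma>(r := w)))"
          by (simp only: cp' simp_thms fin)
        finally show ?thesis .
      qed
      then show "(\<sigma>, \<tau>) \<in> rel c \<longleftrightarrow> (\<exists>y. evals (PrimRec f g) (map \<sigma> as) y \<and> \<tau> = \<sigma>(r := y))"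
        using dn Cons by auto
    qed
    then show ?thesis ..
  qed
qed

text \<open>The candidate is in \<open>N\<close> and the value of \<open>f\<close> in
  \<open>Suc N\<close>. \<open>Star\<close> guesses the number of rounds; in each round
  \<open>Dec\<close> serves as a guard that the value is positive, and after the last one
  \<open>Test\<close> checks that it is zero. Only the guess of the least root survives
  both.\<close>

lemma realizable_Mu:
  assumes f: "realizable f"
  shows "realizable (Mu f)"
proof (rule realizableI)
  fix as :: "nat list" and r N :: nat
  assume as: "set as \<subseteq> {..<N}" and r: "r < N" "r \<notin> set as"
  have nas: "N \<notin> set as" "Suc N \<notin> set as" using as by force+
  obtain cf where cf: "clean (N + 2) \<sigma> \<Longrightarrow>
      (\<sigma>, \<tau>) \<in> rel cf \<longleftrightarrow> (\<exists>y. evals f (map \<sigma> (N # as)) y \<and> \<tau> = \<sigma>(Suc N := y))" for \<sigma> \<tau>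
    using f as nas
    by (elim realizableE[where r = "Suc N" and as = "N # as" and N = "N + 2"]) force+
  define body where "body = Seq cf (Seq (Dec (Suc N)) (Seq (clear (Suc N)) (Inc N)))"
  define c where "c = Seq (Star body) (Seq cf (Seq (Test (Suc N)) (Seq (copy N r (Suc N)) (clear N))))"
  have body: "(\<sigma>, \<tau>) \<in> rel body \<longleftrightarrow>
      (\<exists>k. evals f (\<sigma> N # map \<sigma> as) (Suc k)) \<and> \<tau> = \<sigma>(N := Suc (\<sigma> N))"
    if \<sigma>: "clean (Suc N) \<sigma>" for \<sigma> \<tau>
  proof -
    have 1: "clean (N + 2) \<sigma>" using \<sigma> by (rule clean_mono) simp
    have 3: "(\<sigma>(Suc N := y), \<rho>) \<in> rel (Dec (Suc N)) \<longleftrightarrow> y > 0 \<and> \<rho> = \<sigma>(Suc N := y - 1)" for y \<rho>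
      by simp
    have 4: "\<sigma>(Suc N := y, Suc N := 0) = \<sigma>" for y using \<sigma> by (auto simp: fun_eq_iff clean_def)
    have 5: "map \<sigma> (N # as) = \<sigma> N # map \<sigma> as" by simp
    have "(\<sigma>, \<tau>) \<in> rel body \<longleftrightarrow> (\<exists>y. evals f (\<sigma> N # map \<sigma> as) y \<and>
       (\<exists>\<rho>. (\<sigma>(Suc N := y), \<rho>) \<in> rel (Dec (Suc N)) \<and>
         (\<exists>\<rho>'. \<rho>' = \<rho>(Suc N := 0) \<and> \<tau> = \<rho>'(N := Suc (\<rho>' N)))))"
      unfolding body_def rel_iff cf[OF 1] rel_clear 5 by blast
    also have "\<dots> \<longleftrightarrow> (\<exists>y. evals f (\<sigma> N # map \<sigma> as) y \<and> y > 0 \<and> \<tau> = \<sigma>(N := Suc (\<sigma> N)))"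
      by (simp only: 3 simp_thms 4 conj_assoc ex_simps)
    finally show ?thesis by (metis gr0_conv_Suc)
  qed
  have "realizes c (Mu f) as r N"
    unfolding realizes_def
  proof (intro allI impI)
    fix \<sigma> \<tau> :: store
    assume \<sigma>: "clean N \<sigma>"
    have z: "\<sigma> N = 0" "\<sigma> (Suc N) = 0" using \<sigma> by (auto simp: clean_def)
    have cl: "clean (Suc N) (\<sigma>(N := n))" for n
      using \<sigma> by (auto simp: clean_def)
    have mp: "map (\<sigma>(N := n)) as = map \<sigma> as" for n
      using nas by (simp add: map_upd_notin)
    have star: "(\<sigma>, \<rho>) \<in> (rel body)\<^sup>* \<longleftrightarrow> (\<exists>n. (\<forall>m<n. \<exists>k. evals f (m # map \<sigma> as) (Suc k)) \<and> \<rho> = \<sigma>(N := n))"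
      (is "_ \<longleftrightarrow> ?S \<rho>") for \<rho>
    proof
      assume "(\<sigma>, \<rho>) \<in> (rel body)\<^sup>*"
      then show "?S \<rho>"
      proof (induction rule: rtrancl_induct)
        case base
        show ?case using z(1) by (intro exI[of _ 0]) (auto simp: fun_eq_iff)
      next
        case (step \<rho> \<rho>')
        then obtain n where n: "\<forall>m<n. \<exists>k. evals f (m # map \<sigma> as) (Suc k)" "\<rho> = \<sigma>(N := n)" by blast
        with step.hyps(2) body[OF cl, of n \<rho>'] mp
        have "(\<exists>k. evals f (n # map \<sigma> as) (Suc k)) \<and> \<rho>' = \<sigma>(N := Suc n)" by simp
        with n show ?case by (intro exI[of _ "Suc n"]) (auto simp: less_Suc_eq)
      qed
    next
      assume "?S \<rho>"
      then obtain n where n: "\<forall>m<n. \<exists>k. evals f (m # map \<sigma> as) (Suc k)" "\<rho> = \<sigma>(N := n)" by blast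
      have "m \<le> n \<Longrightarrow> (\<sigma>, \<sigma>(N := m)) \<in> (rel body)\<^sup>*" for m
      proof (induction m)
        case 0
        have "\<sigma>(N := 0) = \<sigma>" using z by auto
        then show ?case by simp
      next
        case (Suc m)
        then have "(\<sigma>(N := m), \<sigma>(N := Suc m)) \<in> rel body"
          using body[OF cl] mp n by simp
        then show ?case using Suc by (meson Suc_leD rtrancl.rtrancl_into_rtrancl)
      qed
      then show "(\<sigma>, \<rho>) \<in> (rel body)\<^sup>*" using n by simp
    qed
    have cf': "(\<sigma>(N := n), \<rho>) \<in> rel cf \<longleftrightarrow> (\<exists>y. evals f (n # map \<sigma> as) y \<and> \<rho> = \<sigma>(N := n, Suc N := y))"
      for n \<rho>
      using cf[OF clean_mono[OF cl], of n \<rho>] mp by simp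
    have cp: "(\<sigma>(N := n, Suc N := 0), \<rho>) \<in> rel (copy N r (Suc N)) \<longleftrightarrow> \<rho> = \<sigma>(N := n, Suc N := 0, r := n)"
      for n \<rho>
      using r by (subst rel_copy) auto
    have fin: "\<sigma>(N := n, Suc N := 0, r := n, N := 0) = \<sigma>(r := n)" for n
      using r z by (auto simp: fun_eq_iff)
    have test: "(\<exists>\<rho>. (\<sigma>(N := n), \<rho>) \<in> rel cf \<and> \<rho> (Suc N) = 0 \<and> Q \<rho>) \<longleftrightarrow>
        evals f (n # map \<sigma> as) 0 \<and> Q (\<sigma>(N := n, Suc N := 0))" for n Q
      unfolding cf' by (metis fun_upd_same)
    have "(\<sigma>, \<tau>) \<in> rel c \<longleftrightarrow> (\<exists>n. (\<forall>m<n. \<exists>k. evals f (m # map \<sigma> as) (Suc k)) \<and>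
        (\<exists>\<rho>. (\<sigma>(N := n), \<rho>) \<in> rel cf \<and> \<rho> (Suc N) = 0 \<and>
          (\<exists>\<rho>'. (\<rho>, \<rho>') \<in> rel (copy N r (Suc N)) \<and> \<tau> = \<rho>'(N := 0))))"
      unfolding c_def rel_iff star rel_clear by blast
    also have "\<dots> \<longleftrightarrow> (\<exists>n. (\<forall>m<n. \<exists>k. evals f (m # map \<sigma> as) (Suc k)) \<and>
        evals f (n # map \<sigma> as) 0 \<and> \<tau> = \<sigma>(N := n, Suc N := 0, r := n, N := 0))"
      unfolding test cp by simp
    finally have "(\<sigma>, \<tau>) \<in> rel c \<longleftrightarrow> (\<exists>n. (\<forall>m<n. \<exists>k. evals f (m # map \<sigma> as) (Suc k)) \<and>
        evals f (n # map \<sigma> as) 0 \<and> \<tau> = \<sigma>(N := n, Suc N := 0, r := n, N := 0))" .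
    then show "(\<sigma>, \<tau>) \<in> rel c \<longleftrightarrow> (\<exists>y. evals (Mu f) (map \<sigma> as) y \<and> \<tau> = \<sigma>(r := y))"
      unfolding fin evals_Mu_iff by auto
  qed
  then show "\<exists>c. realizes c (Mu f) as r N" ..
qed

lemma realizable: "realizable p"
proof (induction p)
  case (Comp f gs)
  then show ?case by (intro realizable_Comp)
next
  case (PrimRec f g)
  then show ?case by (intro realizable_PrimRec)
next
  case (Mu f)
  then show ?case by (intro realizable_Mu)
qed (rule realizable_Zero realizable_Succ realizable_Proj)+

section \<open>Runs of programs on two inputs\<close>

definition input :: "nat \<Rightarrow> nat \<Rightarrow> store" where
  "input x y = (\<lambda>_. 0)(0 := x, 1 := y)"

lemma evals_program:
  obtains c where "\<And>x y. (\<exists>\<tau>. (input x y, \<tau>) \<in> rel c) \<longleftrightarrow> (\<exists>z. evals p [x, y] z)"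
proof -
  have "\<exists>c. realizes c p [0, 1] 2 3"
    using realizable[of p] unfolding realizable_def by (elim allE impE) auto
  then obtain c where c: "clean 3 \<sigma> \<Longrightarrow>
      (\<sigma>, \<tau>) \<in> rel c \<longleftrightarrow> (\<exists>y. evals p (map \<sigma> [0, 1]) y \<and> \<tau> = \<sigma>(2 := y))" for \<sigma> \<tau>
    unfolding realizes_def by blast
  have "clean 3 (input x y)" for x y by (auto simp: clean_def input_def)
  note c[OF this]
  moreover have "map (input x y) [0, 1] = [x, y]" for x y by (simp add: input_def)
  ultimately have "(\<exists>\<tau>. (input x y, \<tau>) \<in> rel c) \<longleftrightarrow> (\<exists>z. evals p [x, y] z)" for x y
    by metis
  then show ?thesis by (rule that)
qed

text \<open>The control state is the stack of the commands still to be executed; only the finitely many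
  stacks in \<open>stacks c []\<close> and the empty one occur in a run of \<open>c\<close>.\<close>

fun ctl :: "com list \<Rightarrow> com list set" where
  "ctl [] = {}"
| "ctl (Seq a b # k) = {a # b # k}"
| "ctl (Star a # k) = {k, a # Star a # k}"
| "ctl (_ # k) = {k}"

text \<open>Kept apart from \<open>ctl\<close> because the tiles check the stack and the registers
  by separate rules.\<close>

fun eff :: "com list \<Rightarrow> store \<Rightarrow> store \<Rightarrow> bool" where
  "eff (Inc i # k) \<sigma> \<tau> \<longleftrightarrow> (\<sigma>, \<tau>) \<in> rel (Inc i)"
| "eff (Dec i # k) \<sigma> \<tau> \<longleftrightarrow> (\<sigma>, \<tau>) \<in> rel (Dec i)"
| "eff (Test i # k) \<sigma> \<tau> \<longleftrightarrow> (\<sigma>, \<tau>) \<in> rel (Test i)"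
| "eff _ \<sigma> \<tau> \<longleftrightarrow> \<tau> = \<sigma>"

definition step :: "((com list \<times> store) \<times> (com list \<times> store)) set" where
  "step = {((k, \<sigma>), (k', \<tau>)). k' \<in> ctl k \<and> eff k \<sigma> \<tau>}"

text \<open>The relational meaning of a stack, used to read a run backwards: prefixing a step stays
  within the meaning of the earlier stack.\<close>

primrec srel :: "com list \<Rightarrow> (store \<times> store) set" where
  "srel [] = Id"
| "srel (c # k) = rel c O srel k"

lemma srel_step:
  assumes "((k, \<sigma>), (k', \<rho>)) \<in> step" "(\<rho>, \<tau>) \<in> srel k'"
  shows "(\<sigma>, \<tau>) \<in> srel k"
proof -
  have s: "k' \<in> ctl k" "eff k \<sigma> \<rho>" using assms(1) unfolding step_def by blast+
  show ?thesis
  proof (cases k)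
    case (Cons c l)
    show ?thesis
      using s assms(2) Cons
      by (cases c) (auto simp: relcomp_unfold simp del: rel_iff(1,2) rel_Dec_iff,
          meson converse_rtrancl_into_rtrancl)
  qed (use s in simp)
qed

text \<open>Generalized over the rest \<open>k\<close> of the stack, because subcommands run with
  their continuation below them.\<close>

lemma rel_imp_steps: "(\<sigma>, \<tau>) \<in> rel c \<Longrightarrow> ((c # k, \<sigma>), (k, \<tau>)) \<in> step\<^sup>*"
proof (induction c arbitrary: \<sigma> \<tau> k)
  case (Seq a b)
  then obtain \<rho> where \<rho>: "(\<sigma>, \<rho>) \<in> rel a" "(\<rho>, \<tau>) \<in> rel b" by auto
  have "((Seq a b # k, \<sigma>), (a # b # k, \<sigma>)) \<in> step" by (simp add: step_def)
  then show ?case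
    using Seq.IH(1)[OF \<rho>(1), of "b # k"] Seq.IH(2)[OF \<rho>(2), of k] by (meson converse_rtrancl_into_rtrancl rtrancl_trans)
next
  case (Star a)
  from Star.prems have "(\<sigma>, \<tau>) \<in> (rel a)\<^sup>*" by simp
  then show ?case
  proof (induction rule: converse_rtrancl_induct)
    case base
    have "((Star a # k, \<tau>), (k, \<tau>)) \<in> step" by (simp add: step_def)
    then show ?case by blast
  next
    case (step \<sigma> \<rho>)
    have "((Star a # k, \<sigma>), (a # Star a # k, \<sigma>)) \<in> step" by (simp add: step_def)
    then show ?case
      using Star.IH[OF step.hyps(1), of "Star a # k"] step.IH
      by (meson converse_rtrancl_into_rtrancl rtrancl_trans)
  qed
qed (simp_all add: step_def r_into_rtrancl del: rel_iff(1,2) rel_Dec_iff)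

lemma steps_iff_rel: "(([c], \<sigma>), ([], \<tau>)) \<in> step\<^sup>* \<longleftrightarrow> (\<sigma>, \<tau>) \<in> rel c"
proof
  have "(\<sigma>, \<tau>) \<in> srel k" if "((k, \<sigma>), ([], \<tau>)) \<in> step\<^sup>*" for k \<sigma>
    using that
  proof (induction "(k, \<sigma>)" arbitrary: k \<sigma> rule: converse_rtrancl_induct)
    case (step p)
    then show ?case using srel_step by (metis surj_pair)
  qed simp
  from this[of "[c]"] show "(([c], \<sigma>), ([], \<tau>)) \<in> step\<^sup>* \<Longrightarrow> (\<sigma>, \<tau>) \<in> rel c" by simp
  show "(\<sigma>, \<tau>) \<in> rel c \<Longrightarrow> (([c], \<sigma>), ([], \<tau>)) \<in> step\<^sup>*" by (rule rel_imp_steps)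
qed

primrec stacks :: "com \<Rightarrow> com list \<Rightarrow> com list set" where
  "stacks (Inc i) k = {Inc i # k}"
| "stacks (Dec i) k = {Dec i # k}"
| "stacks (Test i) k = {Test i # k}"
| "stacks (Seq a b) k = insert (Seq a b # k) (stacks a (b # k) \<union> stacks b k)"
| "stacks (Star a) k = insert (Star a # k) (stacks a (Star a # k))"

lemma finite_stacks: "finite (stacks c k)"
  by (induction c arbitrary: k) auto

lemma Cons_in_stacks: "c # k \<in> stacks c k"
  by (cases c) auto

text \<open>A subcommand that is finished exposes its continuation, which is the first stack of the
  next command, the enclosing \<open>Star\<close>, or \<open>k\<close> itself.\<close>

lemma ctl_stacks: "l \<in> stacks c k \<Longrightarrow> l' \<in> ctl l \<Longrightarrow> l' \<in> insert k (stacks c k)"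
proof (induction c arbitrary: k)
  case (Seq a b)
  then show ?case using Cons_in_stacks by fastforce
next
  case (Star a)
  then show ?case using Cons_in_stacks by fastforce
qed auto

section \<open>Computable functions\<close>

text \<open>The arity is explicit because terms of \<open>recf\<close> carry none; arguments form a
  list, as in \<open>evals\<close>.\<close>

definition rec_fun :: "nat \<Rightarrow> (nat list \<Rightarrow> nat) \<Rightarrow> bool" where
  "rec_fun n f \<longleftrightarrow> (\<exists>p. \<forall>xs. length xs = n \<longrightarrow> evals p xs (f xs))"

lemma rec_fun_comp:
  assumes "rec_fun (length fs) g" "\<And>f. f \<in> set fs \<Longrightarrow> rec_fun n f"
  shows "rec_fun n (\<lambda>xs. g (map (\<lambda>f. f xs) fs))"
proof -
  obtain q where q: "\<And>xs. length xs = length fs \<Longrightarrow> evals q xs (g xs)"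
    using assms(1) unfolding rec_fun_def by blast
  obtain p where p: "\<And>f xs. f \<in> set fs \<Longrightarrow> length xs = n \<Longrightarrow> evals (p f) xs (f xs)"
    using assms(2) unfolding rec_fun_def by metis
  have "evals (Comp q (map p fs)) xs (g (map (\<lambda>f. f xs) fs))" if "length xs = n" for xs
    using p that by (intro evals_Comp[of _ _ "map (\<lambda>f. f xs) fs"] q) (auto simp: list_all2_conv_all_nth)
  then show ?thesis unfolding rec_fun_def by blast
qed

lemma rec_fun_comp1: "rec_fun 1 (\<lambda>xs. g (xs ! 0)) \<Longrightarrow> rec_fun n f \<Longrightarrow> rec_fun n (\<lambda>xs. g (f xs))"
  using rec_fun_comp[of "[f]" "\<lambda>xs. g (xs ! 0)" n] by simp

lemma rec_fun_comp2:
  "rec_fun 2 (\<lambda>xs. g (xs ! 0) (xs ! 1)) \<Longrightarrow> rec_fun n f \<Longrightarrow> rec_fun n h \<Longrightarrow> rec_fun n (\<lambda>xs. g (f xs) (h xs))"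
  using rec_fun_comp[of "[f, h]" "\<lambda>xs. g (xs ! 0) (xs ! 1)" n] by (auto simp: numeral_2_eq_2)

lemma rec_fun_nth: "i < n \<Longrightarrow> rec_fun n (\<lambda>xs. xs ! i)"
  unfolding rec_fun_def using evals_Proj by blast

lemma length_1_iff: "length xs = Suc 0 \<longleftrightarrow> (\<exists>x. xs = [x])"
  by (auto simp: length_Suc_conv)

lemma rec_fun_Suc:
  assumes "rec_fun n f"
  shows "rec_fun n (\<lambda>xs. Suc (f xs))"
proof -
  have "rec_fun 1 (\<lambda>xs. Suc (xs ! 0))"
    unfolding rec_fun_def by (intro exI[of _ Succ]) (auto simp: length_1_iff intro: evals_Succ)
  from rec_fun_comp1[OF this assms] show ?thesis .
qed

lemma rec_fun_const: "rec_fun n (\<lambda>_. k)"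
proof (induction k)
  case 0
  show ?case unfolding rec_fun_def using evals_Zero by blast
qed (rule rec_fun_Suc)

lemma rec_fun_primrec:
  assumes "rec_fun n f" "rec_fun (Suc (Suc n)) g"
    and base: "\<And>xs. length xs = n \<Longrightarrow> h (0 # xs) = f xs"
    and step: "\<And>m xs. length xs = n \<Longrightarrow> h (Suc m # xs) = g (h (m # xs) # m # xs)"
  shows "rec_fun (Suc n) h"
proof -
  obtain p q where p: "\<And>xs. length xs = n \<Longrightarrow> evals p xs (f xs)"
    and q: "\<And>xs. length xs = Suc (Suc n) \<Longrightarrow> evals q xs (g xs)"
    using assms(1,2) unfolding rec_fun_def by blast
  have "evals (PrimRec p q) (m # xs) (h (m # xs))" if xs: "length xs = n" for m xs
  proof (induction m)
    case 0
    show ?case using p[OF xs] by (simp add: base[OF xs] evals_PrimRec_0)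
  next
    case (Suc m)
    have "evals q (h (m # xs) # m # xs) (h (Suc m # xs))"
      using q[of "h (m # xs) # m # xs"] xs by (simp add: step[OF xs])
    with Suc show ?case by (rule evals_PrimRec_Suc)
  qed
  then have "evals (PrimRec p q) xs (h xs)" if "length xs = Suc n" for xs
    using that by (cases xs) auto
  then show ?thesis unfolding rec_fun_def by blast
qed

lemma rec_fun_add:
  assumes "rec_fun n f" "rec_fun n g"
  shows "rec_fun n (\<lambda>xs. f xs + g xs)"
proof -
  have "rec_fun (Suc 1) (\<lambda>xs. xs ! 0 + xs ! 1)"
    by (rule rec_fun_primrec[where f = "\<lambda>xs. xs ! 0" and g = "\<lambda>xs. Suc (xs ! 0)"])
      (auto intro!: rec_fun_nth rec_fun_Suc)
  then have "rec_fun 2 (\<lambda>xs. xs ! 0 + xs ! 1)" by (simp add: numeral_2_eq_2)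
  from rec_fun_comp2[OF this assms] show ?thesis .
qed

lemma rec_fun_pred:
  assumes "rec_fun n f"
  shows "rec_fun n (\<lambda>xs. f xs - 1)"
proof -
  have "rec_fun (Suc 0) (\<lambda>xs. xs ! 0 - 1)"
    by (rule rec_fun_primrec[where f = "\<lambda>_. 0" and g = "\<lambda>xs. xs ! 1"])
      (auto intro!: rec_fun_nth rec_fun_const)
  then have "rec_fun 1 (\<lambda>xs. xs ! 0 - 1)" by simp
  from rec_fun_comp1[OF this assms] show ?thesis .
qed

lemma rec_fun_diff:
  assumes "rec_fun n f" "rec_fun n g"
  shows "rec_fun n (\<lambda>xs. f xs - g xs)"
proof -
  \<comment> \<open>Recursion runs over the first argument, so the subtrahend comes first; the
    arguments are swapped back at the end.\<close>
  have "rec_fun (Suc 1) (\<lambda>xs. xs ! 1 - xs ! 0)"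
  proof (rule rec_fun_primrec[where f = "\<lambda>xs. xs ! 0" and g = "\<lambda>xs. xs ! 0 - 1"])
    show "rec_fun (Suc (Suc 1)) (\<lambda>xs. xs ! 0 - 1)" by (intro rec_fun_pred rec_fun_nth) simp
  qed (auto intro!: rec_fun_nth)
  then have "rec_fun 2 (\<lambda>xs. xs ! 1 - xs ! 0)" by (simp add: numeral_2_eq_2)
  from rec_fun_comp2[OF this assms(2,1)] show ?thesis .
qed

lemma rec_fun_triangle:
  assumes "rec_fun n f"
  shows "rec_fun n (\<lambda>xs. triangle (f xs))"
proof -
  have "rec_fun (Suc 0) (\<lambda>xs. triangle (xs ! 0))"
    by (rule rec_fun_primrec[where f = "\<lambda>_. 0" and g = "\<lambda>xs. xs ! 0 + Suc (xs ! 1)"])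
      (auto intro!: rec_fun_Suc[OF rec_fun_add] rec_fun_nth rec_fun_const)
  then have "rec_fun 1 (\<lambda>xs. triangle (xs ! 0))" by simp
  from rec_fun_comp1[OF this assms] show ?thesis .
qed

lemma rec_fun_prod_encode:
  "rec_fun n f \<Longrightarrow> rec_fun n g \<Longrightarrow> rec_fun n (\<lambda>xs. prod_encode (f xs, g xs))"
  unfolding prod_encode_def by (auto intro!: rec_fun_add rec_fun_triangle)

lemma rec_fun_list_encode_Cons:
  "rec_fun n f \<Longrightarrow> rec_fun n (\<lambda>xs. list_encode (g xs)) \<Longrightarrow> rec_fun n (\<lambda>xs. list_encode (f xs # g xs))"
  unfolding list_encode.simps by (intro rec_fun_Suc rec_fun_prod_encode)

text \<open>A decision procedure becomes a semi-decision procedure: search for a root of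
  \<open>1 - v\<close>, where \<open>v\<close> is the answer.\<close>

lemma halts_iff_accepted:
  assumes "rec_fun 2 f"
  obtains q where "\<And>x y b. evals p [f [x, y]] (if b then 1 else 0) \<Longrightarrow> (\<exists>z. evals q [x, y] z) \<longleftrightarrow> b"
proof -
  obtain a where a: "\<And>x y. evals a [x, y] (f [x, y])"
    using assms unfolding rec_fun_def by (metis One_nat_def length_Cons list.size(3) numeral_2_eq_2)
  obtain m where m: "\<And>v. evals m [v] (1 - v)"
    using rec_fun_diff[OF rec_fun_const rec_fun_nth, of 0 1 1] unfolding rec_fun_def
    by (metis One_nat_def length_Cons less_one list.size(3) nth_Cons_0)
  \<comment> \<open>Argument 0 is the search variable, hence the projections 1 and 2. The value does
    not depend on it, so the search succeeds at once or never.\<close>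
  define t where "t = Comp m [Comp p [Comp a [Proj 1, Proj 2]]]"
  have "(\<exists>z. evals (Mu t) [x, y] z) \<longleftrightarrow> b" if p: "evals p [f [x, y]] (if b then 1 else 0)" for x y b
  proof -
    have t: "evals t [n, x, y] (if b then 0 else 1)" for n
    proof -
      have "evals (Proj 1) [n, x, y] ([n, x, y] ! 1)" "evals (Proj 2) [n, x, y] ([n, x, y] ! 2)"
        by (rule evals_Proj; simp)+
      then have "evals (Comp a [Proj 1, Proj 2]) [n, x, y] (f [x, y])"
        by (intro evals_Comp[OF _ a]) (simp add: numeral_2_eq_2)
      then have "evals (Comp p [Comp a [Proj 1, Proj 2]]) [n, x, y] (if b then 1 else 0)"
        by (intro evals_Comp[OF _ p]) simp
      then have "evals t [n, x, y] (1 - (if b then 1 else 0))"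
        unfolding t_def by (intro evals_Comp[OF _ m]) simp
      then show ?thesis by (simp split: if_splits)
    qed
    show ?thesis
    proof (cases b)
      case True
      then have "evals (Mu t) [x, y] 0" using t[of 0] by (simp add: evals_Mu_iff)
      with True show ?thesis by blast
    next
      case False
      have "\<not> evals (Mu t) [x, y] z" for z
        using t[of z] False evals_deterministic[of t "[z, x, y]" 0 1] by (auto simp: evals_Mu_iff)
      with False show ?thesis by blast
    qed
  qed
  then show ?thesis by (rule that)
qed

section \<open>Tilings of rectangles by halting runs\<close>

text \<open>A halting run is drawn as a rectangle with one row per configuration, from bottom to top. All
  tiles of a row carry the current stack, and the value of register \<open>i\<close> is the number of tiles in the
  row whose \<open>bits\<close> contain \<open>i\<close>. The four flags tell on which sides of the rectangle the tile lies.\<close>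

datatype tile = Tile (lft: bool) (rgt: bool) (bot: bool) (top: bool) (stk: "com list") (bits: "nat set")

definition corner :: "tile \<Rightarrow> bool" where
  "corner t \<longleftrightarrow> lft t \<and> bot t"

text \<open>The last of the tiles in the bottom row that count for register \<open>i\<close>.\<close>

definition mark :: "nat \<Rightarrow> tile \<Rightarrow> tile \<Rightarrow> bool" where
  "mark i t r \<longleftrightarrow> bot t \<and> i \<in> bits t \<and> (\<not> rgt t \<longrightarrow> i \<notin> bits r)"

text \<open>\<open>Inc i\<close> shifts the counting tiles of the row one column to the right and
  adds the leftmost one, which requires the last column to be free; \<open>Dec i\<close> undoes such
  a shift and requires the leftmost tile to count. Each rule thus changes the number by one while
  looking only at adjacent tiles.\<close>

fun bits_rule :: "com list \<Rightarrow> tile \<Rightarrow> tile \<Rightarrow> tile \<Rightarrow> tile \<Rightarrow> bool" where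
  "bits_rule (Inc i # k) t r u l \<longleftrightarrow> (rgt t \<longrightarrow> i \<notin> bits t) \<and>
     (\<forall>j. j \<in> bits u \<longleftrightarrow> (if j = i then lft t \<or> i \<in> bits l else j \<in> bits t))"
| "bits_rule (Dec i # k) t r u l \<longleftrightarrow> (lft t \<longrightarrow> i \<in> bits t) \<and>
     (\<forall>j. j \<in> bits u \<longleftrightarrow> (if j = i then \<not> rgt t \<and> i \<in> bits r else j \<in> bits t))"
| "bits_rule (Test i # k) t r u l \<longleftrightarrow> i \<notin> bits t \<and> bits u = bits t"
| "bits_rule _ t r u l \<longleftrightarrow> bits u = bits t"

text \<open>The arguments \<open>r u l d\<close> are the right, upper, left and lower neighbours of \<open>t\<close>, and \<open>m0\<close> and \<open>m1\<close>
  are the tiles from which \<open>t\<close> is reached by the two offsets encoding the input.\<close>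

definition fits :: "com \<Rightarrow> tile \<Rightarrow> tile \<Rightarrow> tile \<Rightarrow> tile \<Rightarrow> tile \<Rightarrow> tile \<Rightarrow> tile \<Rightarrow> bool" where
  "fits c t r u l d m0 m1 \<longleftrightarrow>
     (lft t \<longleftrightarrow> rgt l) \<and> (bot t \<longleftrightarrow> top d) \<and>
     (\<not> rgt t \<longrightarrow> stk r = stk t \<and> top r = top t \<and> bot r = bot t) \<and>
     (\<not> top t \<longrightarrow> rgt u = rgt t \<and> lft u = lft t \<and> stk u \<in> ctl (stk t) \<and> bits_rule (stk t) t r u l) \<and>
     (top t \<longrightarrow> stk t = []) \<and>
     (bot t \<longrightarrow> stk t = [c] \<and> bits t \<subseteq> {0, 1} \<and> (\<not> rgt t \<longrightarrow> bits r \<subseteq> bits t)) \<and>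
     (corner m0 \<longrightarrow> mark 0 t r) \<and> (corner m1 \<longrightarrow> mark 1 t r)"

text \<open>The planar form of \<open>closed_good\<close>, with states replaced by tiles.\<close>

definition region :: "com \<Rightarrow> nat \<Rightarrow> nat \<Rightarrow> (int \<Rightarrow> int \<Rightarrow> tile) \<Rightarrow> (int \<times> int) set \<Rightarrow> bool" where
  "region c m n T C \<longleftrightarrow> finite C \<and> C \<noteq> {} \<and>
     (\<forall>x y. \<not> rgt (T x y) \<longrightarrow> ((x, y) \<in> C \<longleftrightarrow> (x + 1, y) \<in> C)) \<and>
     (\<forall>x y. \<not> top (T x y) \<longrightarrow> ((x, y) \<in> C \<longleftrightarrow> (x, y + 1) \<in> C)) \<and>
     (\<forall>x y. corner (T x y) \<longrightarrow> ((x, y) \<in> C \<longleftrightarrow> (x + int m, y) \<in> C)) \<and>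
     (\<forall>x y. corner (T x y) \<longrightarrow> ((x, y) \<in> C \<longleftrightarrow> (x + int n, y) \<in> C)) \<and>
     (\<forall>(x, y)\<in>C. fits c (T x y) (T (x + 1) y) (T x (y + 1)) (T (x - 1) y) (T x (y - 1))
        (T (x - int m) y) (T (x - int n) y))"

section \<open>From tilings to halting runs\<close>

text \<open>An injective path cannot stay in a finite set forever, and it can leave \<open>C\<close>
  only after \<open>P\<close> has occurred; the witness is the first occurrence.\<close>

lemma walk:
  fixes f :: "nat \<Rightarrow> 'a"
  assumes C: "finite C" and f: "inj f" "f 0 \<in> C"
    and step: "\<And>n. f n \<in> C \<Longrightarrow> \<not> P (f n) \<Longrightarrow> f (Suc n) \<in> C"
  obtains n where "P (f n)" "\<And>m. m \<le> n \<Longrightarrow> f m \<in> C" "\<And>m. m < n \<Longrightarrow> \<not> P (f m)"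
proof -
  have in_C: "f n \<in> C" if "\<And>m. m < n \<Longrightarrow> \<not> P (f m)" for n
    using that by (induction n) (auto simp: f step)
  have "\<exists>n. P (f n)"
  proof (rule ccontr)
    assume "\<nexists>n. P (f n)"
    with in_C have "range f \<subseteq> C" by blast
    with C f(1) show False using finite_subset finite_imageD infinite_UNIV_nat by blast
  qed
  then have "P (f (LEAST n. P (f n)))" by (rule LeastI_ex)
  moreover have min: "\<not> P (f m)" if "m < (LEAST n. P (f n))" for m
    using that by (rule not_less_Least)
  moreover have "f m \<in> C" if "m \<le> (LEAST n. P (f n))" for m
    using that by (intro in_C min) (rule less_le_trans)
  ultimately show ?thesis using that[of "LEAST n. P (f n)"] by blast
qed

text \<open>Every corner spans a rectangle that carries a run. The corner chosen has the largest
  first coordinate, which is what ties the input edges to its own rectangle.\<close>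

lemma region_halts:
  assumes "region c m n T C"
  shows "\<exists>\<tau>. (([c], input (Suc m) (Suc n)), ([], \<tau>)) \<in> step\<^sup>*"
proof -
  have C: "finite C" "C \<noteq> {}"
    and H: "\<And>x y. \<not> rgt (T x y) \<Longrightarrow> (x, y) \<in> C \<longleftrightarrow> (x + 1, y) \<in> C"
    and V: "\<And>x y. \<not> top (T x y) \<Longrightarrow> (x, y) \<in> C \<longleftrightarrow> (x, y + 1) \<in> C"
    and I0: "\<And>x y. corner (T x y) \<Longrightarrow> (x, y) \<in> C \<Longrightarrow> (x + int m, y) \<in> C"
    and I1: "\<And>x y. corner (T x y) \<Longrightarrow> (x, y) \<in> C \<Longrightarrow> (x + int n, y) \<in> C"
    and G: "\<And>x y. (x, y) \<in> C \<Longrightarrow> fits c (T x y) (T (x + 1) y) (T x (y + 1)) (T (x - 1) y) (T x (y - 1))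
        (T (x - int m) y) (T (x - int n) y)"
    using assms unfolding region_def by blast+

  have left: "(x - 1, y) \<in> C \<and> bot (T (x - 1) y) = bot (T x y)" if "(x, y) \<in> C" "\<not> lft (T x y)" for x y
  proof -
    have r: "\<not> rgt (T (x - 1) y)" using G[OF that(1)] that(2) unfolding fits_def by blast
    then have "(x - 1, y) \<in> C" using H[of "x - 1" y] that(1) by simp
    with G[OF this] r show ?thesis unfolding fits_def by simp
  qed
  have down: "(x, y - 1) \<in> C \<and> lft (T x (y - 1)) = lft (T x y)" if "(x, y) \<in> C" "\<not> bot (T x y)" for x y
  proof -
    have r: "\<not> top (T x (y - 1))" using G[OF that(1)] that(2) unfolding fits_def by blast
    then have "(x, y - 1) \<in> C" using V[of x "y - 1"] that(1) by simp
    with G[OF this] r show ?thesis unfolding fits_def by simp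
  qed
  define K where "K = {(x, y) \<in> C. corner (T x y)}"
  \<comment> \<open>From any cell, go left to a left side and then down along left sides to a
    bottom.\<close>
  have "K \<noteq> {}"
  proof -
    obtain x y where xy: "(x, y) \<in> C" using C(2) by auto
    obtain a where a: "lft (T (x - int a) y)" "(x - int a, y) \<in> C"
    proof (rule walk[of C "\<lambda>a. (x - int a, y)" "\<lambda>(x, y). lft (T x y)"])
      show "inj (\<lambda>a. (x - int a, y))" by (auto simp: inj_def)
      fix a
      assume "(x - int a, y) \<in> C" "\<not> (case (x - int a, y) of (x, y) \<Rightarrow> lft (T x y))"
      then show "(x - int (Suc a), y) \<in> C" using left[of "x - int a" y] by (simp add: algebra_simps)
    qed (use C xy in auto)
    let ?x = "x - int a"
    obtain b where b: "bot (T ?x (y - int b))" "(?x, y - int b) \<in> {(x, y) \<in> C. lft (T x y)}"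
    proof (rule walk[of "{(x, y) \<in> C. lft (T x y)}" "\<lambda>b. (?x, y - int b)" "\<lambda>(x, y). bot (T x y)"])
      show "inj (\<lambda>b. (?x, y - int b))" by (auto simp: inj_def)
      show "finite {(x, y) \<in> C. lft (T x y)}" using C(1) by (rule rev_finite_subset) auto
      fix b
      assume "(?x, y - int b) \<in> {(x, y) \<in> C. lft (T x y)}"
        "\<not> (case (?x, y - int b) of (x, y) \<Rightarrow> bot (T x y))"
      then show "(?x, y - int (Suc b)) \<in> {(x, y) \<in> C. lft (T x y)}"
        using down[of ?x "y - int b"] by (simp add: algebra_simps)
    qed (use a in auto)
    then have "(?x, y - int b) \<in> K" by (auto simp: K_def corner_def)
    then show ?thesis by blast
  qed
  moreover have "finite K" unfolding K_def using C(1) by (rule rev_finite_subset) auto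
  ultimately have "Max (fst ` K) \<in> fst ` K" and le: "\<And>p. p \<in> K \<Longrightarrow> fst p \<le> Max (fst ` K)"
    by auto
  then obtain p where "p \<in> K" "fst p = Max (fst ` K)" by (metis imageE)
  then obtain x0 y0 where K0: "(x0, y0) \<in> K" and K_max: "\<And>x y. (x, y) \<in> K \<Longrightarrow> x \<le> x0"
    using le by (cases p) force
  have C0: "(x0, y0) \<in> C" and corner0: "lft (T x0 y0)" "bot (T x0 y0)"
    using K0 by (auto simp: K_def corner_def)

  define t where "t i j = T (x0 + int i) (y0 + int j)" for i j
  define M where "M i j \<longleftrightarrow> (x0 + int i, y0 + int j) \<in> C" for i j
  have t0: "M 0 0" "lft (t 0 0)" "bot (t 0 0)" using C0 corner0 by (auto simp: t_def M_def)
  have Gl: "lft (t (Suc i) j) \<longleftrightarrow> rgt (t i j)" if "M (Suc i) j" for i j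
    using G[OF that[unfolded M_def]] unfolding fits_def t_def by simp
  have Gb: "bot (t i (Suc j)) \<longleftrightarrow> top (t i j)" if "M i (Suc j)" for i j
    using G[OF that[unfolded M_def]] unfolding fits_def t_def by simp
  have suc: "x0 + int i + 1 = x0 + int (Suc i)" "y0 + int j + 1 = y0 + int (Suc j)" for i j by simp_all
  have Gr: "stk (t (Suc i) j) = stk (t i j) \<and> top (t (Suc i) j) = top (t i j) \<and> bot (t (Suc i) j) = bot (t i j)"
    if "M i j" "\<not> rgt (t i j)" for i j
    using G[OF that(1)[unfolded M_def]] that(2) unfolding fits_def t_def suc by blast
  have Gu: "rgt (t i (Suc j)) = rgt (t i j) \<and> lft (t i (Suc j)) = lft (t i j) \<and> stk (t i (Suc j)) \<in> ctl (stk (t i j)) \<and>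
      bits_rule (stk (t i j)) (t i j) (t (Suc i) j) (t i (Suc j)) (T (x0 + int i - 1) (y0 + int j))"
    if "M i j" "\<not> top (t i j)" for i j
    using G[OF that(1)[unfolded M_def]] that(2) unfolding fits_def t_def suc by blast
  have Gt: "stk (t i j) = []" if "M i j" "top (t i j)" for i j
    using G[OF that(1)[unfolded M_def]] that(2) unfolding fits_def t_def by blast
  have Gbot: "stk (t i j) = [c] \<and> bits (t i j) \<subseteq> {0, 1} \<and> (\<not> rgt (t i j) \<longrightarrow> bits (t (Suc i) j) \<subseteq> bits (t i j))"
    if "M i j" "bot (t i j)" for i j
    using G[OF that(1)[unfolded M_def]] that(2) unfolding fits_def t_def suc by blast
  have MH: "M (Suc i) j \<longleftrightarrow> M i j" if "\<not> rgt (t i j)" for i j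
    using H[of "x0 + int i" "y0 + int j"] that unfolding M_def t_def suc by simp
  have MV: "M i (Suc j) \<longleftrightarrow> M i j" if "\<not> top (t i j)" for i j
    using V[of "x0 + int i" "y0 + int j"] that unfolding M_def t_def suc by simp

  \<comment> \<open>\<open>w\<close> and \<open>h\<close> are the indices of the last column and
    row, one less than the numbers of columns and rows.\<close>
  obtain w where w: "rgt (t w 0)" "\<And>i. i \<le> w \<Longrightarrow> M i 0" "\<And>i. i < w \<Longrightarrow> \<not> rgt (t i 0)"
  proof (rule walk[of C "\<lambda>i. (x0 + int i, y0 + int 0)" "\<lambda>(x, y). rgt (T x y)"])
    show "inj (\<lambda>i. (x0 + int i, y0 + int 0))" by (auto simp: inj_def)
  qed (use C C0 H in \<open>auto simp: t_def M_def algebra_simps\<close>)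
  obtain h where h: "top (t 0 h)" "\<And>j. j \<le> h \<Longrightarrow> M 0 j" "\<And>j. j < h \<Longrightarrow> \<not> top (t 0 j)"
  proof (rule walk[of C "\<lambda>j. (x0 + int 0, y0 + int j)" "\<lambda>(x, y). top (T x y)"])
    show "inj (\<lambda>j. (x0 + int 0, y0 + int j))" by (auto simp: inj_def)
  qed (use C C0 V in \<open>auto simp: t_def M_def algebra_simps\<close>)
  \<comment> \<open>A row inherits its side flags from the row below, while \<open>top\<close> and
    the stack spread through it from column 0.\<close>
  have grid: "\<forall>i\<le>w. M i j \<and> (rgt (t i j) \<longleftrightarrow> i = w) \<and> (lft (t i j) \<longleftrightarrow> i = 0) \<and> (bot (t i j) \<longleftrightarrow> j = 0) \<and>
      (top (t i j) \<longleftrightarrow> j = h) \<and> stk (t i j) = stk (t 0 j)" if "j \<le> h" for j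
    using that
  proof (induction j)
    case 0
    have r: "rgt (t i 0) \<longleftrightarrow> i = w" if "i \<le> w" for i using w that le_neq_implies_less by blast
    have row: "bot (t i 0) \<and> top (t i 0) = top (t 0 0) \<and> stk (t i 0) = stk (t 0 0)" if "i \<le> w" for i
      using that
    proof (induction i)
      case (Suc i)
      then show ?case using Gr[of i 0] w(2,3)[of i] by simp
    qed (use t0 in simp)
    have l: "lft (t i 0) \<longleftrightarrow> i = 0" if "i \<le> w" for i
      using that Gl[of "i - 1" 0] w(2)[of i] r[of "i - 1"] t0 by (cases i) auto
    have tp: "top (t 0 0) \<longleftrightarrow> 0 = h" using h(1) h(3)[of 0] by (cases h) auto
    show ?case
    proof (intro allI impI)
      fix i assume i: "i \<le> w"
      show "M i 0 \<and> (rgt (t i 0) \<longleftrightarrow> i = w) \<and> (lft (t i 0) \<longleftrightarrow> i = 0) \<and> (bot (t i 0) \<longleftrightarrow> (0::nat) = 0) \<and>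
        (top (t i 0) \<longleftrightarrow> 0 = h) \<and> stk (t i 0) = stk (t 0 0)"
        using r[OF i] l[OF i] row[OF i] tp w(2)[OF i] by simp
    qed
  next
    case (Suc j)
    then have IH: "M i j" "rgt (t i j) \<longleftrightarrow> i = w" "lft (t i j) \<longleftrightarrow> i = 0" "\<not> top (t i j)" if "i \<le> w" for i
      using that by simp_all
    have M: "M i (Suc j)" if "i \<le> w" for i using IH[OF that] MV by blast
    have rl: "rgt (t i (Suc j)) \<longleftrightarrow> i = w" "lft (t i (Suc j)) \<longleftrightarrow> i = 0" "bot (t i (Suc j)) \<longleftrightarrow> Suc j = 0"
      if "i \<le> w" for i
      using IH[OF that] Gu[of i j] Gb[OF M[OF that]] by simp_all
    have row: "top (t i (Suc j)) = top (t 0 (Suc j)) \<and> stk (t i (Suc j)) = stk (t 0 (Suc j))" if "i \<le> w" for i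
      using that
    proof (induction i)
      case (Suc i)
      then show ?case using Gr[of i "Suc j"] M[of i] rl(1)[of i] by simp
    qed simp
    have tp: "top (t 0 (Suc j)) \<longleftrightarrow> Suc j = h"
      using h(1) h(3)[of "Suc j"] Suc.prems by (cases "Suc j = h") auto
    show ?case
    proof (intro allI impI)
      fix i assume i: "i \<le> w"
      show "M i (Suc j) \<and> (rgt (t i (Suc j)) \<longleftrightarrow> i = w) \<and> (lft (t i (Suc j)) \<longleftrightarrow> i = 0) \<and>
        (bot (t i (Suc j)) \<longleftrightarrow> Suc j = 0) \<and> (top (t i (Suc j)) \<longleftrightarrow> Suc j = h) \<and>
        stk (t i (Suc j)) = stk (t 0 (Suc j))"
        using rl[OF i] row[OF i] tp M[OF i] by simp
    qed
  qed
  have left_t: "T (x0 + int (Suc i) - 1) (y0 + int j) = t i j" for i j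
    by (simp add: t_def)

  define S where "S j k = {i. i \<le> w \<and> k \<in> bits (t i j)}" for j k
  define \<sigma> where "\<sigma> j k = card (S j k)" for j k
  have S_fin: "finite (S j k)" for j k by (auto simp: S_def)
  have run: "((stk (t 0 j), \<sigma> j), (stk (t 0 (Suc j)), \<sigma> (Suc j))) \<in> step" if j: "j < h" for j
  proof -
    have g: "M i j" "rgt (t i j) \<longleftrightarrow> i = w" "lft (t i j) \<longleftrightarrow> i = 0" "\<not> top (t i j)" "stk (t i j) = stk (t 0 j)"
      if "i \<le> w" for i
      using grid[of j, THEN spec, THEN mp, of i] j that by simp_all
    have br: "bits_rule (stk (t 0 j)) (t i j) (t (Suc i) j) (t i (Suc j)) (T (x0 + int i - 1) (y0 + int j))"
      if "i \<le> w" for i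
      using Gu[of i j] g[OF that] by simp
    have ctl: "stk (t 0 (Suc j)) \<in> ctl (stk (t 0 j))" using Gu[of 0 j] g[of 0] by simp
    have eff_id: "\<sigma> (Suc j) = \<sigma> j" if "\<And>i. i \<le> w \<Longrightarrow> bits (t i (Suc j)) = bits (t i j)"
    proof -
      have "S (Suc j) k = S j k" for k unfolding S_def using that by blast
      then show ?thesis by (simp add: \<sigma>_def fun_eq_iff)
    qed
    have "eff (stk (t 0 j)) (\<sigma> j) (\<sigma> (Suc j))"
    proof (cases "stk (t 0 j)")
      case (Cons d k)
      note br = br[unfolded Cons]
      show ?thesis
      proof (cases d)
        case (Inc a)
        have eq: "S (Suc j) b = S j b" if "b \<noteq> a" for b
          using br that unfolding Inc S_def by auto
        have wa: "w \<notin> S j a" using br[of w] g(2)[of w] unfolding Inc S_def by auto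
        have "S (Suc j) a = insert 0 (Suc ` S j a)"
        proof (intro equalityI subsetI)
          fix i assume i: "i \<in> S (Suc j) a"
          then have "i \<le> w" "lft (t i j) \<or> a \<in> bits (T (x0 + int i - 1) (y0 + int j))"
            using br[of i] unfolding Inc S_def by auto
          then show "i \<in> insert 0 (Suc ` S j a)"
            using g(3)[of i] left_t by (cases i) (auto simp: S_def)
        next
          fix i assume i: "i \<in> insert 0 (Suc ` S j a)"
          then have "i \<le> w" using wa by (auto simp: S_def) (metis le_antisym not_less_eq_eq)
          moreover have "lft (t i j) \<or> a \<in> bits (T (x0 + int i - 1) (y0 + int j))"
            using i \<open>i \<le> w\<close> g(3)[of i] left_t by (cases i) (auto simp: S_def)
          ultimately show "i \<in> S (Suc j) a" using br[of i] unfolding Inc S_def by auto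
        qed
        then have "\<sigma> (Suc j) a = Suc (\<sigma> j a)"
          using S_fin by (simp add: \<sigma>_def card_image)
        with eq have "\<sigma> (Suc j) = (\<sigma> j)(a := Suc (\<sigma> j a))" by (auto simp: \<sigma>_def)
        then show ?thesis unfolding Cons Inc by simp
      next
        case (Dec a)
        have eq: "S (Suc j) b = S j b" if "b \<noteq> a" for b
          using br that unfolding Dec S_def by auto
        have "S j a = insert 0 (Suc ` S (Suc j) a)"
        proof (intro equalityI subsetI)
          fix i assume i: "i \<in> S j a"
          show "i \<in> insert 0 (Suc ` S (Suc j) a)"
          proof (cases i)
            case (Suc i')
            then have "i' \<le> w" "i' \<noteq> w" "a \<in> bits (t (Suc i') j)" using i by (auto simp: S_def)
            with br[of i'] g(2)[of i'] have "i' \<in> S (Suc j) a" unfolding Dec S_def by auto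
            with Suc show ?thesis by blast
          qed simp
        next
          fix i assume i: "i \<in> insert 0 (Suc ` S (Suc j) a)"
          show "i \<in> S j a"
          proof (cases i)
            case 0
            then show ?thesis using br[of 0] g(3)[of 0] unfolding Dec S_def by auto
          next
            case (Suc i')
            with i have i': "i' \<in> S (Suc j) a" by auto
            then have "i' \<le> w" by (simp add: S_def)
            with br[of i'] g(2)[of i'] i' Suc show ?thesis unfolding Dec S_def by auto
          qed
        qed
        then have "\<sigma> j a = Suc (\<sigma> (Suc j) a)"
          using S_fin by (simp add: \<sigma>_def card_image)
        with eq have "\<sigma> (Suc j) = (\<sigma> j)(a := \<sigma> j a - 1)" "\<sigma> j a > 0" by (auto simp: \<sigma>_def)
        then show ?thesis unfolding Cons Dec by simp
      next
        case (Test a)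
        then have "S j a = {}" using br unfolding Test S_def by auto
        moreover have "\<sigma> (Suc j) = \<sigma> j" using br unfolding Test by (intro eff_id) auto
        ultimately show ?thesis unfolding Cons Test by (simp add: \<sigma>_def)
      next
        case (Seq a b)
        then have "\<sigma> (Suc j) = \<sigma> j" using br unfolding Seq by (intro eff_id) auto
        then show ?thesis unfolding Cons Seq by simp
      next
        case (Star a)
        then have "\<sigma> (Suc j) = \<sigma> j" using br unfolding Star by (intro eff_id) auto
        then show ?thesis unfolding Cons Star by simp
      qed
    qed (use ctl in simp)
    with ctl show ?thesis by (simp add: step_def)
  qed
  have steps: "((stk (t 0 0), \<sigma> 0), (stk (t 0 j), \<sigma> j)) \<in> step\<^sup>*" if "j \<le> h" for j
    using that
  proof (induction j)
    case (Suc j)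
    then show ?case using run[of j] by (meson Suc_le_lessD Suc_leD rtrancl.rtrancl_into_rtrancl)
  qed simp
  have last: "stk (t 0 h) = []" using Gt h by blast
  have first: "stk (t 0 0) = [c]" using Gbot t0 by blast

  \<comment> \<open>The mark seen from the corner lies in the same rectangle: otherwise the rectangle of the mark
    would have a corner further to the right.\<close>
  have marked: "v \<le> w \<and> \<sigma> 0 k = Suc v"
    if v: "(x0 + int v, y0) \<in> C" "mark k (t v 0) (t (Suc v) 0)" for v k
  proof -
    have mk: "bot (t v 0)" "k \<in> bits (t v 0)" "\<not> rgt (t v 0) \<Longrightarrow> k \<notin> bits (t (Suc v) 0)"
      using v(2) by (auto simp: mark_def)
    have vw: "v \<le> w"
    proof (rule ccontr)
      assume vw: "\<not> v \<le> w"
      have "\<exists>x>x0. (x, y0) \<in> K"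
      proof (rule ccontr)
        assume no: "\<nexists>x. x > x0 \<and> (x, y0) \<in> K"
        \<comment> \<open>Without such a corner the walk to the left from the mark meets no left
          side before column \<open>Suc w\<close>; but column \<open>w\<close> is a right side, so
          column \<open>Suc w\<close> is a left side, hence a corner.\<close>
        have cells: "(x0 + int v - int a, y0) \<in> C \<and> bot (T (x0 + int v - int a) y0)" if "a < v - w" for a
          using that
        proof (induction a)
          case 0
          show ?case using v(1) mk(1) by (simp add: t_def)
        next
          case (Suc a)
          let ?x = "x0 + int v - int a"
          have IH: "(?x, y0) \<in> C" "bot (T ?x y0)" using Suc by auto
          have "?x > x0" using Suc.prems by linarith
          with no have "(?x, y0) \<notin> K" by blast
          with IH have "\<not> lft (T ?x y0)" by (auto simp: K_def corner_def)
          with left[OF IH(1)] IH(2) have "(?x - 1, y0) \<in> C \<and> bot (T (?x - 1) y0)" by blast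
          then show ?case by (simp add: algebra_simps)
        qed
        let ?x = "x0 + int (Suc w)"
        have "x0 + int v - int (v - Suc w) = ?x" using vw by linarith
        with cells[of "v - Suc w"] vw have x: "(?x, y0) \<in> C" "bot (T ?x y0)" by auto
        then have "M (Suc w) 0" by (simp add: M_def)
        then have "lft (T ?x y0)" using Gl[of w 0] w(1) by (simp add: t_def)
        with x have "(?x, y0) \<in> K" by (auto simp: K_def corner_def)
        moreover have "?x > x0" by simp
        ultimately show False using no by blast
      qed
      with K_max show False by force
    qed
    have g0: "M i 0" "rgt (t i 0) \<longleftrightarrow> i = w" "bot (t i 0)" if "i \<le> w" for i
      using grid[of 0, THEN spec, THEN mp, of i] that by simp_all
    have dec: "bits (t (Suc i) 0) \<subseteq> bits (t i 0)" if "i < w" for i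
      using Gbot[of i 0] g0[of i] that by simp
    have anti: "bits (t (i + a) 0) \<subseteq> bits (t i 0)" if "i + a \<le> w" for i a
      using that
    proof (induction a)
      case (Suc a)
      then have "bits (t (i + a) 0) \<subseteq> bits (t i 0)" by simp
      moreover have "bits (t (Suc (i + a)) 0) \<subseteq> bits (t (i + a) 0)" using dec[of "i + a"] Suc.prems by simp
      ultimately show ?case by simp
    qed simp
    have "S 0 k = {..v}"
    proof (intro equalityI subsetI)
      fix i assume "i \<in> {..v}"
      then have "k \<in> bits (t i 0)" using anti[of i "v - i"] vw mk(2) by auto
      then show "i \<in> S 0 k" using \<open>i \<in> {..v}\<close> vw by (auto simp: S_def)
    next
      fix i assume i: "i \<in> S 0 k"
      show "i \<in> {..v}"
      proof (rule ccontr)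
        assume "i \<notin> {..v}"
        then have "v < i" "i \<le> w" "k \<in> bits (t i 0)" using i by (auto simp: S_def)
        then have "k \<in> bits (t (Suc v) 0)" using anti[of "Suc v" "i - Suc v"] by auto
        moreover have "\<not> rgt (t v 0)" using g0(2)[of v] \<open>v < i\<close> \<open>i \<le> w\<close> by auto
        ultimately show False using mk(3) by blast
      qed
    qed
    then show ?thesis using vw by (simp add: \<sigma>_def)
  qed
  have cn: "corner (T x0 y0)" using corner0 by (simp add: corner_def)
  have "mark 0 (t m 0) (t (Suc m) 0)"
    using G[OF I0[OF cn C0]] cn unfolding fits_def t_def by (simp add: algebra_simps)
  with marked[of m 0] I0[OF cn C0] have \<sigma>0: "\<sigma> 0 0 = Suc m" by simp
  have "mark 1 (t n 0) (t (Suc n) 0)"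
    using G[OF I1[OF cn C0]] cn unfolding fits_def t_def by (simp add: algebra_simps)
  with marked[of n 1] I1[OF cn C0] have \<sigma>1: "\<sigma> 0 1 = Suc n" by simp
  have \<sigma>2: "\<sigma> 0 k = 0" if "k \<noteq> 0" "k \<noteq> 1" for k
  proof -
    have "S 0 k = {}" using Gbot[of _ 0] grid[of 0] that unfolding S_def by blast
    then show ?thesis by (simp add: \<sigma>_def)
  qed
  have "\<sigma> 0 = input (Suc m) (Suc n)"
    using \<sigma>0 \<sigma>1 \<sigma>2 by (auto simp: input_def fun_eq_iff)
  with steps[of h] first last show ?thesis by auto
qed

section \<open>From halting runs to tilings\<close>

text \<open>Only the input registers and those incremented somewhere in \<open>c\<close> can become
  nonzero, so finitely many tiles suffice.\<close>

definition regs :: "com \<Rightarrow> nat set" where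
  "regs c = {0, 1} \<union> {i. \<exists>k. Inc i # k \<in> stacks c []}"

definition tiles :: "com \<Rightarrow> tile set" where
  "tiles c = {Tile l r b u k B | l r b u k B. k \<in> insert [] (stacks c []) \<and> B \<subseteq> regs c}"

lemma finite_regs: "finite (regs c)"
proof -
  have "{i. \<exists>k. Inc i # k \<in> stacks c []} \<subseteq> (\<lambda>s. case hd s of Inc i \<Rightarrow> i | _ \<Rightarrow> 0) ` stacks c []"
    by force
  then show ?thesis unfolding regs_def using finite_stacks finite_surj by blast
qed

lemma finite_tiles: "finite (tiles c)"
proof -
  have "tiles c \<subseteq> (\<lambda>(l, r, b, u, k, B). Tile l r b u k B) `
      (UNIV \<times> UNIV \<times> UNIV \<times> UNIV \<times> insert [] (stacks c []) \<times> Pow (regs c))"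
  proof
    fix t assume "t \<in> tiles c"
    then obtain l r b u k B where "t = Tile l r b u k B" "k \<in> insert [] (stacks c [])" "B \<subseteq> regs c"
      unfolding tiles_def by blast
    then show "t \<in> (\<lambda>(l, r, b, u, k, B). Tile l r b u k B) `
      (UNIV \<times> UNIV \<times> UNIV \<times> UNIV \<times> insert [] (stacks c []) \<times> Pow (regs c))"
      by (intro image_eqI[of _ _ "(l, r, b, u, k, B)"]) simp_all
  qed
  moreover have "finite (UNIV \<times> UNIV \<times> UNIV \<times> UNIV \<times> insert [] (stacks c []) \<times> Pow (regs c)
      :: (bool \<times> bool \<times> bool \<times> bool \<times> com list \<times> nat set) set)"
    using finite_regs finite_stacks by (intro finite_cartesian_product) auto
  ultimately show ?thesis by (rule finite_surj[rotated])
qed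

text \<open>In row \<open>j\<close>, register \<open>i\<close> is drawn as the first
  \<open>\<sigma> j i\<close> columns.\<close>

lemma halts_region:
  assumes "(([c], input (Suc m) (Suc n)), ([], \<tau>)) \<in> step\<^sup>*"
  shows "\<exists>T C. region c m n T C \<and> (\<forall>x y. T x y \<in> tiles c)"
proof -
  from assms obtain h f where f: "f 0 = ([c], input (Suc m) (Suc n))" "f h = ([], \<tau>)"
    "\<And>j. j < h \<Longrightarrow> (f j, f (Suc j)) \<in> step"
    unfolding rtrancl_power relpow_fun_conv by blast
  define k where "k j = fst (f j)" for j
  define \<sigma> where "\<sigma> j = snd (f j)" for j
  have k0: "k 0 = [c]" "\<sigma> 0 = input (Suc m) (Suc n)" and kh: "k h = []" using f by (auto simp: k_def \<sigma>_def)
  have st: "k (Suc j) \<in> ctl (k j)" "eff (k j) (\<sigma> j) (\<sigma> (Suc j))" if "j < h" for j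
    using f(3)[OF that] by (auto simp: step_def k_def \<sigma>_def split: prod.splits)
  have kj: "k j \<in> insert [] (stacks c [])" if "j \<le> h" for j
    using that
  proof (induction j)
    case 0
    show ?case using k0 Cons_in_stacks[of c "[]"] by simp
  next
    case (Suc j)
    then have "k j \<in> insert [] (stacks c [])" "k (Suc j) \<in> ctl (k j)" using st by auto
    then show ?case using ctl_stacks by auto
  qed
  have \<sigma>j: "\<sigma> j i = 0" if "j \<le> h" "i \<notin> regs c" for j i
    using that(1)
  proof (induction j)
    case 0
    show ?case using k0 that by (auto simp: input_def regs_def)
  next
    case (Suc j)
    then have IH: "\<sigma> j i = 0" and e: "eff (k j) (\<sigma> j) (\<sigma> (Suc j))" using st by auto
    have i: "k j = Inc a # l \<Longrightarrow> i \<noteq> a" for a l using kj[of j] Suc.prems that(2) by (auto simp: regs_def)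
    show ?case
    proof (cases "k j")
      case (Cons d l)
      with e i IH show ?thesis by (cases d) auto
    qed (use e IH in simp)
  qed
  \<comment> \<open>A generous bound on all register values and both offsets. The columns are
    \<open>0\<close> to \<open>w\<close>, one more than any register value, so \<open>Inc\<close>
    always finds the last column free.\<close>
  define w where "w = (\<Sum>j\<le>h. \<Sum>i\<in>regs c. \<sigma> j i) + m + n"
  have w: "\<sigma> j i \<le> w" if "j \<le> h" for j i
  proof (cases "i \<in> regs c")
    case True
    have "\<sigma> j i \<le> (\<Sum>i\<in>regs c. \<sigma> j i)" using True finite_regs by (intro member_le_sum) auto
    also have "\<dots> \<le> (\<Sum>j\<le>h. \<Sum>i\<in>regs c. \<sigma> j i)" using that by (intro member_le_sum[of j]) auto
    finally show ?thesis by (simp add: w_def)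
  next
    case False
    then show ?thesis using \<sigma>j that by simp
  qed
  have mnw: "m \<le> w" "n \<le> w" by (simp_all add: w_def)
  define C where "C = {0..int w} \<times> {0..int h}"
  \<comment> \<open>The filler tile outside closes its right and upper edges and is no corner, so
    nothing links it to the rectangle; its flags \<open>rgt\<close> and \<open>top\<close> agree
    with the left and bottom sides of the rectangle.\<close>
  define T where "T x y = (if (x, y) \<in> C
    then Tile (x = 0) (x = int w) (y = 0) (y = int h) (k (nat y)) {i. x < int (\<sigma> (nat y) i)}
    else Tile False True False True [] {})" for x y
  have inT: "T x y = Tile (x = 0) (x = int w) (y = 0) (y = int h) (k (nat y)) {i. x < int (\<sigma> (nat y) i)}"
    if "(x, y) \<in> C" for x y
    using that by (simp add: T_def)
  have outT: "T x y = Tile False True False True [] {}" if "(x, y) \<notin> C" for x y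
    using that by (simp add: T_def)
  have cT: "corner (T x y) \<longleftrightarrow> x = 0 \<and> y = 0" for x y
    by (auto simp: T_def corner_def C_def)
  have "region c m n T C"
    unfolding region_def
  proof (intro conjI allI impI ballI)
    show "finite C" "C \<noteq> {}" by (auto simp: C_def)
    show "(x, y) \<in> C \<longleftrightarrow> (x + 1, y) \<in> C" if "\<not> rgt (T x y)" for x y
      using that by (auto simp: T_def C_def split: if_splits)
    show "(x, y) \<in> C \<longleftrightarrow> (x, y + 1) \<in> C" if "\<not> top (T x y)" for x y
      using that by (auto simp: T_def C_def split: if_splits)
    show "(x, y) \<in> C \<longleftrightarrow> (x + int m, y) \<in> C" if "corner (T x y)" for x y
      using that by (auto simp: cT C_def mnw)
    show "(x, y) \<in> C \<longleftrightarrow> (x + int n, y) \<in> C" if "corner (T x y)" for x y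
      using that by (auto simp: cT C_def mnw)
    fix p assume p: "p \<in> C"
    obtain x y where xy: "p = (x, y)" by force
    with p have Cxy: "(x, y) \<in> C" by simp
    define j where "j = nat y"
    have j: "y = int j" "j \<le> h" and x: "0 \<le> x" "x \<le> int w" using Cxy by (auto simp: C_def j_def)
    note t = inT[OF Cxy, folded j_def]
    have r: "T (x + 1) y = Tile (x + 1 = 0) (x + 1 = int w) (y = 0) (y = int h) (k j) {i. x + 1 < int (\<sigma> j i)}"
      if "x \<noteq> int w"
      using inT[of "x + 1" y] that x j by (auto simp: C_def)
    have l: "T (x - 1) y = Tile (x - 1 = 0) (x - 1 = int w) (y = 0) (y = int h) (k j) {i. x - 1 < int (\<sigma> j i)}"
      if "x \<noteq> 0"
      using inT[of "x - 1" y] that x j by (auto simp: C_def)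
    have u: "T x (y + 1) = Tile (x = 0) (x = int w) (y + 1 = 0) (y + 1 = int h) (k (Suc j)) {i. x < int (\<sigma> (Suc j) i)}"
      if "y \<noteq> int h"
    proof -
      have "nat (y + 1) = Suc j" using j by simp
      then show ?thesis using inT[of x "y + 1"] that x j by (auto simp: C_def)
    qed
    have "lft (T x y) \<longleftrightarrow> rgt (T (x - 1) y)"
    proof (cases "x = 0")
      case True
      then show ?thesis using t outT[of "x - 1" y] by (simp add: C_def)
    next
      case False
      then show ?thesis using t l x by simp
    qed
    moreover have "bot (T x y) \<longleftrightarrow> top (T x (y - 1))"
    proof (cases "y = 0")
      case True
      then show ?thesis using t outT[of x "y - 1"] by (simp add: C_def)
    next
      case False
      then have "(x, y - 1) \<in> C" using x j by (auto simp: C_def)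
      then show ?thesis using t inT[of x "y - 1"] False j by simp
    qed
    moreover have "bits_rule (k j) (T x y) (T (x + 1) y) (T x (y + 1)) (T (x - 1) y)" if "y \<noteq> int h"
    proof -
      have jh: "j < h" using j that by simp
      note e = st(2)[OF jh]
      show ?thesis
      proof (cases "k j")
        case Nil
        then show ?thesis using e t u[OF that] by simp
      next
        case (Cons d s)
        show ?thesis
        proof (cases d)
          case (Inc a)
          have e: "\<sigma> (Suc j) = (\<sigma> j)(a := Suc (\<sigma> j a))" using e unfolding Cons Inc by simp
          have "\<sigma> j a \<le> w" using w j by blast
          moreover have "x < int (Suc (\<sigma> j a)) \<longleftrightarrow> x = 0 \<or> a \<in> bits (T (x - 1) y)"
          proof (cases "x = 0")
            case False
            then show ?thesis using l x by auto
          qed simp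
          ultimately show ?thesis unfolding Cons Inc t u[OF that] by (auto simp: e)
        next
          case (Dec a)
          have e: "\<sigma> j a > 0" "\<sigma> (Suc j) = (\<sigma> j)(a := \<sigma> j a - 1)" using e unfolding Cons Dec by simp_all
          have "\<sigma> j a \<le> w" using w j by blast
          then have "x < int (\<sigma> j a - 1) \<longleftrightarrow> x \<noteq> int w \<and> a \<in> bits (T (x + 1) y)"
            using r x e(1) by (cases "x = int w") auto
          with e(1) show ?thesis unfolding Cons Dec t u[OF that] by (auto simp: e(2))
        next
          case (Test a)
          have e: "\<sigma> j a = 0" "\<sigma> (Suc j) = \<sigma> j" using e unfolding Cons Test by simp_all
          then show ?thesis unfolding Cons Test t u[OF that] using x by simp
        next
          case (Seq a b)
          have e: "\<sigma> (Suc j) = \<sigma> j" using e unfolding Cons Seq by simp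
          then show ?thesis unfolding Cons Seq t u[OF that] by simp
        next
          case (Star a)
          have e: "\<sigma> (Suc j) = \<sigma> j" using e unfolding Cons Star by simp
          then show ?thesis unfolding Cons Star t u[OF that] by simp
        qed
      qed
    qed
    moreover have "stk (T x (y + 1)) \<in> ctl (k j)" if "y \<noteq> int h"
      using st(1)[of j] j that u by simp
    moreover have "k j = [c] \<and> bits (T x y) \<subseteq> {0, 1}" if "y = 0"
      using that j k0 t x by (auto simp: input_def split: if_splits)
    moreover have "mark 0 (T x y) (T (x + 1) y)" if "corner (T (x - int m) y)"
    proof -
      have "x = int m" "y = 0" using that by (auto simp: cT)
      then show ?thesis using t r j k0 by (auto simp: mark_def input_def)
    qed
    moreover have "mark 1 (T x y) (T (x + 1) y)" if "corner (T (x - int n) y)"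
    proof -
      have "x = int n" "y = 0" using that by (auto simp: cT)
      then show ?thesis using t r j k0 by (auto simp: mark_def input_def)
    qed
    moreover have "y = int h \<Longrightarrow> k j = []" using kh j by simp
    ultimately have "fits c (T x y) (T (x + 1) y) (T x (y + 1)) (T (x - 1) y) (T x (y - 1))
        (T (x - int m) y) (T (x - int n) y)"
      unfolding fits_def using t r u by auto
    then show "case p of (x, y) \<Rightarrow> fits c (T x y) (T (x + 1) y) (T x (y + 1)) (T (x - 1) y) (T x (y - 1))
        (T (x - int m) y) (T (x - int n) y)"
      using xy by simp
  qed
  moreover have "T x y \<in> tiles c" for x y
  proof (cases "(x, y) \<in> C")
    case True
    then have y: "nat y \<le> h" and x: "0 \<le> x" by (auto simp: C_def)
    have "i \<in> regs c" if "x < int (\<sigma> (nat y) i)" for i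
      using \<sigma>j[OF y, of i] that x by fastforce
    then show ?thesis using kj[OF y] inT[OF True] by (auto simp: tiles_def)
  qed (auto simp: outT tiles_def)
  ultimately show ?thesis by blast
qed

section \<open>Undecidability\<close>

definition pt :: "nat \<Rightarrow> int \<Rightarrow> int \<Rightarrow> int list" where
  "pt d x y = x # y # replicate (d - 2) 0"

definition tile_vs :: "nat \<Rightarrow> nat \<Rightarrow> nat \<Rightarrow> int list list" where
  "tile_vs d m n = [pt d 1 0, pt d 0 1, pt d (int m) 0, pt d (int n) 0]"

definition tile_open :: "(nat \<Rightarrow> tile) \<Rightarrow> nat \<Rightarrow> nat \<Rightarrow> bool" where
  "tile_open dec j q \<longleftrightarrow> [\<not> rgt (dec q), \<not> top (dec q), corner (dec q), corner (dec q)] ! j"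

text \<open>The indices follow \<open>nbs d (tile_vs d m n)\<close>: 1 and 2 are the right and upper
  neighbours, 5 and 6 the left and lower ones, 7 and 8 the starts of the arriving input
  edges.\<close>

definition tile_good :: "com \<Rightarrow> (nat \<Rightarrow> tile) \<Rightarrow> nat list \<Rightarrow> bool" where
  "tile_good c dec qs \<longleftrightarrow> fits c (dec (qs ! 0)) (dec (qs ! 1)) (dec (qs ! 2)) (dec (qs ! 5)) (dec (qs ! 6))
     (dec (qs ! 7)) (dec (qs ! 8))"

lemma vneg_pt: "vneg (pt d x y) = pt d (- x) (- y)"
  by (simp add: vneg_def pt_def)

lemma pt_zero:
  assumes "d \<ge> 2"
  shows "replicate d 0 = pt d 0 0"
proof -
  obtain k where "d = Suc (Suc k)" using assms by (metis Suc_le_D numeral_2_eq_2 Suc_le_mono)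
  then show ?thesis by (simp add: pt_def)
qed

lemma pt_lattice: "d \<ge> 2 \<Longrightarrow> pt d x y \<in> lattice d"
  by (simp add: pt_def lattice_def)

lemma pt_eq_iff: "pt d x y = pt d x' y' \<longleftrightarrow> x = x' \<and> y = y'"
  by (simp add: pt_def)

lemma nbs_tile_vs:
  "d \<ge> 2 \<Longrightarrow> nbs d (tile_vs d m n) = [pt d 0 0, pt d 1 0, pt d 0 1, pt d (int m) 0, pt d (int n) 0,
     pt d (- 1) 0, pt d 0 (- 1), pt d (- int m) 0, pt d (- int n) 0]"
  by (simp add: nbs_def tile_vs_def vneg_pt pt_zero)

lemma vadd_pt: "length r = d - 2 \<Longrightarrow> vadd (x # y # r) (pt d a b) = (x + a) # (y + b) # r"
proof -
  assume "length r = d - 2"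
  then have "map2 (+) r (replicate (d - 2) 0) = r" by (intro nth_equalityI) auto
  then show ?thesis by (simp add: vadd_def pt_def)
qed

text \<open>The bounds keep the offsets \<open>m\<close> and \<open>n\<close> apart from each other,
  from 0 and from the unit step.\<close>

lemma parity_tile:
  assumes "d \<ge> 2" "2 \<le> m" "m < n" "finite Q" "{0, 1} \<subseteq> Q"
  shows "parity d (tile_vs d m n) Q"
proof
  show "distinct (nbs d (tile_vs d m n))"
    using assms by (auto simp: nbs_tile_vs pt_eq_iff)
qed (use assms pt_lattice in \<open>auto simp: tile_vs_def\<close>)

lemma ball_less_4: "(\<forall>j<4. P j) \<longleftrightarrow> P 0 \<and> P 1 \<and> P 2 \<and> P (3 :: nat)"
  by (auto simp: eval_nat_numeral All_less_Suc)

text \<open>All offsets lie in the first two coordinates, so the rest \<open>r\<close> is constant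
  along edges and the condition splits into independent planes.\<close>

lemma closed_good_tile_iff:
  assumes d: "d \<ge> 2"
  shows "closed_good d (tile_vs d m n) (tile_open dec) (tile_good c dec) e C \<longleftrightarrow>
    finite C \<and> C \<noteq> {} \<and> C \<subseteq> lattice d \<and>
    (\<forall>x y r. length r = d - 2 \<longrightarrow> (let T = (\<lambda>x y. dec (e (x # y # r))); P = (\<lambda>x y. x # y # r \<in> C) in
      (\<not> rgt (T x y) \<longrightarrow> (P x y \<longleftrightarrow> P (x + 1) y)) \<and>
      (\<not> top (T x y) \<longrightarrow> (P x y \<longleftrightarrow> P x (y + 1))) \<and>
      (corner (T x y) \<longrightarrow> (P x y \<longleftrightarrow> P (x + int m) y)) \<and>
      (corner (T x y) \<longrightarrow> (P x y \<longleftrightarrow> P (x + int n) y)) \<and>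
      (P x y \<longrightarrow> fits c (T x y) (T (x + 1) y) (T x (y + 1)) (T (x - 1) y) (T x (y - 1))
        (T (x - int m) y) (T (x - int n) y))))"
proof -
  have ball: "(\<forall>z\<in>lattice d. K z) \<longleftrightarrow> (\<forall>x y r. length r = d - 2 \<longrightarrow> K (x # y # r))" for K
  proof
    assume r: "\<forall>x y r. length r = d - 2 \<longrightarrow> K (x # y # r)"
    show "\<forall>z\<in>lattice d. K z"
    proof
      fix z assume "z \<in> lattice d"
      then obtain x y r where "z = x # y # r" "length r = d - 2"
        using d by (cases z; cases "tl z") (auto simp: lattice_def)
      with r show "K z" by blast
    qed
  qed (use d in \<open>auto simp: lattice_def\<close>)
  have len: "length (tile_vs d m n) = 4" by (simp add: tile_vs_def)
  have "(C \<subseteq> lattice d \<and> (\<forall>z\<in>lattice d. \<forall>j<4. tile_open dec j (e z) \<longrightarrow> (z \<in> C \<longleftrightarrow> vadd z (tile_vs d m n ! j) \<in> C)) \<and>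
      (\<forall>z\<in>C. tile_good c dec (map (\<lambda>v. e (vadd z v)) (nbs d (tile_vs d m n))))) \<longleftrightarrow>
    (C \<subseteq> lattice d \<and> (\<forall>z\<in>lattice d. (\<forall>j<4. tile_open dec j (e z) \<longrightarrow> (z \<in> C \<longleftrightarrow> vadd z (tile_vs d m n ! j) \<in> C)) \<and>
      (z \<in> C \<longrightarrow> tile_good c dec (map (\<lambda>v. e (vadd z v)) (nbs d (tile_vs d m n))))))"
    by blast
  also have "\<dots> \<longleftrightarrow> (C \<subseteq> lattice d \<and>
    (\<forall>x y r. length r = d - 2 \<longrightarrow> (let T = (\<lambda>x y. dec (e (x # y # r))); P = (\<lambda>x y. x # y # r \<in> C) in
      (\<not> rgt (T x y) \<longrightarrow> (P x y \<longleftrightarrow> P (x + 1) y)) \<and>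
      (\<not> top (T x y) \<longrightarrow> (P x y \<longleftrightarrow> P x (y + 1))) \<and>
      (corner (T x y) \<longrightarrow> (P x y \<longleftrightarrow> P (x + int m) y)) \<and>
      (corner (T x y) \<longrightarrow> (P x y \<longleftrightarrow> P (x + int n) y)) \<and>
      (P x y \<longrightarrow> fits c (T x y) (T (x + 1) y) (T x (y + 1)) (T (x - 1) y) (T x (y - 1))
        (T (x - int m) y) (T (x - int n) y)))))"
    unfolding ball ball_less_4 tile_open_def tile_good_def nbs_tile_vs[OF d] Let_def
    by (simp add: tile_vs_def vadd_pt nth_Cons' cong: conj_cong)
  finally show ?thesis unfolding closed_good_def len by simp
qed

text \<open>Any plane meeting \<open>C\<close> yields a region. Conversely, \<open>e\<close> repeats
  the tiling in every parallel plane, and the closed set is the copy of the region in the plane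
  through the origin.\<close>

lemma closed_good_iff_halts:
  assumes d: "d \<ge> 2" and enc: "\<forall>t\<in>tiles c. enc t \<in> Q \<and> dec (enc t) = t"
  shows "(\<exists>e C. e \<in> configs d Q \<and> closed_good d (tile_vs d m n) (tile_open dec) (tile_good c dec) e C) \<longleftrightarrow>
    (\<exists>\<tau>. (input (Suc m) (Suc n), \<tau>) \<in> rel c)"
proof
  assume "\<exists>e C. e \<in> configs d Q \<and> closed_good d (tile_vs d m n) (tile_open dec) (tile_good c dec) e C"
  then obtain e C where C: "finite C" "C \<noteq> {}" "C \<subseteq> lattice d"
    and K: "\<And>x y r. length r = d - 2 \<Longrightarrow> (let T = (\<lambda>x y. dec (e (x # y # r))); P = (\<lambda>x y. x # y # r \<in> C) in
      (\<not> rgt (T x y) \<longrightarrow> (P x y \<longleftrightarrow> P (x + 1) y)) \<and>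
      (\<not> top (T x y) \<longrightarrow> (P x y \<longleftrightarrow> P x (y + 1))) \<and>
      (corner (T x y) \<longrightarrow> (P x y \<longleftrightarrow> P (x + int m) y)) \<and>
      (corner (T x y) \<longrightarrow> (P x y \<longleftrightarrow> P (x + int n) y)) \<and>
      (P x y \<longrightarrow> fits c (T x y) (T (x + 1) y) (T x (y + 1)) (T (x - 1) y) (T x (y - 1))
        (T (x - int m) y) (T (x - int n) y)))"
    unfolding closed_good_tile_iff[OF d] by blast
  from C obtain z where z: "z \<in> C" "z \<in> lattice d" by blast
  then obtain x0 y0 r where r: "z = x0 # y0 # r" "length r = d - 2"
    using d by (cases z; cases "tl z") (auto simp: lattice_def)
  define T where "T x y = dec (e (x # y # r))" for x y
  define C' where "C' = (\<lambda>(x, y). x # y # r) -` C"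
  have C': "(x, y) \<in> C' \<longleftrightarrow> x # y # r \<in> C" for x y by (simp add: C'_def)
  note K' = K[OF r(2), unfolded Let_def, folded T_def C']
  have "inj (\<lambda>(x, y). x # y # r)" by (auto simp: inj_def)
  then have fin: "finite C'" unfolding C'_def by (rule finite_vimageI[OF C(1)])
  have ne: "C' \<noteq> {}" using z(1) r(1) C'[of x0 y0] by auto
  have "region c m n T C'"
    unfolding region_def
  proof (intro conjI allI impI ballI)
    show "finite C'" "C' \<noteq> {}" by (rule fin, rule ne)
    show "(x, y) \<in> C' \<longleftrightarrow> (x + 1, y) \<in> C'" if "\<not> rgt (T x y)" for x y using K'[of x y] that by blast
    show "(x, y) \<in> C' \<longleftrightarrow> (x, y + 1) \<in> C'" if "\<not> top (T x y)" for x y using K'[of x y] that by blast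
    show "(x, y) \<in> C' \<longleftrightarrow> (x + int m, y) \<in> C'" if "corner (T x y)" for x y using K'[of x y] that by blast
    show "(x, y) \<in> C' \<longleftrightarrow> (x + int n, y) \<in> C'" if "corner (T x y)" for x y using K'[of x y] that by blast
    fix p assume p: "p \<in> C'"
    obtain x y where xy: "p = (x, y)" by force
    from p have "fits c (T x y) (T (x + 1) y) (T x (y + 1)) (T (x - 1) y) (T x (y - 1))
        (T (x - int m) y) (T (x - int n) y)" unfolding xy using K'[of x y] by blast
    then show "case p of (x, y) \<Rightarrow> fits c (T x y) (T (x + 1) y) (T x (y + 1)) (T (x - 1) y) (T x (y - 1))
        (T (x - int m) y) (T (x - int n) y)" by (simp add: xy)
  qed
  then show "\<exists>\<tau>. (input (Suc m) (Suc n), \<tau>) \<in> rel c"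
    using region_halts steps_iff_rel by blast
next
  assume "\<exists>\<tau>. (input (Suc m) (Suc n), \<tau>) \<in> rel c"
  then obtain T C where reg: "region c m n T C" and T: "\<And>x y. T x y \<in> tiles c"
    using halts_region steps_iff_rel by blast
  have C: "finite C" "C \<noteq> {}"
    and H: "\<And>x y. \<not> rgt (T x y) \<Longrightarrow> (x, y) \<in> C \<longleftrightarrow> (x + 1, y) \<in> C"
    and V: "\<And>x y. \<not> top (T x y) \<Longrightarrow> (x, y) \<in> C \<longleftrightarrow> (x, y + 1) \<in> C"
    and I0: "\<And>x y. corner (T x y) \<Longrightarrow> (x, y) \<in> C \<longleftrightarrow> (x + int m, y) \<in> C"
    and I1: "\<And>x y. corner (T x y) \<Longrightarrow> (x, y) \<in> C \<longleftrightarrow> (x + int n, y) \<in> C"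
    and G: "\<And>x y. (x, y) \<in> C \<Longrightarrow> fits c (T x y) (T (x + 1) y) (T x (y + 1)) (T (x - 1) y) (T x (y - 1))
        (T (x - int m) y) (T (x - int n) y)"
    using reg unfolding region_def by blast+
  define e where "e = (\<lambda>z\<in>lattice d. enc (T (z ! 0) (z ! 1)))"
  define C' where "C' = (\<lambda>(x, y). pt d x y) ` C"
  have "e \<in> configs d Q" using enc T by (auto simp: e_def configs_def)
  moreover have "closed_good d (tile_vs d m n) (tile_open dec) (tile_good c dec) e C'"
    unfolding closed_good_tile_iff[OF d] Let_def
  proof (intro conjI allI impI)
    show "finite C'" "C' \<noteq> {}" "C' \<subseteq> lattice d" using C d pt_lattice by (auto simp: C'_def)
    fix x y :: int and r :: "int list" assume r: "length r = d - 2"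
    have de: "dec (e (x # y # r)) = T x y" for x y
    proof -
      have "Suc (Suc (d - 2)) = d" using d by simp
      then show ?thesis using enc[rule_format, OF T] r by (simp add: e_def lattice_def)
    qed
    have in_C': "x # y # r \<in> C' \<longleftrightarrow> (x, y) \<in> C \<and> r = replicate (d - 2) 0" for x y
      by (auto simp: C'_def pt_def)
    show "x # y # r \<in> C' \<longleftrightarrow> (x + 1) # y # r \<in> C'" if "\<not> rgt (dec (e (x # y # r)))"
      using H that unfolding de in_C' by blast
    show "x # y # r \<in> C' \<longleftrightarrow> x # (y + 1) # r \<in> C'" if "\<not> top (dec (e (x # y # r)))"
      using V that unfolding de in_C' by blast
    show "x # y # r \<in> C' \<longleftrightarrow> (x + int m) # y # r \<in> C'" if "corner (dec (e (x # y # r)))"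
      using I0 that unfolding de in_C' by blast
    show "x # y # r \<in> C' \<longleftrightarrow> (x + int n) # y # r \<in> C'" if "corner (dec (e (x # y # r)))"
      using I1 that unfolding de in_C' by blast
    show "fits c (dec (e (x # y # r))) (dec (e ((x + 1) # y # r))) (dec (e (x # (y + 1) # r)))
        (dec (e ((x - 1) # y # r))) (dec (e (x # (y - 1) # r)))
        (dec (e ((x - int m) # y # r))) (dec (e ((x - int n) # y # r)))" if "x # y # r \<in> C'"
      using G that unfolding de in_C' by blast
  qed
  ultimately show "\<exists>e C. e \<in> configs d Q \<and>
      closed_good d (tile_vs d m n) (tile_open dec) (tile_good c dec) e C"
    by blast
qed

lemma tiles_encoding: "\<exists>enc dec. \<exists>q :: nat. {0, 1} \<subseteq> {..<q} \<and> (\<forall>t\<in>tiles c. enc t \<in> {..<q} \<and> dec (enc t) = t)"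
proof -
  obtain h where h: "bij_betw h (tiles c) {0..<card (tiles c)}"
    using ex_bij_betw_finite_nat[OF finite_tiles] by blast
  \<comment> \<open>Two different tiles guarantee that the outputs 0 and 1 are among the
    states.\<close>
  have "{Tile True True True True [] {}, Tile False True True True [] {}} \<subseteq> tiles c"
    by (auto simp: tiles_def)
  then have "card {Tile True True True True [] {}, Tile False True True True [] {}} \<le> card (tiles c)"
    by (intro card_mono finite_tiles)
  then have "{0, 1} \<subseteq> {..<card (tiles c)}" by simp
  moreover have "h t \<in> {..<card (tiles c)} \<and> inv_into (tiles c) h (h t) = t" if "t \<in> tiles c" for t
    using h that by (auto simp: bij_betw_def inv_into_f_f)
  ultimately show ?thesis by blast
qed

section \<open>Codes as functions of the offsets\<close>

text \<open>Written as arithmetic in \<open>m\<close> and \<open>n\<close>, to be visibly recursive: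
  \<open>int_encode\<close> maps \<open>k\<close> to \<open>2 k\<close>, and \<open>- k\<close> to
  \<open>2 k - 1\<close> for positive \<open>k\<close>.\<close>

definition nbs_code :: "nat \<Rightarrow> nat \<Rightarrow> nat \<Rightarrow> nat" where
  "nbs_code d m n = list_encode [vector_code (pt d 0 0), vector_code (pt d 1 0), vector_code (pt d 0 1),
     list_encode ((m + m) # map int_encode (0 # replicate (d - 2) 0)),
     list_encode ((n + n) # map int_encode (0 # replicate (d - 2) 0)),
     vector_code (pt d (- 1) 0), vector_code (pt d 0 (- 1)),
     list_encode ((m + m - 1) # map int_encode (0 # replicate (d - 2) 0)),
     list_encode ((n + n - 1) # map int_encode (0 # replicate (d - 2) 0))]"

text \<open>\<open>S\<close> and \<open>T\<close> stand for the codes of the states and of the large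
  table, and are treated as opaque numbers. The exponent \<open>Suc 4\<close> counts the four edge
  bits and the private bit.\<close>

definition pair_code :: "nat \<Rightarrow> nat \<Rightarrow> nat \<Rightarrow> nat \<Rightarrow> nat \<Rightarrow> nat" where
  "pair_code d S T m n = prod_encode (
     list_encode [S, list_encode [0, 1], list_encode [], list_encode [vector_code (replicate d 0)], list_encode [0, 1]],
     list_encode [S, list_encode (sorted_list_of_set {..<2 ^ Suc 4}), nbs_code d m n, nbs_code d m n, T])"

lemma nbs_code:
  assumes "d \<ge> 2" "m \<ge> 1" "n \<ge> 1"
  shows "list_encode (map vector_code (nbs d (tile_vs d m n))) = nbs_code d m n"
proof -
  have "int_encode (int k) = k + k" for k
    by (simp add: int_encode_def sum_encode_def)
  moreover have "int_encode (- int k) = k + k - 1" if "k \<ge> 1" for k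
    using that by (simp add: int_encode_def sum_encode_def nat_diff_distrib)
  ultimately show ?thesis
    using assms unfolding nbs_tile_vs[OF assms(1)] nbs_code_def by (simp add: vector_code_def pt_def)
qed

lemma ca_code_coin:
  "ca_code (coin_ca d Q) = list_encode [list_encode (sorted_list_of_set Q), list_encode [0, 1],
     list_encode [], list_encode [vector_code (replicate d 0)], list_encode [0, 1]]"
  by (simp add: ca_code_def coin_ca_def fun_table_def)

text \<open>The table does not depend on the offsets, whence the arbitrary choice \<open>tile_vs d 0 0\<close>.\<close>

lemma ca_code_parity_tile:
  assumes "d \<ge> 2" "m \<ge> 1" "n \<ge> 1"
  shows "ca_code (parity_ca d (tile_vs d m n) opn good Q) = list_encode [list_encode (sorted_list_of_set Q),
     list_encode (sorted_list_of_set {..<2 ^ Suc 4}), nbs_code d m n, nbs_code d m n,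
     list_encode (fun_table (parity_ca d (tile_vs d 0 0) opn good Q))]"
proof -
  have "length (tile_vs d m n) = 4" for m n by (simp add: tile_vs_def)
  moreover have "length (nbs d (tile_vs d m n)) = 9" for m n by (simp add: tile_vs_def nbs_def)
  ultimately show ?thesis
    by (simp add: ca_code_def parity_ca_def fun_table_def nbs_code[OF assms])
qed

text \<open>The arguments are the initial registers \<open>x = S + 3\<close> and
  \<open>y = S + T + 6\<close>, from which \<open>S\<close>, \<open>T\<close> and both offsets are
  recovered.\<close>

lemma rec_fun_pair_code:
  "rec_fun 2 (\<lambda>xs. pair_code d (xs ! 0 - 3) (xs ! 1 - xs ! 0 - 3) (xs ! 0 - 1) (xs ! 1 - 1))"
  unfolding pair_code_def nbs_code_def
  by (intro rec_fun_prod_encode rec_fun_list_encode_Cons rec_fun_const rec_fun_diff rec_fun_add rec_fun_nth)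
    simp_all

section \<open>Diagonalization\<close>

text \<open>\<open>P\<close> is left abstract because both equalities have the same characterization
  by closed good sets.\<close>

lemma undecidable:
  assumes d: "d \<ge> 2"
    and P: "\<And>vs opn good Q. parity d vs Q \<Longrightarrow> P (coin_ca d Q, parity_ca d vs opn good Q) \<longleftrightarrow>
      (\<nexists>e C. e \<in> configs d Q \<and> closed_good d vs opn good e C)"
  shows "\<not> decidable_problem (ca_pairs d) ca_pair_code P"
proof
  assume "decidable_problem (ca_pairs d) ca_pair_code P"
  then obtain p where p: "\<And>A. A \<in> ca_pairs d \<Longrightarrow> evals p [ca_pair_code A] (if P A then 1 else 0)"
    unfolding decidable_problem_def by blast
  define f where "f xs = pair_code d (xs ! 0 - 3) (xs ! 1 - xs ! 0 - 3) (xs ! 0 - 1) (xs ! 1 - 1)" for xs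
  have "rec_fun 2 f" unfolding f_def by (rule rec_fun_pair_code)
  then obtain q where q: "\<And>x y b. evals p [f [x, y]] (if b then 1 else 0) \<Longrightarrow> (\<exists>z. evals q [x, y] z) \<longleftrightarrow> b"
    using halts_iff_accepted by blast
  obtain c where c: "\<And>x y. (\<exists>\<tau>. (input x y, \<tau>) \<in> rel c) \<longleftrightarrow> (\<exists>z. evals q [x, y] z)"
    using evals_program by blast
  obtain enc dec and k :: nat where k: "{0, 1} \<subseteq> {..<k}"
    "\<forall>t\<in>tiles c. enc t \<in> {..<k} \<and> dec (enc t) = t"
    using tiles_encoding[of c] by blast
  let ?Q = "{..<k}"
  let ?G = "\<lambda>m n. parity_ca d (tile_vs d m n) (tile_open dec) (tile_good c dec) ?Q"
  \<comment> \<open>Both numbers are determined by \<open>c\<close> alone: the table is the same for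
    all offsets, so it is taken at 0.\<close>
  define S where "S = list_encode (sorted_list_of_set ?Q)"
  define T where "T = list_encode (fun_table (?G 0 0))"
  \<comment> \<open>Self-reference: the offsets, which are the input of \<open>c\<close>, describe the automaton built from \<open>c\<close>.\<close>
  define m where "m = S + 2"
  define n where "n = S + T + 5"
  let ?A = "(coin_ca d ?Q, ?G m n)"
  interpret parity d "tile_vs d m n" "tile_open dec" "tile_good c dec" ?Q
    using d k by (intro parity_tile) (auto simp: m_def n_def)
  have "ca_pair_code ?A = pair_code d S T m n"
    using d by (simp add: ca_pair_code_def ca_code_coin ca_code_parity_tile pair_code_def S_def T_def m_def n_def)
  also have "\<dots> = f [Suc m, Suc n]"
  proof -
    \<comment> \<open>The summand 2 in \<open>m\<close>, and the 3 by which \<open>n\<close> exceeds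
      \<open>m + T\<close>, give the margin \<open>2 \<le> m\<close> and \<open>m < n\<close>
      required of the offsets.\<close>
    have "Suc m - 3 = S" "Suc n - Suc m - 3 = T" "Suc m - 1 = m" "Suc n - 1 = n"
      by (simp_all add: m_def n_def)
    then show ?thesis by (simp only: f_def nth_Cons_0 nth_Cons_Suc One_nat_def)
  qed
  finally have code: "ca_pair_code ?A = f [Suc m, Suc n]" .
  have "?A \<in> ca_pairs d" using is_stoch_ca_F is_stoch_ca_G by (simp add: ca_pairs_def)
  from q[OF p[OF this, unfolded code]] have "(\<exists>\<tau>. (input (Suc m) (Suc n), \<tau>) \<in> rel c) \<longleftrightarrow> P ?A"
    unfolding c .
  moreover have "P ?A \<longleftrightarrow> \<not> (\<exists>\<tau>. (input (Suc m) (Suc n), \<tau>) \<in> rel c)"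
    by (simp only: P[OF parity_axioms] closed_good_iff_halts[OF d k(2)])
  ultimately show False by blast
qed

theorem corollary4p2:
  fixes d :: nat
  assumes "d \<ge> 2"
  shows "\<not> decidable_problem (ca_pairs d) ca_pair_code (\<lambda>(F, G). nondet_equal d F G) \<and>
         \<not> decidable_problem (ca_pairs d) ca_pair_code (\<lambda>(F, G). stoch_equal d F G)"
proof
  show "\<not> decidable_problem (ca_pairs d) ca_pair_code (\<lambda>(F, G). nondet_equal d F G)"
    using assms by (rule undecidable) (simp add: parity.nondet_equal_iff)
  show "\<not> decidable_problem (ca_pairs d) ca_pair_code (\<lambda>(F, G). stoch_equal d F G)"
    using assms by (rule undecidable) (simp add: parity.stoch_equal_iff)
qed

end
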